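(* Let $G$ be a finite group, $p$ a prime, $N$ a normal subgroup of $G$ and $P$ a Sylow $p$-subgroup of $N$. If every maximal subgroup of $P$ satisfies the $IC$-$\Pi$-property in $G$, then either $|P|=p$ or $N\le Z_{p\mathfrak{U}}(G)$.
   Context: All groups are finite and $p$ is a fixed prime. For a group $A$, $\pi(A)$ denotes the set of prime divisors of $|A|$; for a set $\pi$ of primes, a $\pi$-number is a positive integer all of whose prime divisors lie in $\pi$ (so $1$ is always a $\pi$-number). $\Pi$-property: a subgroup $H$ of $G$ satisfies the $\Pi$-property in $G$ if for every chief factor $L/K$ of $G$, the index $|G/K:N_{G/K}(HK/K\cap L/K)|$ is a $\pi(HK/K\cap L/K)$-number. $IC$-$\Pi$-property: a subgroup $H$ of $G$ satisfies the $IC$-$\Pi$-property in $G$ if the subgroup $H\cap[H,G]$ satisfies the $\Pi$-property in $G$, where $[H,G]$ is the commutator subgroup generated by all $[h,g]$, $h\in H$, $g\in G$. $p\mathfrak{U}$-hypercenter: $Z_{p\mathfrak{U}}(G)$ is the product of all normal subgroups $A$ of $G$ such that every $p$-chief factor of $G$ below $A$ (i.e. every chief factor $L/K$ of $G$ with $L\le A$ and $p$ dividing $|L/K|$) is cyclic. *)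

theory Defs
  imports
    "HOL-Algebra.Algebra"
    "HOL-Algebra.Elementary_Groups"
begin

text \<open>
  Subgroups are represented by their carrier sets. For \<open>K \<subseteq> L\<close> with \<open>K\<close> normal in \<open>G\<close>, the quotient
  \<open>L/K\<close> is the group \<open>G\<lparr>carrier := L\<rparr> Mod K\<close>; its carrier consists of the cosets \<open>K #> x\<close> with
  \<open>x \<in> L\<close> and is therefore literally a subset of the carrier of \<open>G Mod K\<close>.
\<close>

abbreviation quot :: "('a, 'b) monoid_scheme \<Rightarrow> 'a set \<Rightarrow> 'a set \<Rightarrow> 'a set monoid"
  where "quot G L K \<equiv> G\<lparr>carrier := L\<rparr> Mod K"

definition chief_factor :: "('a, 'b) monoid_scheme \<Rightarrow> 'a set \<Rightarrow> 'a set \<Rightarrow> bool"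
  where "chief_factor G L K \<longleftrightarrow>
    L \<lhd> G \<and> K \<lhd> G \<and> K \<subset> L \<and>
    (\<forall>M. M \<lhd> G \<and> K \<subseteq> M \<and> M \<subseteq> L \<longrightarrow> M = K \<or> M = L)"

definition maximal_subgroup :: "'a set \<Rightarrow> ('a, 'b) monoid_scheme \<Rightarrow> bool"
  where "maximal_subgroup M G \<longleftrightarrow>
    subgroup M G \<and> M \<noteq> carrier G \<and>
    (\<forall>K. subgroup K G \<and> M \<subseteq> K \<longrightarrow> K = M \<or> K = carrier G)"

definition sylow_subgroup :: "nat \<Rightarrow> 'a set \<Rightarrow> ('a, 'b) monoid_scheme \<Rightarrow> bool"
  where "sylow_subgroup p P G \<longleftrightarrow>
    subgroup P G \<and> card P = p ^ multiplicity p (order G)"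

definition prime_divisors_card :: "'a set \<Rightarrow> nat set"
  where "prime_divisors_card A = {q. Factorial_Ring.prime q \<and> q dvd card A}"

definition pi_number :: "nat set \<Rightarrow> nat \<Rightarrow> bool"
  where "pi_number \<pi> n \<longleftrightarrow> n > 0 \<and> (\<forall>q. Factorial_Ring.prime q \<and> q dvd n \<longrightarrow> q \<in> \<pi>)"

definition subgroup_index :: "('a, 'b) monoid_scheme \<Rightarrow> 'a set \<Rightarrow> nat"
  where "subgroup_index G H = card (rcosets\<^bsub>G\<^esub> H)"

definition Pi_property :: "('a, 'b) monoid_scheme \<Rightarrow> 'a set \<Rightarrow> bool"
  where "Pi_property G H \<longleftrightarrow>
    (\<forall>L K. chief_factor G L K \<longrightarrow>
      (let A = carrier (quot G (H <#>\<^bsub>G\<^esub> K) K) \<inter> carrier (quot G L K)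
       in pi_number (prime_divisors_card A)
            (subgroup_index (G Mod K) (normalizer (G Mod K) A))))"

text \<open>The convention is \<open>[h, g] = h\<^sup>-\<^sup>1 g\<^sup>-\<^sup>1 h g\<close>. For subgroups \<open>H\<close> and \<open>K\<close>, the other common convention
  \<open>h g h\<^sup>-\<^sup>1 g\<^sup>-\<^sup>1\<close> yields the same generating set.\<close>

definition commutator_subgroup :: "('a, 'b) monoid_scheme \<Rightarrow> 'a set \<Rightarrow> 'a set \<Rightarrow> 'a set"
  where "commutator_subgroup G H K =
    generate G {inv\<^bsub>G\<^esub> h \<otimes>\<^bsub>G\<^esub> inv\<^bsub>G\<^esub> g \<otimes>\<^bsub>G\<^esub> h \<otimes>\<^bsub>G\<^esub> g | h g. h \<in> H \<and> g \<in> K}"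

definition IC_Pi_property :: "('a, 'b) monoid_scheme \<Rightarrow> 'a set \<Rightarrow> bool"
  where "IC_Pi_property G H \<longleftrightarrow> Pi_property G (H \<inter> commutator_subgroup G H (carrier G))"

text \<open>A \<open>p\<close>-chief factor is a chief factor whose order is divisible by \<open>p\<close>; it need not be a \<open>p\<close>-group.\<close>

definition pU_hypercentral :: "nat \<Rightarrow> ('a, 'b) monoid_scheme \<Rightarrow> 'a set \<Rightarrow> bool"
  where "pU_hypercentral p G A \<longleftrightarrow>
    A \<lhd> G \<and>
    (\<forall>L K. chief_factor G L K \<and> L \<subseteq> A \<and> p dvd order (quot G L K) \<longrightarrow>
       cyclic_group (quot G L K))"

text \<open>The product of a family of normal subgroups is the subgroup generated by their union.\<close>

definition pU_hypercenter :: "nat \<Rightarrow> ('a, 'b) monoid_scheme \<Rightarrow> 'a set"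
  where "pU_hypercenter p G = generate G (\<Union>{A. pU_hypercentral p G A})"

end

theory Submission
  imports Defs "HOL-Library.Set_Algebras" "HOL-Number_Theory.Residue_Primitive_Roots"
begin

text \<open>
  Let \<open>T / K\<close> be a chief factor of \<open>G\<close> with \<open>T \<subseteq> N\<close> and \<open>p\<close> dividing its order, \<open>M\<close> a maximal subgroup
  of \<open>P\<close> and \<open>H = M \<inter> [M, G]\<close>. The hypothesis says that the normalizer of \<open>H K \<inter> T\<close> has \<open>p\<close>-power index,
  so its product with any Sylow \<open>p\<close>-subgroup \<open>S\<close> of \<open>G\<close> is \<open>G\<close>. Hence \<open>T / K\<close> is a \<open>p\<close>-group unless
  \<open>H K \<inter> T = K\<close>, and \<open>H K \<inter> T\<close> is normal in \<open>G\<close> as soon as it is \<open>S\<close>-invariant. If \<open>T \<subseteq> [M, G] K\<close> and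
  \<open>P \<inter> K \<subseteq> M\<close>, then \<open>H K \<inter> T = M K \<inter> T\<close>; if not \<open>T \<subseteq> [M, G] K\<close>, then \<open>M K \<inter> T\<close> is normal in \<open>G\<close> because
  \<open>[M K \<inter> T, G] \<subseteq> K\<close>.

  When \<open>P\<close> has order at least \<open>p\<^sup>2\<close>, this yields \<open>\<bar>T / K\<bar> = p\<close> by induction from the top of \<open>N\<close> downwards.
  Suppose first that \<open>\<bar>P : P \<inter> K\<bar> \<ge> p\<^sup>2\<close>. Then some \<open>M\<close> shows that \<open>T / K\<close> is a \<open>p\<close>-group. If \<open>P \<inter> T\<close> is not
  contained in the Frattini subgroup of \<open>P\<close> modulo \<open>K\<close>, one can choose \<open>M\<close> such that \<open>M \<inter> T\<close> is \<open>S\<close>-invariant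
  of index \<open>p\<close> in \<open>P \<inter> T\<close>, so \<open>M K \<inter> T = K\<close>. Otherwise let \<open>X\<close> be the centralizer of all \<open>p\<close>-chief factors
  between \<open>T\<close> and \<open>N\<close>. These have order \<open>p\<close>, so \<open>X\<close> contains \<open>P\<close>, \<open>[G, G]\<close> and all \<open>(p - 1)\<close>-th powers.
  A Frattini argument shows that the \<open>q\<close>-elements of \<open>X\<close>, \<open>q \<noteq> p\<close>, centralize \<open>T / K\<close>; then so does \<open>X\<close>, and
  \<open>T / K\<close> is an irreducible module for an abelian group of exponent dividing \<open>p - 1\<close>, that is, of order \<open>p\<close>.
  If \<open>\<bar>P : P \<inter> K\<bar> = p\<close>, then there is a chief factor \<open>J / E\<close> of order \<open>p\<close> with \<open>J \<subseteq> K\<close>, \<open>P \<inter> J = P \<inter> K\<close> and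
  \<open>\<bar>P : P \<inter> E\<bar> = p\<^sup>2\<close>, and transfer from its centralizer into \<open>P E / E\<close> shows that \<open>T / K\<close> is a \<open>p\<close>-group.
\<close>

text \<open>A maximal subgroup \<open>M\<close> gives information only through
  \<open>H = M \<inter> [M, G]\<close>, and \<open>H K \<inter> T\<close> may collapse to
  \<open>K\<close>. The condition \<open>P \<inter> K \<subseteq> M\<close> prevents a loss: it
  makes \<open>M\<close> a Sylow subgroup of \<open>M K\<close>, so that intersecting with
  \<open>[M, G] K\<close> amounts to replacing \<open>M\<close> by \<open>H\<close>. When
  \<open>P \<inter> K\<close> is itself maximal in \<open>P\<close>, the only such \<open>M\<close>
  lies in \<open>K\<close> and yields nothing; a maximal subgroup not containing
  \<open>P \<inter> K\<close> has to be produced, and this is the purpose of the transfer. If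
  \<open>P\<close> has order \<open>p\<close>, its only maximal subgroup is trivial and the
  hypothesis is void, whence the exception in the theorem. The induction runs downwards because the
  Frattini case needs an abelian action of exponent dividing \<open>p - 1\<close> on the factors
  above. A \<open>p\<close>-chief factor need not be a \<open>p\<close>-group, so two things are
  shown for each of them: that it is a \<open>p\<close>-group, and that its order is
  \<open>p\<close>.\<close>

hide_const (open) Divisibility.prime
no_notation Polynomials.var (\<open>X\<index>\<close>)

section \<open>Subgroups of a group type\<close>

text \<open>Equations between group words in a type class are decided by rewriting, without side conditions
  on carriers. An arbitrary group is embedded into a group type by Cayley's theorem.\<close>

class group_mult = monoid_mult + inverse +
  assumes group_left_inverse [simp]: "inverse a * a = 1"
begin

lemma inverse_mult_cancel [simp]: "inverse a * (a * b) = b"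
  by (simp flip: mult.assoc)

lemma group_right_inverse [simp]: "a * inverse a = 1"
  by (metis group_left_inverse inverse_mult_cancel mult_1_right)

lemma mult_inverse_cancel [simp]: "a * (inverse a * b) = b"
  by (simp flip: mult.assoc)

lemma group_inverse_inverse [simp]: "inverse (inverse a) = a"
  by (metis inverse_mult_cancel group_left_inverse mult_1_right)

lemma group_left_cancel [simp]: "a * b = a * c \<longleftrightarrow> b = c"
  by (metis inverse_mult_cancel)

lemma group_right_cancel [simp]: "b * a = c * a \<longleftrightarrow> b = c"
  by (metis mult.assoc group_right_inverse mult_1_right)

lemma group_inverse_mult: "inverse (a * b) = inverse b * inverse a"
proof -
  have "(a * b) * inverse (a * b) = (a * b) * (inverse b * inverse a)"
    by (simp only: group_right_inverse) (simp add: mult.assoc)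
  then show ?thesis
    by (simp only: group_left_cancel)
qed

lemma group_inverse_one [simp]: "inverse 1 = 1"
  by (metis group_left_inverse mult_1_right)

lemmas group_word = mult.assoc group_inverse_mult

end

lemma group_power_conj: "(g * x * inverse g) ^ n = g * x ^ n * inverse g" for g :: "'g::group_mult"
  by (induction n) (simp_all add: group_word)

definition is_subgroup :: "'g::group_mult set \<Rightarrow> bool"
  where "is_subgroup A \<longleftrightarrow> 1 \<in> A \<and> (\<forall>x\<in>A. \<forall>y\<in>A. x * y \<in> A) \<and> (\<forall>x\<in>A. inverse x \<in> A)"

text \<open>Only an inclusion is asked, and \<open>A\<close> need not lie in \<open>G\<close>, so
  that a Sylow subgroup can be said to normalize any set. Over a subgroup \<open>G\<close> equality
  follows, see \<open>conjugate_normal\<close>.\<close>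

definition normalizes :: "'g::group_mult set \<Rightarrow> 'g set \<Rightarrow> bool"
  where "normalizes G A \<longleftrightarrow> (\<forall>g\<in>G. \<forall>a\<in>A. g * a * inverse g \<in> A)"

definition is_normal :: "'g::group_mult set \<Rightarrow> 'g set \<Rightarrow> bool"
  where "is_normal A G \<longleftrightarrow> is_subgroup A \<and> A \<subseteq> G \<and> normalizes G A"

text \<open>The division is exact only if \<open>A\<close> and \<open>B\<close> are finite subgroups with \<open>A \<subseteq> B\<close>.\<close>

definition idx :: "'g set \<Rightarrow> 'g set \<Rightarrow> nat"
  where "idx B A = card B div card A"

definition conjugate :: "'g::group_mult \<Rightarrow> 'g set \<Rightarrow> 'g set"
  where "conjugate g A = (\<lambda>a. g * a * inverse g) ` A"

lemma is_subgroupD: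
  assumes "is_subgroup A"
  shows "1 \<in> A" "\<And>x y. x \<in> A \<Longrightarrow> y \<in> A \<Longrightarrow> x * y \<in> A" "\<And>x. x \<in> A \<Longrightarrow> inverse x \<in> A"
    "\<And>x n. x \<in> A \<Longrightarrow> x ^ n \<in> A"
proof -
  show *: "1 \<in> A" "\<And>x y. x \<in> A \<Longrightarrow> y \<in> A \<Longrightarrow> x * y \<in> A" "\<And>x. x \<in> A \<Longrightarrow> inverse x \<in> A"
    using assms by (auto simp: is_subgroup_def)
  fix x n assume "x \<in> A"
  then show "x ^ n \<in> A" using *(1,2) by (induction n) auto
qed

lemma is_subgroup_left_iff:
  assumes "is_subgroup A" "x \<in> A"
  shows "x * y \<in> A \<longleftrightarrow> y \<in> A"
  using is_subgroupD(2)[OF assms(1), of "inverse x" "x * y"] assms by (auto simp: is_subgroupD)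

lemma is_subgroup_right_iff:
  assumes "is_subgroup A" "x \<in> A"
  shows "y * x \<in> A \<longleftrightarrow> y \<in> A"
  using is_subgroupD(2)[OF assms(1), of "y * x" "inverse x"] assms by (auto simp: is_subgroupD mult.assoc)

lemma is_subgroup_inverse_iff: "is_subgroup A \<Longrightarrow> inverse x \<in> A \<longleftrightarrow> x \<in> A"
  by (metis group_inverse_inverse is_subgroupD(3))

lemma is_subgroup_Int: "is_subgroup A \<Longrightarrow> is_subgroup B \<Longrightarrow> is_subgroup (A \<inter> B)"
  by (simp add: is_subgroup_def)

lemma is_subgroup_Inter: "(\<And>A. A \<in> \<A> \<Longrightarrow> is_subgroup A) \<Longrightarrow> is_subgroup (\<Inter>\<A>)"
  by (simp add: is_subgroup_def)

lemma normalizesD: "normalizes G A \<Longrightarrow> g \<in> G \<Longrightarrow> a \<in> A \<Longrightarrow> g * a * inverse g \<in> A"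
  by (simp add: normalizes_def)

lemma normalizesD2:
  assumes "normalizes G A" "is_subgroup G" "g \<in> G" "a \<in> A"
  shows "inverse g * a * g \<in> A"
  using normalizesD[OF assms(1), of "inverse g" a] assms by (simp add: is_subgroupD)

lemma normalizes_Int: "normalizes G A \<Longrightarrow> normalizes G B \<Longrightarrow> normalizes G (A \<inter> B)"
  by (simp add: normalizes_def)

lemma normalizes_mono: "normalizes G A \<Longrightarrow> H \<subseteq> G \<Longrightarrow> normalizes H A"
  by (auto simp add: normalizes_def)

lemma normalizes_subgroup: "is_subgroup A \<Longrightarrow> normalizes A A"
  by (simp add: normalizes_def is_subgroup_def)

lemma is_normalD:
  assumes "is_normal A G"
  shows "is_subgroup A" "A \<subseteq> G" "normalizes G A"
  using assms by (simp_all add: is_normal_def)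

lemma is_normal_Int: "is_normal A G \<Longrightarrow> is_normal B G \<Longrightarrow> is_normal (A \<inter> B) G"
  by (auto simp: is_normal_def is_subgroup_Int normalizes_Int)

section \<open>Products of subgroups and the modular law\<close>

lemma set_times_mem: "x \<in> A * B \<longleftrightarrow> (\<exists>a\<in>A. \<exists>b\<in>B. x = a * b)"
  by (simp add: set_times_def)

lemma set_times_superset1: "is_subgroup B \<Longrightarrow> A \<subseteq> A * B"
  by (force simp: set_times_def dest: is_subgroupD(1))

lemma set_times_superset2: "is_subgroup A \<Longrightarrow> B \<subseteq> A * B"
  by (force simp: set_times_def dest: is_subgroupD(1))

lemma set_times_least: "is_subgroup C \<Longrightarrow> A \<subseteq> C \<Longrightarrow> B \<subseteq> C \<Longrightarrow> A * B \<subseteq> C"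
  by (auto simp: set_times_def dest: is_subgroupD(2))

lemma is_subgroup_times:
  assumes A: "is_subgroup A" and B: "is_subgroup B" and n: "normalizes A B"
  shows "is_subgroup (A * B)"
  unfolding is_subgroup_def
proof (intro conjI ballI)
  show "1 \<in> A * B"
    using A B by (metis is_subgroupD(1) mult_1_left set_times_intro)
  fix x assume "x \<in> A * B"
  then obtain a b where x: "a \<in> A" "b \<in> B" "x = a * b" by (auto simp: set_times_mem)
  have "inverse x = inverse a * (a * inverse b * inverse a)"
    by (simp add: x group_word)
  then show "inverse x \<in> A * B"
    using x A B n by (metis is_subgroupD(3) normalizesD set_times_intro)
  fix y assume "y \<in> A * B"
  then obtain c d where y: "c \<in> A" "d \<in> B" "y = c * d" by (auto simp: set_times_mem)
  have "x * y = (a * c) * ((inverse c * b * c) * d)"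
    by (simp add: x y group_word)
  then show "x * y \<in> A * B"
    using x y A B n by (metis is_subgroupD(2) normalizesD2 set_times_intro)
qed

lemma set_times_commute:
  assumes A: "is_subgroup A" and n: "normalizes A B"
  shows "A * B = B * A"
proof (rule Set.set_eqI)
  fix x
  show "x \<in> A * B \<longleftrightarrow> x \<in> B * A"
  proof
    assume "x \<in> A * B"
    then obtain a b where x: "a \<in> A" "b \<in> B" "x = a * b" by (auto simp: set_times_mem)
    then have "x = (a * b * inverse a) * a" by (simp add: group_word)
    then show "x \<in> B * A" using x n by (metis normalizesD set_times_intro)
  next
    assume "x \<in> B * A"
    then obtain a b where x: "a \<in> A" "b \<in> B" "x = b * a" by (auto simp: set_times_mem)
    then have "x = a * (inverse a * b * a)" by (simp add: group_word)
    then show "x \<in> A * B" using x n A by (metis normalizesD2 set_times_intro)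
  qed
qed

lemma normalizes_times:
  assumes "normalizes G A" "normalizes G B"
  shows "normalizes G (A * B)"
  unfolding normalizes_def
proof (intro ballI)
  fix g x assume "g \<in> G" "x \<in> A * B"
  then obtain a b where x: "a \<in> A" "b \<in> B" "x = a * b" by (auto simp: set_times_mem)
  have "g * x * inverse g = (g * a * inverse g) * (g * b * inverse g)"
    by (simp add: x group_word)
  then show "g * x * inverse g \<in> A * B"
    using assms x \<open>g \<in> G\<close> by (metis normalizesD set_times_intro)
qed

lemma is_normal_times:
  assumes "is_normal A G" "is_normal B G" "is_subgroup G"
  shows "is_normal (A * B) G"
proof -
  have "normalizes A B" using assms by (meson is_normalD normalizes_mono)
  then show ?thesis
    using assms by (simp add: is_normal_def is_subgroup_times normalizes_times set_times_least)
qed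

lemma is_subgroup_times_normal:
  assumes "is_subgroup A" "A \<subseteq> G" "is_normal B G"
  shows "is_subgroup (A * B)"
  by (meson assms is_normalD is_subgroup_times normalizes_mono)

lemma dedekind_right:
  assumes "is_subgroup C" "B \<subseteq> C"
  shows "A * B \<inter> C = (A \<inter> C) * B"
proof -
  have "a * b \<in> C \<longleftrightarrow> a \<in> C" if "b \<in> B" for a b
    using that assms by (simp add: is_subgroup_right_iff subset_eq)
  then show ?thesis unfolding set_times_def by blast
qed

lemma dedekind_left:
  assumes "is_subgroup C" "A \<subseteq> C"
  shows "A * B \<inter> C = A * (B \<inter> C)"
proof -
  have "a * b \<in> C \<longleftrightarrow> b \<in> C" if "a \<in> A" for a b
    using that assms by (simp add: is_subgroup_left_iff subset_eq)
  then show ?thesis unfolding set_times_def by blast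
qed

lemma set_times_absorb1: "is_subgroup B \<Longrightarrow> is_subgroup A \<Longrightarrow> A \<subseteq> B \<Longrightarrow> A * B = B"
  by (meson order_refl set_times_least set_times_superset2 subset_antisym)

lemma set_times_absorb2: "is_subgroup B \<Longrightarrow> is_subgroup A \<Longrightarrow> A \<subseteq> B \<Longrightarrow> B * A = B"
  by (meson order_refl set_times_least set_times_superset1 subset_antisym)

text \<open>The product map on \<open>A \<times> B\<close> has fibres of constant size: the pairs
  over \<open>a * b\<close> are the \<open>(a * x, inverse x * b)\<close> with \<open>x\<close> in
  \<open>A \<inter> B\<close>.\<close>

lemma card_times:
  fixes A B :: "'g::group_mult set"
  assumes A: "is_subgroup A" and B: "is_subgroup B" and fin: "finite A" "finite B"
  shows "card (A * B) * card (A \<inter> B) = card A * card B"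
proof -
  have "card (A \<times> B) = (\<Sum>c\<in>A * B. card {(a, b). (a, b) \<in> A \<times> B \<and> a * b = c})"
  proof -
    have "A \<times> B = (\<Union>c\<in>A * B. {(a, b). (a, b) \<in> A \<times> B \<and> a * b = c})"
      by auto
    then have "card (A \<times> B) = card (\<Union>c\<in>A * B. {(a, b). (a, b) \<in> A \<times> B \<and> a * b = c})"
      by (rule arg_cong)
    also have "\<dots> = (\<Sum>c\<in>A * B. card {(a, b). (a, b) \<in> A \<times> B \<and> a * b = c})"
    proof (rule card_UN_disjoint)
      show "finite (A * B)" using fin by (rule finite_set_times)
      show "\<forall>i\<in>A * B. finite {(a, b). (a, b) \<in> A \<times> B \<and> a * b = i}"
        by (intro ballI, rule finite_subset[of _ "A \<times> B"]) (use fin in auto)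
    qed auto
    finally show ?thesis .
  qed
  also have "\<dots> = (\<Sum>c\<in>A * B. card (A \<inter> B))"
  proof (rule sum.cong)
    fix c assume "c \<in> A * B"
    then obtain a b where c: "a \<in> A" "b \<in> B" "c = a * b" by (auto simp: set_times_mem)
    have "bij_betw (\<lambda>x. (a * x, inverse x * b)) (A \<inter> B) {(a, b). (a, b) \<in> A \<times> B \<and> a * b = c}"
      unfolding bij_betw_def
    proof
      show "inj_on (\<lambda>x. (a * x, inverse x * b)) (A \<inter> B)"
        by (simp add: inj_on_def)
      show "(\<lambda>x. (a * x, inverse x * b)) ` (A \<inter> B) = {(a, b). (a, b) \<in> A \<times> B \<and> a * b = c}"
      proof
        show "(\<lambda>x. (a * x, inverse x * b)) ` (A \<inter> B) \<subseteq> {(a, b). (a, b) \<in> A \<times> B \<and> a * b = c}"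
          using c A B by (auto simp: is_subgroupD group_word)
        show "{(a, b). (a, b) \<in> A \<times> B \<and> a * b = c} \<subseteq> (\<lambda>x. (a * x, inverse x * b)) ` (A \<inter> B)"
        proof
          fix z assume "z \<in> {(a, b). (a, b) \<in> A \<times> B \<and> a * b = c}"
          then obtain a' b' where z: "z = (a', b')" and h: "a' \<in> A" "b' \<in> B" "a' * b' = c"
            by auto
          have "a' = a' * b' * inverse b'" by (simp add: group_word)
          also have "\<dots> = a * b * inverse b'" using h c by simp
          finally have e: "inverse a * a' = b * inverse b'" by (simp add: group_word)
          have "inverse a * a' \<in> A" using A h(1) c(1) by (simp add: is_subgroupD)
          moreover have "inverse a * a' \<in> B"
            unfolding e using B h(2) c(2) by (simp add: is_subgroupD)
          ultimately have 1: "inverse a * a' \<in> A \<inter> B" by simp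
          have 2: "inverse (inverse a * a') * b = b'"
            unfolding e group_inverse_mult group_inverse_inverse mult.assoc group_left_inverse by (rule mult_1_right)
          show "z \<in> (\<lambda>x. (a * x, inverse x * b)) ` (A \<inter> B)"
            by (rule image_eqI[OF _ 1]) (simp add: 2 z)
        qed
      qed
    qed
    then show "card {(a, b). (a, b) \<in> A \<times> B \<and> a * b = c} = card (A \<inter> B)"
      by (rule bij_betw_same_card[symmetric])
  qed simp
  finally show ?thesis
    by (simp add: card_cartesian_product)
qed

section \<open>Cosets, Lagrange's theorem and indices\<close>

definition left_cosets :: "'g::group_mult set \<Rightarrow> 'g set \<Rightarrow> 'g set set"
  where "left_cosets B A = (\<lambda>b. b *o A) ` B"

lemma elt_set_times_mem: "x \<in> a *o A \<longleftrightarrow> inverse a * x \<in> A" for a :: "'g::group_mult"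
proof
  assume "inverse a * x \<in> A"
  then show "x \<in> a *o A" unfolding elt_set_times_def by (intro CollectI bexI[of _ "inverse a * x"]) simp_all
qed (auto simp: elt_set_times_def)

lemma left_coset_eq_iff:
  assumes "is_subgroup A"
  shows "a *o A = b *o A \<longleftrightarrow> inverse a * b \<in> A"
proof
  assume "a *o A = b *o A"
  moreover have "b \<in> b *o A" using assms by (simp add: elt_set_times_mem is_subgroupD)
  ultimately show "inverse a * b \<in> A" by (metis elt_set_times_mem)
next
  assume h: "inverse a * b \<in> A"
  show "a *o A = b *o A"
  proof (rule Set.set_eqI)
    fix x
    have "inverse a * x = (inverse a * b) * (inverse b * x)" by (simp add: group_word)
    then show "x \<in> a *o A \<longleftrightarrow> x \<in> b *o A"
      using assms h by (metis elt_set_times_mem is_subgroup_left_iff)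
  qed
qed

lemma elt_set_times_eq_image: "a *o A = (*) a ` A"
  by (auto simp: elt_set_times_def)

lemma card_left_coset: "card (a *o A) = card A" for a :: "'g::group_mult"
  by (simp add: elt_set_times_eq_image card_image inj_on_def)

lemma card_left_cosets:
  assumes A: "is_subgroup A" and B: "is_subgroup B" and AB: "A \<subseteq> B" and fin: "finite B"
  shows "card B = card (left_cosets B A) * card A"
proof -
  have "card A * card (left_cosets B A) = card (\<Union>(left_cosets B A))"
  proof (rule card_partition)
    show "finite (left_cosets B A)" using fin by (simp add: left_cosets_def)
    show "finite (\<Union> (left_cosets B A))"
      using fin finite_subset[OF AB fin] by (simp add: left_cosets_def elt_set_times_eq_image)
    show "\<And>c. c \<in> left_cosets B A \<Longrightarrow> card c = card A"
      by (auto simp: left_cosets_def card_left_coset)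
    fix c1 c2 assume h: "c1 \<in> left_cosets B A" "c2 \<in> left_cosets B A" "c1 \<noteq> c2"
    then obtain a b where ab: "c1 = a *o A" "c2 = b *o A" by (auto simp: left_cosets_def)
    have False if "x \<in> c1" "x \<in> c2" for x
    proof -
      have "a *o A = x *o A" "b *o A = x *o A" 
        using that by (simp_all add: ab elt_set_times_mem left_coset_eq_iff[OF A])
      then show False using h ab by simp
    qed
    then show "c1 \<inter> c2 = {}" by blast
  qed
  moreover have "\<Union>(left_cosets B A) = B"
  proof
    show "\<Union>(left_cosets B A) \<subseteq> B"
      using AB B by (auto simp: left_cosets_def elt_set_times_def is_subgroupD subset_eq)
    show "B \<subseteq> \<Union>(left_cosets B A)"
      using A by (auto simp: left_cosets_def elt_set_times_mem is_subgroupD)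
  qed
  ultimately show ?thesis by (simp add: mult.commute)
qed

lemma card_subgroup_pos: "is_subgroup A \<Longrightarrow> finite A \<Longrightarrow> card A > 0"
  by (metis card_gt_0_iff empty_iff is_subgroupD(1))

lemma lagrange_idx:
  assumes "is_subgroup A" "is_subgroup B" "A \<subseteq> B" "finite B"
  shows "card B = idx B A * card A"
  unfolding idx_def using card_left_cosets[OF assms] by simp

lemma card_left_cosets_idx:
  assumes "is_subgroup A" "is_subgroup B" "A \<subseteq> B" "finite B"
  shows "card (left_cosets B A) = idx B A"
proof -
  have "card A > 0" using assms by (meson card_subgroup_pos finite_subset)
  then show ?thesis unfolding idx_def using card_left_cosets[OF assms] by simp
qed

lemma idx_mult:
  assumes "is_subgroup A" "is_subgroup B" "is_subgroup C" "A \<subseteq> B" "B \<subseteq> C" "finite C"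
  shows "idx C A = idx C B * idx B A"
proof -
  have "card C = idx C B * card B" "card B = idx B A * card A"
    using assms by (meson lagrange_idx finite_subset)+
  moreover have "card A > 0" using assms by (meson card_subgroup_pos finite_subset)
  ultimately show ?thesis unfolding idx_def[of C A] by simp
qed

lemma idx_pos:
  assumes "is_subgroup A" "is_subgroup B" "A \<subseteq> B" "finite B"
  shows "idx B A > 0"
  using lagrange_idx[OF assms] card_subgroup_pos[OF assms(2,4)] by (metis gr0I mult_is_0 nat_less_le)

lemma idx_self: "is_subgroup A \<Longrightarrow> finite A \<Longrightarrow> idx A A = 1"
  using card_subgroup_pos[of A] unfolding idx_def by (intro div_self) linarith

lemma idx_eq_1:
  assumes "is_subgroup A" "is_subgroup B" "A \<subseteq> B" "finite B" "idx B A = 1"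
  shows "A = B"
  using lagrange_idx[OF assms(1-4)] assms by (simp add: card_subset_eq)

text \<open>The second isomorphism theorem at the level of orders. \<open>A * B\<close> may fail to
  be a subgroup, but \<open>card_times\<close> still makes its order a multiple of
  \<open>card B\<close>, so the division in \<open>idx\<close> is exact.\<close>

lemma idx_times:
  fixes A B :: "'g::group_mult set"
  assumes "is_subgroup A" "is_subgroup B" "finite A" "finite B"
  shows "idx (A * B) B = idx A (A \<inter> B)"
proof -
  have 1: "card (A * B) * card (A \<inter> B) = card A * card B" by (rule card_times[OF assms])
  have 2: "card A = idx A (A \<inter> B) * card (A \<inter> B)"
    by (rule lagrange_idx) (use assms in \<open>auto simp: is_subgroup_Int\<close>)
  have "card (A \<inter> B) > 0" using assms by (simp add: card_subgroup_pos is_subgroup_Int)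
  then have "card (A * B) = idx A (A \<inter> B) * card B" using 1 2 by simp
  then show ?thesis using assms by (simp add: idx_def card_subgroup_pos)
qed

lemma idx_dvd_trans:
  assumes "is_subgroup A" "is_subgroup B" "is_subgroup C" "A \<subseteq> B" "B \<subseteq> C" "finite C"
  shows "idx C B dvd idx C A" "idx B A dvd idx C A"
  using idx_mult[OF assms] by simp_all

section \<open>Conjugates and normalizers\<close>

lemma conjugate_one [simp]: "conjugate 1 A = A"
  by (simp add: conjugate_def)

lemma conjugate_conjugate: "conjugate g (conjugate h A) = conjugate (g * h) A"
  by (simp add: conjugate_def image_image group_word)

lemma conjugate_mem: "x \<in> conjugate g A \<longleftrightarrow> inverse g * x * g \<in> A"
  unfolding conjugate_def
proof
  assume "inverse g * x * g \<in> A"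
  then show "x \<in> (\<lambda>a. g * a * inverse g) ` A"
    by (rule rev_image_eqI) (simp add: group_word)
qed (auto simp: group_word)

lemma card_conjugate [simp]: "card (conjugate g A) = card A"
  by (simp add: conjugate_def card_image inj_on_def)

lemma conjugate_mono: "A \<subseteq> B \<Longrightarrow> conjugate g A \<subseteq> conjugate g B"
  by (auto simp: conjugate_def)

lemma is_subgroup_conjugate:
  assumes A: "is_subgroup A"
  shows "is_subgroup (conjugate g A)"
  unfolding is_subgroup_def conjugate_mem
proof (intro conjI ballI)
  show "inverse g * 1 * g \<in> A" using A by (simp add: is_subgroupD)
  fix x assume x: "x \<in> conjugate g A"
  have "inverse g * inverse x * g = inverse (inverse g * x * g)" by (simp add: group_word)
  then show "inverse g * inverse x * g \<in> A" using A x by (simp only: is_subgroupD conjugate_mem)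
  fix y assume y: "y \<in> conjugate g A"
  have "inverse g * (x * y) * g = (inverse g * x * g) * (inverse g * y * g)" by (simp add: group_word)
  then show "inverse g * (x * y) * g \<in> A" using A x y by (simp only: is_subgroupD conjugate_mem)
qed

lemma conjugate_normal:
  assumes "normalizes G A" "is_subgroup G" "g \<in> G"
  shows "conjugate g A = A"
proof (rule Set.set_eqI)
  fix x
  have "x = g * (inverse g * x * g) * inverse g" by (simp add: group_word)
  then show "x \<in> conjugate g A \<longleftrightarrow> x \<in> A"
    unfolding conjugate_mem using assms by (metis normalizesD normalizesD2)
qed

lemma conjugate_times: "conjugate g (A * B) = conjugate g A * conjugate g B"
proof (rule Set.set_eqI)
  fix x
  show "x \<in> conjugate g (A * B) \<longleftrightarrow> x \<in> conjugate g A * conjugate g B"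
  proof
    assume "x \<in> conjugate g (A * B)"
    then obtain a b where "a \<in> A" "b \<in> B" "x = g * (a * b) * inverse g"
      by (auto simp: conjugate_def set_times_mem)
    moreover have "g * (a * b) * inverse g = (g * a * inverse g) * (g * b * inverse g)"
      by (simp add: group_word)
    ultimately show "x \<in> conjugate g A * conjugate g B"
      unfolding conjugate_def by (metis imageI set_times_intro)
  next
    assume "x \<in> conjugate g A * conjugate g B"
    then obtain a b where "a \<in> A" "b \<in> B" "x = (g * a * inverse g) * (g * b * inverse g)"
      by (auto simp: conjugate_def set_times_mem)
    moreover have "g * (a * b) * inverse g = (g * a * inverse g) * (g * b * inverse g)"
      by (simp add: group_word)
    ultimately show "x \<in> conjugate g (A * B)"
      unfolding conjugate_def by (metis image_eqI set_times_intro)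
  qed
qed

lemma conjugate_subset: "is_subgroup G \<Longrightarrow> g \<in> G \<Longrightarrow> A \<subseteq> G \<Longrightarrow> conjugate g A \<subseteq> G"
  by (auto simp: conjugate_def is_subgroupD subset_eq)

lemma conjugate_swap: "conjugate g A = B \<longleftrightarrow> A = conjugate (inverse g) B"
  by (metis conjugate_conjugate conjugate_one group_left_inverse group_right_inverse)

lemma finite_conjugate [simp]: "finite A \<Longrightarrow> finite (conjugate g A)"
  by (simp add: conjugate_def)

definition normalizer_in :: "'g::group_mult set \<Rightarrow> 'g set \<Rightarrow> 'g set"
  where "normalizer_in G A = {g \<in> G. conjugate g A = A}"

lemma is_subgroup_normalizer_in:
  assumes "is_subgroup G"
  shows "is_subgroup (normalizer_in G A)"
  unfolding is_subgroup_def
proof (intro conjI ballI)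
  show "1 \<in> normalizer_in G A" using assms by (simp add: normalizer_in_def is_subgroupD)
  fix x assume x: "x \<in> normalizer_in G A"
  then show "inverse x \<in> normalizer_in G A"
    using assms conjugate_swap[of x A A] by (simp add: normalizer_in_def is_subgroupD)
  fix y assume "y \<in> normalizer_in G A"
  with x show "x * y \<in> normalizer_in G A"
    using assms conjugate_conjugate[of x y A] by (simp add: normalizer_in_def is_subgroupD)
qed

section \<open>Sylow subgroups and \<open>p\<close>-groups\<close>

lemma card_fibres:
  assumes "finite A" "\<And>y. y \<in> f ` A \<Longrightarrow> card {a \<in> A. f a = y} = k"
  shows "card A = card (f ` A) * k"
proof -
  have "card A = (\<Sum>a\<in>A. 1)" by simp
  also have "\<dots> = (\<Sum>y\<in>f ` A. \<Sum>a\<in>{a \<in> A. f a = y}. 1)"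
    by (rule sum.image_gen[OF assms(1)])
  also have "\<dots> = (\<Sum>y\<in>f ` A. k)"
    by (rule sum.cong) (use assms(2) in auto)
  finally show ?thesis by simp
qed

definition prime_power_of :: "nat \<Rightarrow> nat \<Rightarrow> bool"
  where "prime_power_of p n \<longleftrightarrow> (\<exists>k. n = p ^ k)"

lemma prime_power_of_dvd: "prime p \<Longrightarrow> prime_power_of p n \<Longrightarrow> m dvd n \<Longrightarrow> prime_power_of p m" for p :: nat
  unfolding prime_power_of_def using divides_primepow_nat by blast

lemma prime_power_of_eq_1: "prime_power_of p n \<Longrightarrow> \<not> p dvd n \<Longrightarrow> n = 1"
  unfolding prime_power_of_def by (metis dvd_power gr0I power_0)

lemma prime_power_of_self: "prime_power_of p p"
  unfolding prime_power_of_def by (metis power_one_right)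

lemma prime_power_ofI:
  fixes p n :: nat
  assumes "n > 0" "\<And>q. prime q \<Longrightarrow> q dvd n \<Longrightarrow> q = p" "prime p"
  shows "prime_power_of p n"
proof -
  have "prime_factors n \<subseteq> {p}" using assms by (auto simp: prime_factors_dvd)
  then have "n = p ^ multiplicity p n"
    using prime_factorization_nat[of n] assms(1)
    by (cases "prime_factors n = {}") (auto simp: subset_singleton_iff prime_factorization_empty_iff)
  then show ?thesis unfolding prime_power_of_def by blast
qed

text \<open>A point that is not fixed has an orbit of length greater than 1, and this length divides
  \<open>card Q\<close>, so it is divisible by \<open>p\<close>. These orbits partition the
  complement of the fixed points.\<close>

lemma fixed_points_mod_prime:
  fixes Q :: "'g::group_mult set" and act :: "'g \<Rightarrow> 'x \<Rightarrow> 'x"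
  assumes p: "prime p" and Q: "is_subgroup Q" "finite Q" "prime_power_of p (card Q)"
    and fin: "finite \<Omega>"
    and closed: "\<And>g x. g \<in> Q \<Longrightarrow> x \<in> \<Omega> \<Longrightarrow> act g x \<in> \<Omega>"
    and one: "\<And>x. x \<in> \<Omega> \<Longrightarrow> act 1 x = x"
    and mult: "\<And>g h x. g \<in> Q \<Longrightarrow> h \<in> Q \<Longrightarrow> x \<in> \<Omega> \<Longrightarrow> act (g * h) x = act g (act h x)"
  shows "card \<Omega> mod p = card {x \<in> \<Omega>. \<forall>g\<in>Q. act g x = x} mod p"
proof -
  define F where "F = {x \<in> \<Omega>. \<forall>g\<in>Q. act g x = x}"
  define orb where "orb = (\<lambda>x. (\<lambda>g. act g x) ` Q)"
  have inv: "act (inverse g) (act g x) = x" if "g \<in> Q" "x \<in> \<Omega>" for g x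
    using mult[of "inverse g" g x] one Q that by (simp add: is_subgroupD)
  have orb_sub: "orb x \<subseteq> \<Omega>" if "x \<in> \<Omega>" for x
    using that closed by (auto simp: orb_def)
  have self: "x \<in> orb x" if "x \<in> \<Omega>" for x
    unfolding orb_def using that one Q by (intro image_eqI[of _ _ 1]) (simp_all add: is_subgroupD)
  have orb_eq: "orb y = orb x" if x: "x \<in> \<Omega>" and y: "y \<in> orb x" for x y
  proof -
    obtain g where g: "g \<in> Q" "y = act g x" using y by (auto simp: orb_def)
    have "act h y \<in> orb x" if "h \<in> Q" for h
      unfolding orb_def using that g x mult[of h g x] Q
      by (intro image_eqI[of _ _ "h * g"]) (simp_all add: is_subgroupD)
    moreover have "act h x \<in> orb y" if "h \<in> Q" for h
    proof -
      have "act (h * inverse g) y = act h x"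
        using mult[of h "inverse g" y] that g x Q inv closed by (simp add: is_subgroupD)
      then show ?thesis
        unfolding orb_def using that g Q
        by (intro image_eqI[of _ _ "h * inverse g"]) (simp_all add: is_subgroupD)
    qed
    ultimately show ?thesis by (auto simp: orb_def)
  qed
  have dvd: "p dvd card (orb x)" if x: "x \<in> \<Omega> - F" for x
  proof -
    define St where "St = {g \<in> Q. act g x = x}"
    have "card Q = card (orb x) * card St"
      unfolding orb_def
    proof (rule card_fibres)
      fix y assume "y \<in> (\<lambda>g. act g x) ` Q"
      then obtain g where g: "g \<in> Q" "y = act g x" by auto
      have "{a \<in> Q. act a x = y} = (*) g ` St"
      proof (intro Set.set_eqI iffI)
        fix a assume a: "a \<in> {a \<in> Q. act a x = y}"
        then have "act (inverse g * a) x = x"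
          using g x inv mult[of "inverse g" a x] Q by (simp add: is_subgroupD)
        then show "a \<in> (*) g ` St"
          using a g Q by (intro image_eqI[of _ _ "inverse g * a"]) (simp_all add: St_def is_subgroupD)
      next
        fix a assume "a \<in> (*) g ` St"
        then show "a \<in> {a \<in> Q. act a x = y}"
          using g x Q mult by (auto simp: St_def is_subgroupD)
      qed
      then show "card {a \<in> Q. act a x = y} = card St"
        by (simp add: card_image inj_on_def)
    qed (use Q in simp)
    then have pp: "prime_power_of p (card (orb x))"
      using prime_power_of_dvd[OF p Q(3)] by simp
    show ?thesis
    proof (rule ccontr)
      assume "\<not> p dvd card (orb x)"
      then have "card (orb x) = 1" using pp prime_power_of_eq_1 by blast
      then obtain z where "orb x = {z}" by (auto simp: card_1_singleton_iff)
      then have "orb x = {x}" using self[of x] x by auto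
      then show False using x by (auto simp: F_def orb_def)
    qed
  qed
  have U: "\<Union>(orb ` (\<Omega> - F)) = \<Omega> - F"
  proof
    show "\<Union>(orb ` (\<Omega> - F)) \<subseteq> \<Omega> - F"
    proof clarify
      fix x y assume x: "x \<in> \<Omega>" "x \<notin> F" and y: "y \<in> orb x"
      have "y \<notin> F"
      proof
        assume "y \<in> F"
        then have "orb y = {y}" using self[of y] by (auto simp: F_def orb_def)
        then have "orb x = {y}" using orb_eq[OF x(1) y] by simp
        then have "x = y" using self[of x] x by auto
        then show False using x \<open>y \<in> F\<close> by simp
      qed
      then show "y \<in> \<Omega> - F" using orb_sub[OF x(1)] y by auto
    qed
    show "\<Omega> - F \<subseteq> \<Union>(orb ` (\<Omega> - F))" using self by auto
  qed
  have "p dvd card (\<Union>(orb ` (\<Omega> - F)))"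
  proof (rule dvd_partition)
    show "finite (\<Union>(orb ` (\<Omega> - F)))" using U fin by simp
    show "\<forall>c\<in>orb ` (\<Omega> - F). p dvd card c" using dvd by auto
    show "\<forall>c1\<in>orb ` (\<Omega> - F). \<forall>c2\<in>orb ` (\<Omega> - F). c1 \<noteq> c2 \<longrightarrow> c1 \<inter> c2 = {}"
    proof (intro ballI impI)
      fix c1 c2 assume h: "c1 \<in> orb ` (\<Omega> - F)" "c2 \<in> orb ` (\<Omega> - F)" "c1 \<noteq> c2"
      then obtain x y where xy: "x \<in> \<Omega>" "y \<in> \<Omega>" "c1 = orb x" "c2 = orb y" by auto
      have False if "z \<in> c1" "z \<in> c2" for z
        using that orb_eq[of x z] orb_eq[of y z] xy h by simp
      then show "c1 \<inter> c2 = {}" by blast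
    qed
  qed
  then have "p dvd card (\<Omega> - F)" by (simp only: U)
  moreover have "card \<Omega> = card F + card (\<Omega> - F)"
  proof -
    have "F \<subseteq> \<Omega>" by (auto simp: F_def)
    then show ?thesis using fin by (simp add: card_Diff_subset finite_subset card_mono)
  qed
  ultimately show ?thesis unfolding F_def[symmetric] by (metis add.right_neutral mod_add_right_eq mod_0_imp_dvd dvd_imp_mod_0)
qed

text \<open>In this form both conditions pass to products and intersections by divisibility of
  indices alone.\<close>

definition is_sylow :: "nat \<Rightarrow> 'g::group_mult set \<Rightarrow> 'g set \<Rightarrow> bool"
  where "is_sylow p S X \<longleftrightarrow> is_subgroup S \<and> S \<subseteq> X \<and> prime_power_of p (card S) \<and> \<not> p dvd idx X S"

lemma is_sylowD:
  assumes "is_sylow p S X"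
  shows "is_subgroup S" "S \<subseteq> X" "prime_power_of p (card S)" "\<not> p dvd idx X S"
  using assms by (simp_all add: is_sylow_def)

text \<open>\<open>Q\<close> acts on the cosets of \<open>C\<close> by left multiplication; their
  number is prime to \<open>p\<close>, so some \<open>x *o C\<close> is fixed. A Sylow subgroup as
  \<open>C\<close> gives conjugacy; a larger \<open>C\<close>, built from a normalizer, is used in
  \<open>sylow_centralizes_frattini\<close>.\<close>

lemma subgroup_in_conjugate:
  fixes X :: "'g::group_mult set"
  assumes p: "prime p" and X: "is_subgroup X" "finite X"
    and C: "is_subgroup C" "C \<subseteq> X" "\<not> p dvd idx X C"
    and Q: "is_subgroup Q" "Q \<subseteq> X" "prime_power_of p (card Q)"
  shows "\<exists>x\<in>X. Q \<subseteq> conjugate x C"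
proof -
  have "card (left_cosets X C) mod p = card {c \<in> left_cosets X C. \<forall>g\<in>Q. g *o c = c} mod p"
  proof (rule fixed_points_mod_prime[OF p Q(1) _ Q(3)])
    show "finite Q" using X Q finite_subset by blast
    show "finite (left_cosets X C)" using X by (simp add: left_cosets_def)
    fix g x assume "g \<in> Q" "x \<in> left_cosets X C"
    then show "g *o x \<in> left_cosets X C"
      using X Q by (auto simp: left_cosets_def set_times_rearrange2 is_subgroupD)
  next
    fix g h :: 'g and x :: "'g set" assume "x \<in> left_cosets X C"
    show "1 *o x = x" by (simp add: elt_set_times_eq_image)
    show "(g * h) *o x = g *o (h *o x)" by (simp add: set_times_rearrange2)
  qed
  moreover have "\<not> p dvd card (left_cosets X C)"
    using C X by (simp add: card_left_cosets_idx)
  ultimately have "card {c \<in> left_cosets X C. \<forall>g\<in>Q. g *o c = c} \<noteq> 0"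
    by (metis dvd_eq_mod_eq_0 mod_0)
  then have "{c \<in> left_cosets X C. \<forall>g\<in>Q. g *o c = c} \<noteq> {}" by (metis card.empty)
  then obtain c where "c \<in> left_cosets X C" and c: "\<And>g. g \<in> Q \<Longrightarrow> g *o c = c"
    by blast
  then obtain x where x: "x \<in> X" "c = x *o C" by (auto simp: left_cosets_def)
  have "g \<in> conjugate x C" if "g \<in> Q" for g
  proof -
    have "(g * x) *o C = x *o C" using c[OF that] by (simp add: x set_times_rearrange2)
    then have "x *o C = (g * x) *o C" ..
    then have "inverse x * (g * x) \<in> C" using left_coset_eq_iff[OF C(1)] by blast
    then show ?thesis by (simp add: conjugate_mem mult.assoc)
  qed
  then show ?thesis using x by blast
qed

lemma sylow_exists:
  fixes X :: "'g::group_mult set"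
  assumes p: "prime p" and X: "is_subgroup X" "finite X"
  shows "\<exists>S. is_sylow p S X"
proof -
  let ?G = "\<lparr>carrier = X, monoid.mult = (*), one = 1\<rparr>"
  have G: "group ?G"
  proof (rule groupI)
    fix x assume "x \<in> carrier ?G"
    then show "\<exists>y\<in>carrier ?G. y \<otimes>\<^bsub>?G\<^esub> x = \<one>\<^bsub>?G\<^esub>"
      using X by (intro bexI[of _ "inverse x"]) (simp_all add: is_subgroupD)
  qed (use X in \<open>simp_all add: is_subgroupD mult.assoc\<close>)
  define a where "a = multiplicity p (card X)"
  have "card X \<noteq> 0" using card_subgroup_pos[OF X] by linarith
  then obtain m where m: "card X = p ^ a * m" "\<not> p dvd m"
    unfolding a_def using multiplicity_decompose'[of "card X" p] p by (metis not_prime_unit)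
  obtain H where H: "subgroup H ?G" "card H = p ^ a"
    using sylow_thm[OF p G, of a m] m X by (auto simp: order_def)
  have HX: "H \<subseteq> X" using subgroup.subset[OF H(1)] by simp
  have "is_subgroup H"
    unfolding is_subgroup_def
  proof (intro conjI ballI)
    show "1 \<in> H" using subgroup.one_closed[OF H(1)] by simp
    fix x assume x: "x \<in> H"
    have "inv\<^bsub>?G\<^esub> x = inverse x"
      by (rule group.inv_equality[OF G]) (use x HX X in \<open>auto simp: is_subgroupD\<close>)
    then show "inverse x \<in> H" using subgroup.m_inv_closed[OF H(1) x] by simp
    fix y assume y: "y \<in> H"
    show "x * y \<in> H" using subgroup.m_closed[OF H(1) x y] by simp
  qed
  moreover have "idx X H = m"
    using m H p by (simp add: idx_def prime_gt_0_nat)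
  ultimately have "is_sylow p H X"
    using HX H m unfolding is_sylow_def prime_power_of_def by blast
  then show ?thesis by blast
qed

lemma sylow_contains:
  assumes "prime p" "is_subgroup X" "finite X" "is_subgroup Q" "Q \<subseteq> X" "prime_power_of p (card Q)"
  shows "\<exists>S. is_sylow p S X \<and> Q \<subseteq> S"
proof -
  obtain S where S: "is_sylow p S X" using sylow_exists assms by blast
  obtain x where x: "x \<in> X" "Q \<subseteq> conjugate x S"
    using subgroup_in_conjugate[of p X S Q] assms is_sylowD[OF S] by blast
  have "is_sylow p (conjugate x S) X"
    using is_sylowD[OF S] x assms
    by (simp add: is_sylow_def is_subgroup_conjugate conjugate_subset idx_def)
  then show ?thesis using x by blast
qed

lemma sylow_card_le:
  assumes "prime p" "is_subgroup X" "finite X" "is_sylow p S X"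
    and "is_subgroup Q" "Q \<subseteq> X" "prime_power_of p (card Q)"
  shows "card Q \<le> card S"
proof -
  obtain x where x: "x \<in> X" "Q \<subseteq> conjugate x S"
    using subgroup_in_conjugate[of p X S Q] assms is_sylowD[OF assms(4)] by blast
  have "finite S" using is_sylowD(2)[OF assms(4)] assms(3) finite_subset by blast
  then have "card Q \<le> card (conjugate x S)"
    using x by (intro card_mono) simp_all
  then show ?thesis by simp
qed

text \<open>The index of \<open>S \<inter> A\<close> in \<open>A\<close> equals the index of
  \<open>S\<close> in \<open>S * A\<close>, which divides the index of \<open>S\<close> in
  \<open>X\<close>.\<close>

lemma sylow_Int_normal:
  assumes p: "prime p" and X: "is_subgroup X" "finite X" and S: "is_sylow p S X" and A: "is_normal A X"
  shows "is_sylow p (S \<inter> A) A"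
proof -
  note S' = is_sylowD[OF S] and A' = is_normalD[OF A]
  have fin: "finite A" "finite S" using X S' A' finite_subset by blast+
  have sub: "is_subgroup (S * A)"
    using is_subgroup_times_normal[OF S'(1,2) A] .
  have SA: "A * S = S * A"
    using set_times_commute[OF S'(1), of A] A'(3) S'(2) normalizes_mono by metis
  have "idx (A * S) S = idx A (A \<inter> S)" using idx_times A' S' fin by blast
  then have "idx A (S \<inter> A) = idx (S * A) S" by (simp add: SA Int_commute)
  moreover have "idx (S * A) S dvd idx X S"
    by (rule idx_dvd_trans(2))
      (use S' A' sub X set_times_superset1 in \<open>simp_all add: set_times_least\<close>)
  ultimately have "\<not> p dvd idx A (S \<inter> A)" using S'(4) dvd_trans by metis
  moreover have "prime_power_of p (card (S \<inter> A))"
  proof -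
    have "card (S \<inter> A) dvd card S"
      using lagrange_idx[of "S \<inter> A" S] S' A' fin by (simp add: is_subgroup_Int)
    then show ?thesis using prime_power_of_dvd[OF p S'(3)] by blast
  qed
  ultimately show ?thesis using S' A' by (simp add: is_sylow_def is_subgroup_Int)
qed

lemma sylow_times_normal:
  assumes p: "prime p" and X: "is_subgroup X" "finite X" and S: "is_sylow p S X"
    and K: "is_normal K X" and pp: "prime_power_of p (idx X K)"
  shows "X = S * K"
proof -
  note S' = is_sylowD[OF S] and K' = is_normalD[OF K]
  have sub: "is_subgroup (S * K)" "S * K \<subseteq> X"
    using is_subgroup_times_normal[OF S'(1,2) K] S' K' X by (simp_all add: set_times_least)
  have "idx X (S * K) dvd idx X S"
    by (rule idx_dvd_trans(1)) (use S' K' sub X set_times_superset1 in simp_all)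
  moreover have "idx X (S * K) dvd idx X K"
    by (rule idx_dvd_trans(1)) (use S' K' sub X set_times_superset2 in simp_all)
  ultimately have "idx X (S * K) = 1"
    using S'(4) prime_power_of_eq_1[OF prime_power_of_dvd[OF p pp]] dvd_trans by blast
  then show ?thesis using idx_eq_1 sub X by blast
qed

text \<open>Conjugacy of Sylow subgroups in the shape of the Frattini argument: \<open>g\<close> may
  lie outside \<open>A\<close> and is replaced by an element inside.\<close>

lemma frattini_conjugate:
  assumes p: "prime p" and A: "is_subgroup A" "finite A" and S: "is_sylow p S A" and g: "conjugate g S \<subseteq> A"
  shows "\<exists>a\<in>A. conjugate g S = conjugate a S"
proof -
  note S' = is_sylowD[OF S]
  obtain a where a: "a \<in> A" "conjugate g S \<subseteq> conjugate a S"
    using subgroup_in_conjugate[OF p A S'(1,2,4), of "conjugate g S"] S' g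
    by (auto simp: is_subgroup_conjugate)
  have "finite S" using S' A finite_subset by blast
  then have "conjugate g S = conjugate a S"
    using a by (intro card_subset_eq) simp_all
  then show ?thesis using a by blast
qed

section \<open>Cyclic subgroups and orders modulo a subgroup\<close>

definition cyc :: "'g::group_mult \<Rightarrow> 'g set"
  where "cyc x = range (\<lambda>n. x ^ n)"

lemma cyc_self: "x \<in> cyc x" and power_in_cyc: "x ^ n \<in> cyc x"
  unfolding cyc_def by (rule range_eqI[of _ _ 1], simp) (rule range_eqI, rule refl)

lemma cyc_subset: "is_subgroup G \<Longrightarrow> x \<in> G \<Longrightarrow> cyc x \<subseteq> G"
  by (auto simp: cyc_def is_subgroupD)

lemma power_eq_one_exists:
  assumes "is_subgroup G" "finite G" "x \<in> G"
  shows "\<exists>n>0. x ^ n = 1"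
proof -
  have "\<not> inj (\<lambda>n. x ^ n)"
  proof
    assume "inj (\<lambda>n. x ^ n)"
    then have "infinite (range (\<lambda>n. x ^ n))" by (rule range_inj_infinite)
    then show False using cyc_subset[OF assms(1,3)] assms(2) finite_subset unfolding cyc_def by blast
  qed
  then obtain i j where "x ^ i = x ^ j" "i \<noteq> j" by (auto simp: inj_def)
  then obtain i j where ij: "x ^ i = x ^ j" "i < j" by (metis linorder_neqE_nat)
  have "x ^ i * x ^ (j - i) = x ^ j" using ij(2) by (simp flip: power_add)
  then have "x ^ i * x ^ (j - i) = x ^ i * 1" using ij by simp
  then have "x ^ (j - i) = 1" by (simp only: group_left_cancel)
  then show ?thesis using ij by (intro exI[of _ "j - i"]) simp
qed

lemma is_subgroup_cyc:
  assumes "is_subgroup G" "finite G" "x \<in> G"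
  shows "is_subgroup (cyc x)"
  unfolding is_subgroup_def
proof (intro conjI ballI)
  show "1 \<in> cyc x" using power_in_cyc[of x 0] by simp
  fix y assume "y \<in> cyc x"
  then obtain k where k: "y = x ^ k" by (auto simp: cyc_def)
  obtain n where n: "n > 0" "x ^ n = 1" using power_eq_one_exists[OF assms] by blast
  have "n * k = k + k * (n - 1)" using n(1) by (cases n) simp_all
  then have "y * x ^ (k * (n - 1)) = x ^ (n * k)" by (simp only: k power_add)
  also have "\<dots> = 1" by (simp add: power_mult n)
  also have "\<dots> = y * inverse y" by simp
  finally have "x ^ (k * (n - 1)) = inverse y" by (simp only: group_left_cancel)
  then show "inverse y \<in> cyc x" using power_in_cyc by metis
  fix z assume "z \<in> cyc x"
  then obtain l where "z = x ^ l" by (auto simp: cyc_def)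
  then show "y * z \<in> cyc x" using power_in_cyc[of x "k + l"] by (simp add: k power_add)
qed

text \<open>\<open>m\<close> is the order of \<open>x\<close> modulo \<open>K\<close>. Having it as
  a condition on exponents and as an index at once turns statements about indices into divisibility
  of exponents.\<close>

lemma relative_order:
  assumes G: "is_subgroup G" "finite G" "x \<in> G" and K: "is_subgroup K" "K \<subseteq> G" "is_subgroup (cyc x * K)"
  shows "\<exists>m>0. (\<forall>n. x ^ n \<in> K \<longleftrightarrow> m dvd n) \<and> idx (cyc x * K) K = m"
proof -
  define m where "m = (LEAST m. m > 0 \<and> x ^ m \<in> K)"
  obtain n where "n > 0" "x ^ n = 1" using power_eq_one_exists[OF G] by blast
  then have ex: "n > 0 \<and> x ^ n \<in> K" using K by (simp add: is_subgroupD)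
  have m: "m > 0" "x ^ m \<in> K" using LeastI[of "\<lambda>m. m > 0 \<and> x ^ m \<in> K", OF ex] by (simp_all add: m_def)
  have least: "\<not> (0 < k \<and> x ^ k \<in> K)" if "k < m" for k
    using not_less_Least that unfolding m_def by blast
  have *: "x ^ n \<in> K \<longleftrightarrow> x ^ (n mod m) \<in> K" for n
  proof -
    have "x ^ n = x ^ (m * (n div m)) * x ^ (n mod m)" by (simp flip: power_add)
    moreover have "x ^ (m * (n div m)) \<in> K" using m K by (simp add: power_mult is_subgroupD)
    ultimately show ?thesis using is_subgroup_left_iff K(1) by metis
  qed
  have dvd: "x ^ n \<in> K \<longleftrightarrow> m dvd n" for n
  proof
    assume "m dvd n" then show "x ^ n \<in> K" using m K by (auto simp: power_mult is_subgroupD elim!: dvdE)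
  next
    assume "x ^ n \<in> K"
    then have "x ^ (n mod m) \<in> K" using * by blast
    then show "m dvd n" using least[of "n mod m"] m by (auto simp: dvd_eq_mod_eq_0)
  qed
  have sub: "cyc x * K \<subseteq> G" using set_times_least cyc_subset G K by metis
  have fin: "finite (cyc x * K)" using sub G finite_subset by blast
  have "left_cosets (cyc x * K) K = (\<lambda>i. x ^ i *o K) ` {..<m}"
  proof (intro equalityI subsetI)
    fix c assume "c \<in> left_cosets (cyc x * K) K"
    then obtain n k where k: "k \<in> K" "c = (x ^ n * k) *o K"
      by (auto simp: left_cosets_def cyc_def set_times_mem)
    have "x ^ n = x ^ (n mod m) * x ^ (m * (n div m))" by (simp flip: power_add)
    then have "inverse (x ^ (n mod m)) * (x ^ n * k) = x ^ (m * (n div m)) * k" by (simp add: mult.assoc)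
    moreover have "x ^ (m * (n div m)) * k \<in> K" using m k K by (simp add: power_mult is_subgroupD)
    ultimately have "c = x ^ (n mod m) *o K" using left_coset_eq_iff[OF K(1)] k(2) by metis
    then show "c \<in> (\<lambda>i. x ^ i *o K) ` {..<m}" using m by simp
  next
    fix c assume "c \<in> (\<lambda>i. x ^ i *o K) ` {..<m}"
    then show "c \<in> left_cosets (cyc x * K) K"
      unfolding left_cosets_def using set_times_superset1[OF K(1), of "cyc x"] power_in_cyc[of x] by blast
  qed
  moreover have "inj_on (\<lambda>i. x ^ i *o K) {..<m}"
  proof (rule linorder_inj_onI)
    fix i j assume ij: "i < j" "i \<in> {..<m}" "j \<in> {..<m}"
    have "inverse (x ^ i) * x ^ j = x ^ (j - i)"
    proof -
      have "x ^ j = x ^ i * x ^ (j - i)" using ij by (simp flip: power_add)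
      then show ?thesis by simp
    qed
    moreover have "\<not> m dvd j - i" using ij by (auto dest: dvd_imp_le)
    ultimately show "x ^ i *o K \<noteq> x ^ j *o K" using left_coset_eq_iff[OF K(1)] dvd by metis
  qed auto
  ultimately have "card (left_cosets (cyc x * K) K) = m" by (simp add: card_image)
  moreover have "is_subgroup (cyc x)" using is_subgroup_cyc G by blast
  ultimately have "idx (cyc x * K) K = m"
    using card_left_cosets_idx[OF K(1,3) _ fin] set_times_superset2 by metis
  then show ?thesis using m dvd by blast
qed

lemma power_idx_mem:
  assumes X: "is_subgroup X" "finite X" and K: "is_normal K X" and x: "x \<in> X"
  shows "x ^ idx X K \<in> K"
proof -
  note K' = is_normalD[OF K]
  have c: "is_subgroup (cyc x)" "cyc x \<subseteq> X" using is_subgroup_cyc cyc_subset X x by blast+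
  have s: "is_subgroup (cyc x * K)" using is_subgroup_times_normal c K by blast
  obtain m where m: "\<And>n. x ^ n \<in> K \<longleftrightarrow> m dvd n" "idx (cyc x * K) K = m"
    using relative_order[OF X x K'(1,2) s] by blast
  have "idx (cyc x * K) K dvd idx X K"
    by (rule idx_dvd_trans(2))
      (use K' s X set_times_superset2[OF c(1)] set_times_least[OF X(1) c(2) K'(2)] in auto)
  then show ?thesis using m by simp
qed

lemma power_card_eq_one:
  assumes "is_subgroup X" "finite X" "x \<in> X"
  shows "x ^ card X = 1"
proof -
  have "is_normal {1} X" using assms by (simp add: is_normal_def is_subgroup_def normalizes_def)
  from power_idx_mem[OF assms(1,2) this assms(3)] show ?thesis by (simp add: idx_def)
qed

lemma coprime_powers_mem:
  assumes "is_subgroup K" "x ^ a \<in> K" "x ^ b \<in> K" "coprime a b"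
  shows "x \<in> K"
proof (cases "a = 0")
  case True
  then show ?thesis using assms by simp
next
  case False
  obtain u v where "a * u = b * v + gcd a b" using bezout_nat[OF False] by blast
  then have "x ^ (a * u) = x ^ (b * v) * x" using assms by (simp add: power_commutes)
  moreover have "x ^ (a * u) \<in> K" "x ^ (b * v) \<in> K" using assms by (simp_all add: power_mult is_subgroupD)
  ultimately show ?thesis using is_subgroup_left_iff assms(1) by metis
qed

section \<open>Maximal subgroups of finite \<open>p\<close>-groups\<close>

definition maxsub :: "'g::group_mult set \<Rightarrow> 'g set \<Rightarrow> bool"
  where "maxsub M P \<longleftrightarrow> is_subgroup M \<and> M \<subset> P \<and>
    (\<forall>U. is_subgroup U \<and> M \<subseteq> U \<and> U \<subseteq> P \<longrightarrow> U = M \<or> U = P)"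

lemma maxsubD:
  assumes "maxsub M P"
  shows "is_subgroup M" "M \<subseteq> P" "M \<noteq> P"
    "\<And>U. is_subgroup U \<Longrightarrow> M \<subseteq> U \<Longrightarrow> U \<subseteq> P \<Longrightarrow> U = M \<or> U = P"
  using assms by (auto simp: maxsub_def)

lemma maxsub_exists:
  assumes "finite P" "is_subgroup A" "A \<subset> P"
  shows "\<exists>M. maxsub M P \<and> A \<subseteq> M"
proof -
  let ?F = "{U. is_subgroup U \<and> A \<subseteq> U \<and> U \<subset> P}"
  have "finite ?F" by (rule finite_subset[of _ "Pow P"]) (use assms in auto)
  moreover have "?F \<noteq> {}" using assms by auto
  ultimately obtain M where "M \<in> ?F" "\<forall>U\<in>?F. M \<subseteq> U \<longrightarrow> M = U"
    using finite_has_maximal[of ?F] by auto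
  then show ?thesis by (intro exI[of _ M]) (auto simp: maxsub_def)
qed

lemma maxsub_of_prime_idx:
  assumes p: "prime p" and P: "is_subgroup P" "finite P" and M: "is_subgroup M" "M \<subseteq> P" "idx P M = p"
  shows "maxsub M P"
  unfolding maxsub_def
proof (intro conjI allI impI)
  show "M \<subset> P" using M p idx_self[OF P] by (metis not_prime_1 psubsetI)
  fix U assume U: "is_subgroup U \<and> M \<subseteq> U \<and> U \<subseteq> P"
  then have "idx P U * idx U M = p" using idx_mult[of M U P] M P by simp
  then have "idx P U = 1 \<or> idx U M = 1" using p by (metis prime_product)
  moreover have "finite U" using U P finite_subset by blast
  ultimately show "U = M \<or> U = P" using U M P idx_eq_1 by metis
qed (fact M)

text \<open>\<open>M\<close> acts on the cosets of \<open>M\<close> in \<open>P\<close> by left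
  multiplication. The number of fixed cosets is divisible by \<open>p\<close>, and \<open>M\<close>
  itself is fixed; so a second coset \<open>x *o M\<close> is fixed, which says that
  \<open>x\<close> normalizes \<open>M\<close>.\<close>

lemma p_group_normalizer_grows:
  assumes p: "prime p" and P: "is_subgroup P" "finite P" "prime_power_of p (card P)"
    and M: "is_subgroup M" "M \<subset> P"
  shows "\<exists>x\<in>P - M. conjugate x M = M"
proof -
  have fin: "finite M" using M P finite_subset by blast
  have MP: "M \<subseteq> P" using M by blast
  have lag: "card P = idx P M * card M" using lagrange_idx M P by blast
  have "card (left_cosets P M) mod p = card {c \<in> left_cosets P M. \<forall>g\<in>M. g *o c = c} mod p"
  proof (rule fixed_points_mod_prime[OF p M(1) fin])
    show "prime_power_of p (card M)" using prime_power_of_dvd[OF p P(3)] lag by simp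
    show "finite (left_cosets P M)" using P by (simp add: left_cosets_def)
    fix g x assume "g \<in> M" "x \<in> left_cosets P M"
    then show "g *o x \<in> left_cosets P M"
      using P MP by (auto simp: left_cosets_def set_times_rearrange2 is_subgroupD)
  next
    fix g h :: 'a and x :: "'a set" assume "x \<in> left_cosets P M"
    show "1 *o x = x" by (simp add: elt_set_times_eq_image)
    show "(g * h) *o x = g *o (h *o x)" by (simp add: set_times_rearrange2)
  qed
  moreover have "p dvd card (left_cosets P M)"
  proof (rule ccontr)
    assume "\<not> p dvd card (left_cosets P M)"
    then have "\<not> p dvd idx P M" using card_left_cosets_idx[OF M(1) P(1) MP P(2)] by simp
    moreover have "prime_power_of p (idx P M)" using prime_power_of_dvd[OF p P(3)] lag by simp
    ultimately have "idx P M = 1" using prime_power_of_eq_1 by blast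
    then show False using idx_eq_1 M P MP by blast
  qed
  ultimately have "p dvd card {c \<in> left_cosets P M. \<forall>g\<in>M. g *o c = c}" by (simp add: dvd_eq_mod_eq_0)
  moreover have one: "1 *o M \<in> {c \<in> left_cosets P M. \<forall>g\<in>M. g *o c = c}"
  proof -
    have "g *o M = 1 *o M" if "g \<in> M" for g
      using left_coset_eq_iff[OF M(1), of g 1] that M(1) by (simp only: mult_1_right is_subgroupD)
    then have "g *o (1 *o M) = 1 *o M" if "g \<in> M" for g
      using that by (simp add: set_times_rearrange2)
    moreover have "1 *o M \<in> left_cosets P M" using P by (simp add: left_cosets_def is_subgroupD)
    ultimately show ?thesis by simp
  qed
  ultimately have "{c \<in> left_cosets P M. \<forall>g\<in>M. g *o c = c} \<noteq> {1 *o M}"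
    using p by (metis is_singletonI is_singleton_altdef nat_dvd_1_iff_1 not_prime_1)
  then obtain c where c: "c \<in> left_cosets P M" "\<And>g. g \<in> M \<Longrightarrow> g *o c = c" "c \<noteq> 1 *o M"
    using one by blast
  then obtain x where x: "x \<in> P" "c = x *o M" by (auto simp: left_cosets_def)
  have "x \<notin> M" using c(3) x left_coset_eq_iff[OF M(1), of 1 x] by auto
  have "conjugate (inverse x) M \<subseteq> M"
  proof
    fix y assume "y \<in> conjugate (inverse x) M"
    then obtain g where g: "g \<in> M" "y = inverse x * g * x" by (auto simp: conjugate_def)
    have "x *o M = (g * x) *o M" using c(2)[OF g(1)] by (simp add: x set_times_rearrange2)
    then have "inverse x * (g * x) \<in> M" using left_coset_eq_iff[OF M(1)] by blast
    then show "y \<in> M" by (simp add: g mult.assoc)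
  qed
  then have "conjugate (inverse x) M = M" using fin by (intro card_subset_eq) simp_all
  then have "conjugate x M = M" using conjugate_swap[of x M M] by simp
  then show ?thesis using x \<open>x \<notin> M\<close> by blast
qed

lemma normalizes_if_conjugate: "(\<And>g. g \<in> G \<Longrightarrow> conjugate g A = A) \<Longrightarrow> normalizes G A"
  unfolding normalizes_def conjugate_def by blast

lemma normalizes_cyc:
  assumes "conjugate x A = A"
  shows "normalizes (cyc x) A"
proof -
  have "conjugate (x ^ n) A = A" for n
    using assms by (induction n) (simp_all flip: conjugate_conjugate)
  then show ?thesis by (intro normalizes_if_conjugate) (auto simp: cyc_def)
qed

lemma p_group_maxsub:
  assumes p: "prime p" and P: "is_subgroup P" "finite P" "prime_power_of p (card P)" and M: "maxsub M P"
  shows "normalizes P M" "idx P M = p"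
proof -
  note M' = maxsubD[OF M]
  obtain x where x: "x \<in> P" "x \<notin> M" "conjugate x M = M"
    using p_group_normalizer_grows[OF p P M'(1)] M' by auto
  have MN: "M \<subseteq> normalizer_in P M"
    using conjugate_normal[OF normalizes_subgroup[OF M'(1)] M'(1)] M'(2) by (auto simp: normalizer_in_def)
  have "normalizer_in P M = P"
    using M'(4)[OF is_subgroup_normalizer_in[OF P(1)] MN] x by (auto simp: normalizer_in_def)
  then have conj: "conjugate g M = M" if "g \<in> P" for g using that by (auto simp: normalizer_in_def)
  then show n: "normalizes P M" by (rule normalizes_if_conjugate)
  obtain k where k: "card P = p ^ k" using P by (auto simp: prime_power_of_def)
  have ex: "x ^ (p ^ k) \<in> M" using power_card_eq_one[OF P(1,2) x(1)] k M' by (simp add: is_subgroupD)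
  \<comment> \<open>The last of the powers \<open>x ^ (p ^ i)\<close> outside \<open>M\<close> has
    its \<open>p\<close>-th power in \<open>M\<close>, and together with \<open>M\<close> it
    generates \<open>P\<close>. So the index of \<open>M\<close> is its order modulo
    \<open>M\<close>.\<close>
  define j where "j = (LEAST j. x ^ (p ^ j) \<in> M)"
  have j: "x ^ (p ^ j) \<in> M" using LeastI[of "\<lambda>j. x ^ (p ^ j) \<in> M", OF ex] by (simp add: j_def)
  have "j \<noteq> 0" using j x by (metis power_0 power_one_right)
  then obtain i where i: "j = Suc i" by (metis not0_implies_Suc)
  define y where "y = x ^ (p ^ i)"
  have yM: "y \<notin> M" unfolding y_def using not_less_Least[of i "\<lambda>j. x ^ (p ^ j) \<in> M"] i by (simp add: j_def)
  have yp: "y ^ p \<in> M" using j by (simp add: y_def i mult.commute flip: power_mult)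
  have yP: "y \<in> P" using x P by (simp add: y_def is_subgroupD)
  have c: "is_subgroup (cyc y)" "cyc y \<subseteq> P" using is_subgroup_cyc cyc_subset P yP by blast+
  have s: "is_subgroup (cyc y * M)"
    using is_subgroup_times[OF c(1) M'(1)] normalizes_cyc[OF conj[OF yP]] by blast
  have "cyc y * M = P"
    using M'(4)[OF s set_times_superset2[OF c(1)] set_times_least[OF P(1) c(2) M'(2)]]
      set_times_superset1[OF M'(1), of "cyc y"] cyc_self[of y] yM by blast
  moreover obtain m where m: "\<And>n. y ^ n \<in> M \<longleftrightarrow> m dvd n" "idx (cyc y * M) M = m"
    using relative_order[OF P(1,2) yP M'(1,2) s] by blast
  moreover have "m dvd p" "m \<noteq> 1" using m(1)[of p] m(1)[of 1] yp yM by auto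
  ultimately show "idx P M = p" using p by (metis prime_nat_iff)
qed

text \<open>This is the other convention than in \<open>commutator_subgroup\<close>; it makes conjugation by \<open>x\<close> left
  multiplication by a commutator.\<close>

definition commutator :: "'g::group_mult \<Rightarrow> 'g \<Rightarrow> 'g"
  where "commutator x y = x * y * inverse x * inverse y"

lemma commutator_inverse: "inverse (commutator x y) = commutator y x"
  by (simp add: commutator_def group_word)

lemma conj_eq_commutator: "x * y * inverse x = commutator x y * y"
  by (simp add: commutator_def group_word)

lemma commutator_mem_commute: "is_subgroup K \<Longrightarrow> commutator x y \<in> K \<longleftrightarrow> commutator y x \<in> K"
  using is_subgroup_inverse_iff[of K "commutator x y"] by (simp add: commutator_inverse)

text \<open>A group that is cyclic modulo a central subgroup is abelian, read modulo
  \<open>F\<close>: an \<open>x\<close> outside \<open>M\<close> generates \<open>P\<close> over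
  \<open>M\<close>, so \<open>y = x ^ i * m\<close>, and the commutator of \<open>x\<close> with
  \<open>y\<close> is a conjugate of the one with \<open>m\<close>.\<close>

lemma commutator_mem_of_prime_idx:
  assumes p: "prime p" and P: "is_subgroup P" "finite P"
    and M: "is_subgroup M" "M \<subseteq> P" "normalizes P M" "idx P M = p"
    and F: "is_subgroup F" "normalizes P F" and c: "\<And>x m. x \<in> P \<Longrightarrow> m \<in> M \<Longrightarrow> commutator x m \<in> F"
    and xy: "x \<in> P" "y \<in> P"
  shows "commutator x y \<in> F"
proof (cases "x \<in> M")
  case True
  then show ?thesis using c[of y x] xy commutator_mem_commute F by blast
next
  case False
  have cy: "is_subgroup (cyc x)" "cyc x \<subseteq> P" using is_subgroup_cyc cyc_subset P xy by blast+
  have s: "is_subgroup (cyc x * M)" using is_subgroup_times[OF cy(1) M(1)] M(3) cy(2) normalizes_mono by blast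
  have "maxsub M P" using maxsub_of_prime_idx[OF p P M(1,2,4)] .
  then have "cyc x * M = P"
    using maxsubD(4)[OF _ s set_times_superset2[OF cy(1)] set_times_least[OF P(1) cy(2) M(2)]]
      set_times_superset1[OF M(1), of "cyc x"] cyc_self[of x] False by blast
  then obtain i m where y: "y = x ^ i * m" "m \<in> M" using xy by (auto simp: set_times_mem cyc_def)
  have "commutator x y = (x * x ^ i) * m * inverse x * inverse m * inverse (x ^ i)"
    by (simp add: y commutator_def group_word)
  also have "\<dots> = x ^ i * commutator x m * inverse (x ^ i)"
    unfolding power_commutes[symmetric] by (simp add: commutator_def group_word)
  finally have "commutator x y = x ^ i * commutator x m * inverse (x ^ i)" .
  then show ?thesis using normalizesD[OF F(2), of "x ^ i"] c[of x m] xy y P by (simp add: is_subgroupD)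
qed

section \<open>Chief factors and commutator subgroups\<close>

definition chief :: "'g::group_mult set \<Rightarrow> 'g set \<Rightarrow> 'g set \<Rightarrow> bool"
  where "chief G L K \<longleftrightarrow> is_normal L G \<and> is_normal K G \<and> K \<subset> L \<and>
    (\<forall>M. is_normal M G \<and> K \<subseteq> M \<and> M \<subseteq> L \<longrightarrow> M = K \<or> M = L)"

lemma chiefD:
  assumes "chief G L K"
  shows "is_normal L G" "is_normal K G" "K \<subseteq> L" "K \<noteq> L"
    "\<And>M. is_normal M G \<Longrightarrow> K \<subseteq> M \<Longrightarrow> M \<subseteq> L \<Longrightarrow> M = K \<or> M = L"
  using assms by (auto simp: chief_def)

lemma chief_Int_cases:
  assumes "chief G L K" "is_normal B G" "K \<subseteq> B"
  shows "B \<inter> L = K \<or> L \<subseteq> B"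
  using chiefD(5)[OF assms(1) is_normal_Int[OF assms(2) chiefD(1)[OF assms(1)]]] assms(3) chiefD(3)[OF assms(1)]
  by blast

text \<open>\<open>[M, G]\<close> as the least subgroup containing the commutators, in the
  convention of \<open>commutator_subgroup\<close>; \<open>com_image\<close> carries one into the
  other.\<close>

definition com :: "'g::group_mult set \<Rightarrow> 'g set \<Rightarrow> 'g set"
  where "com M G = \<Inter>{A. is_subgroup A \<and> (\<forall>m\<in>M. \<forall>g\<in>G. inverse m * inverse g * m * g \<in> A)}"

lemma com_subgroup: "is_subgroup (com M G)"
  unfolding com_def by (rule is_subgroup_Inter) simp

lemma com_gen: "m \<in> M \<Longrightarrow> g \<in> G \<Longrightarrow> inverse m * inverse g * m * g \<in> com M G"
  by (simp add: com_def)

lemma com_least: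
  "is_subgroup A \<Longrightarrow> (\<And>m g. m \<in> M \<Longrightarrow> g \<in> G \<Longrightarrow> inverse m * inverse g * m * g \<in> A) \<Longrightarrow> com M G \<subseteq> A"
  unfolding com_def by blast

lemma com_normalized:
  assumes G: "is_subgroup G"
  shows "normalizes G (com M G)"
  unfolding normalizes_def
proof (intro ballI)
  fix x a assume x: "x \<in> G" and a: "a \<in> com M G"
  have "com M G \<subseteq> conjugate (inverse x) (com M G)"
  proof (rule com_least)
    show "is_subgroup (conjugate (inverse x) (com M G))"
      by (rule is_subgroup_conjugate[OF com_subgroup])
    fix m g assume m: "m \<in> M" and g: "g \<in> G"
    let ?y = "inverse x"
    \<comment> \<open>Writing \<open>[m, g]\<close> for
      \<open>inverse m * inverse g * m * g\<close>, the inverse of \<open>[m, y]\<close> times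
      \<open>[m, g * y]\<close> is \<open>[m, g]\<close> conjugated by \<open>y\<close>. So
      conjugates of generators remain in the subgroup.\<close>
    have "inverse (inverse m * inverse ?y * m * ?y) * (inverse m * inverse (g * ?y) * m * (g * ?y)) \<in> com M G"
      using m g x G by (intro is_subgroupD(2,3)[OF com_subgroup] com_gen) (simp_all add: is_subgroupD)
    then show "inverse m * inverse g * m * g \<in> conjugate (inverse x) (com M G)"
      by (simp add: conjugate_mem group_word)
  qed
  then show "x * a * inverse x \<in> com M G" using a by (auto simp: conjugate_mem)
qed

lemma com_commutator:
  assumes "is_subgroup G" "is_subgroup M" "m \<in> M" "g \<in> G"
  shows "commutator g m \<in> com M G"
proof -
  have "commutator m g \<in> com M G"
    using com_gen[of "inverse m" M "inverse g" G] assms by (simp add: commutator_def is_subgroupD)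
  then show ?thesis using commutator_mem_commute com_subgroup by blast
qed

lemma com_subset_normal:
  assumes "is_normal R G" "is_subgroup G" "M \<subseteq> R"
  shows "com M G \<subseteq> R"
proof (rule com_least)
  fix m g assume h: "m \<in> M" "g \<in> G"
  have "inverse m * (inverse g * m * g) \<in> R"
    using assms h normalizesD2[of G R g m] by (auto simp: is_normal_def is_subgroupD)
  then show "inverse m * inverse g * m * g \<in> R" by (simp add: mult.assoc)
qed (use assms in \<open>simp add: is_normal_def\<close>)

lemma com_is_normal:
  assumes "is_subgroup G" "M \<subseteq> G"
  shows "is_normal (com M G) G"
proof -
  have "is_normal G G" using assms by (simp add: is_normal_def normalizes_subgroup)
  then have "com M G \<subseteq> G" using com_subset_normal assms by blast
  then show ?thesis using assms by (simp add: is_normal_def com_subgroup com_normalized)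
qed

text \<open>With \<open>W = G\<close> and a factor \<open>S / U\<close> this is the centralizer of
  that factor; with an acting group \<open>S\<close> it is the subgroup of fixed points in
  \<open>W\<close> modulo \<open>U\<close>. Both readings occur.\<close>

definition centralizer_mod :: "'g::group_mult set \<Rightarrow> 'g set \<Rightarrow> 'g set \<Rightarrow> 'g set"
  where "centralizer_mod W S U = {x \<in> W. \<forall>s\<in>S. commutator s x \<in> U}"

lemma commutator_one [simp]: "commutator s 1 = 1" "commutator 1 s = 1"
  by (simp_all add: commutator_def)

lemma commutator_mult_right: "commutator s (x * y) = commutator s x * (x * commutator s y * inverse x)"
  by (simp add: commutator_def group_word)

lemma commutator_inverse_right: "commutator s (inverse x) = inverse x * commutator x s * inverse (inverse x)"
  by (simp add: commutator_def group_word)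

lemma commutator_conj: "commutator s (g * x * inverse g) = g * commutator (inverse g * s * g) x * inverse g"
  by (simp add: commutator_def group_word)

lemma commutator_mem_normal:
  "is_subgroup K \<Longrightarrow> normalizes G K \<Longrightarrow> g \<in> G \<Longrightarrow> k \<in> K \<Longrightarrow> commutator g k \<in> K"
  by (simp add: commutator_def is_subgroupD normalizesD)

lemma is_subgroup_centralizer_mod:
  assumes W: "is_subgroup W" and U: "is_subgroup U" "normalizes W U"
  shows "is_subgroup (centralizer_mod W S U)"
  unfolding is_subgroup_def
proof (intro conjI ballI)
  show "1 \<in> centralizer_mod W S U" using W U by (simp add: centralizer_mod_def is_subgroupD)
  fix x assume x: "x \<in> centralizer_mod W S U"
  then have xW: "x \<in> W" and xU: "\<And>s. s \<in> S \<Longrightarrow> commutator s x \<in> U" by (simp_all add: centralizer_mod_def)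
  have "commutator s (inverse x) \<in> U" if "s \<in> S" for s
    unfolding commutator_inverse_right
    using xU[OF that] xW W U commutator_mem_commute[of U s x] by (intro normalizesD[OF U(2)]) (simp_all add: is_subgroupD)
  then show "inverse x \<in> centralizer_mod W S U" using xW W by (simp add: centralizer_mod_def is_subgroupD)
  fix y assume "y \<in> centralizer_mod W S U"
  then show "x * y \<in> centralizer_mod W S U"
    using xW xU W U by (simp add: centralizer_mod_def is_subgroupD commutator_mult_right normalizesD)
qed

lemma normalizes_centralizer_mod:
  assumes H: "is_subgroup H" and "normalizes H S" "normalizes H W" "normalizes H U"
  shows "normalizes H (centralizer_mod W S U)"
  unfolding normalizes_def
proof (intro ballI)
  fix g x assume g: "g \<in> H" and x: "x \<in> centralizer_mod W S U"
  have "commutator s (g * x * inverse g) \<in> U" if "s \<in> S" for s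
    unfolding commutator_conj
    using assms g x that normalizesD2[of H S g s] by (intro normalizesD[of H U]) (simp_all add: centralizer_mod_def)
  then show "g * x * inverse g \<in> centralizer_mod W S U"
    using assms g x by (simp add: centralizer_mod_def normalizesD)
qed

lemma conjugate_coset: "conjugate s (x *o U) = (s * x * inverse s) *o conjugate s U"
  by (rule Set.set_eqI) (simp add: conjugate_mem elt_set_times_mem group_word)

text \<open>\<open>S\<close> acts by conjugation on the cosets of \<open>U\<close> in
  \<open>W\<close>, whose number is divisible by \<open>p\<close>; as the trivial coset is fixed, so
  is another one.\<close>

lemma p_group_fixed_coset:
  assumes p: "prime p" and S: "is_subgroup S" "finite S" "prime_power_of p (card S)"
    and W: "is_subgroup W" "finite W" "normalizes S W"
    and U: "is_subgroup U" "U \<subset> W" "normalizes S U" "normalizes W U" "prime_power_of p (idx W U)"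
  shows "\<exists>x\<in>W - U. \<forall>s\<in>S. commutator s x \<in> U"
proof -
  have UW: "U \<subseteq> W" using U by blast
  have cU: "conjugate s U = U" if "s \<in> S" for s using conjugate_normal[OF U(3) S(1) that] .
  let ?F = "{c \<in> left_cosets W U. \<forall>s\<in>S. conjugate s c = c}"
  have "card (left_cosets W U) mod p = card ?F mod p"
  proof (rule fixed_points_mod_prime[OF p S])
    show "finite (left_cosets W U)" using W by (simp add: left_cosets_def)
    fix g x assume "g \<in> S" "x \<in> left_cosets W U"
    then show "conjugate g x \<in> left_cosets W U"
      using W by (auto simp: left_cosets_def conjugate_coset cU normalizesD)
  qed (simp_all add: conjugate_conjugate)
  moreover have "p dvd card (left_cosets W U)"
  proof (rule ccontr)
    assume "\<not> p dvd card (left_cosets W U)"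
    then have "\<not> p dvd idx W U" using card_left_cosets_idx[OF U(1) W(1) UW W(2)] by simp
    then have "idx W U = 1" using prime_power_of_eq_1 U by blast
    then show False using idx_eq_1 U W UW by blast
  qed
  ultimately have dvd: "p dvd card ?F" by (simp add: dvd_eq_mod_eq_0)
  have one: "1 *o U \<in> ?F"
    using W by (simp add: left_cosets_def conjugate_coset cU is_subgroupD)
  have "?F \<noteq> {1 *o U}"
  proof
    assume "?F = {1 *o U}"
    then have "card ?F = 1" by (simp only: card.insert) simp
    then show False using dvd p by (simp add: prime_nat_iff)
  qed
  then obtain c where c: "c \<in> left_cosets W U" "\<And>g. g \<in> S \<Longrightarrow> conjugate g c = c" "c \<noteq> 1 *o U"
    using one by blast
  then obtain x where x: "x \<in> W" "c = x *o U" by (auto simp: left_cosets_def)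
  have "x \<notin> U" using c(3) x left_coset_eq_iff[OF U(1), of 1 x] by auto
  moreover have "commutator s x \<in> U" if s: "s \<in> S" for s
  proof -
    have "x *o U = (s * x * inverse s) *o U" using c(2)[OF s] by (simp add: x conjugate_coset cU s)
    then have "inverse x * (s * x * inverse s) \<in> U" using left_coset_eq_iff[OF U(1)] by blast
    then have "x * (inverse x * (s * x * inverse s)) * inverse x \<in> U" using normalizesD[OF U(4)] x by blast
    then show ?thesis by (simp add: commutator_def mult.assoc)
  qed
  ultimately show ?thesis using x by blast
qed

text \<open>The index of \<open>B\<close> is prime to the index of \<open>S\<close>, so it divides
  the index of \<open>S \<inter> B\<close> in \<open>S\<close>. Hence \<open>S * B\<close> has at
  least as many elements as \<open>G\<close>.\<close>

lemma times_sylow_eq: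
  assumes p: "prime p" and G: "is_subgroup G" "finite G" and S: "is_sylow p S G"
    and B: "is_subgroup B" "B \<subseteq> G" "prime_power_of p (idx G B)"
  shows "G = S * B"
proof -
  note S' = is_sylowD[OF S]
  have fin: "finite S" "finite B" using G S' B finite_subset by blast+
  have SB: "is_subgroup (S \<inter> B)" using S' B is_subgroup_Int by blast
  have "idx G (S \<inter> B) = idx G S * idx S (S \<inter> B)" by (rule idx_mult) (use SB S' G in auto)
  moreover have "idx G (S \<inter> B) = idx G B * idx B (S \<inter> B)" by (rule idx_mult) (use SB B G in auto)
  ultimately have "idx G B dvd idx G S * idx S (S \<inter> B)" by (metis dvd_triv_left)
  moreover have "coprime (idx G B) (idx G S)"
    using B(3) S'(4) p by (auto simp: prime_power_of_def coprime_commute prime_imp_coprime)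
  ultimately have dvd: "idx G B dvd idx S (S \<inter> B)" by (simp add: coprime_dvd_mult_right_iff)
  have "idx S (S \<inter> B) > 0" using idx_pos[OF SB S'(1) _ fin(1)] by simp
  with dvd have le: "idx G B \<le> idx S (S \<inter> B)" by (rule dvd_imp_le)
  have pos: "card (S \<inter> B) > 0" using card_subgroup_pos[OF SB] fin by simp
  have "card (S * B) * card (S \<inter> B) = idx S (S \<inter> B) * card (S \<inter> B) * card B"
    using card_times[OF S'(1) B(1) fin] lagrange_idx[OF SB S'(1) _ fin(1)] by simp
  then have "card (S * B) = idx S (S \<inter> B) * card B" using pos by simp
  moreover have "card G = idx G B * card B" using lagrange_idx[OF B(1) G(1) B(2) G(2)] .
  ultimately have "card G \<le> card (S * B)" using le by simp
  moreover have "S * B \<subseteq> G" using set_times_least G S' B by blast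
  ultimately have "S * B = G" using card_seteq[OF G(2)] by blast
  then show ?thesis by simp
qed

lemma mult_power_mod:
  assumes K: "is_subgroup K" "normalizes G K" and G: "is_subgroup G" and a: "a \<in> G" and k: "k \<in> K"
  shows "\<exists>k'\<in>K. (a * k) ^ n = a ^ n * k'"
proof (induction n)
  case 0
  then show ?case using K by (auto simp: is_subgroupD intro: bexI[of _ 1])
next
  case (Suc n)
  then obtain k' where k': "k' \<in> K" "(a * k) ^ n = a ^ n * k'" by blast
  have "(a * k) ^ Suc n = a ^ Suc n * ((inverse (a ^ n) * k * a ^ n) * k')"
    by (simp add: k' group_word power_commutes)
  moreover have "(inverse (a ^ n) * k * a ^ n) * k' \<in> K"
    using normalizesD2[OF K(2) G, of "a ^ n" k] k' k a G K by (simp add: is_subgroupD)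
  ultimately show ?case by blast
qed

text \<open>The powers of \<open>z ^ p\<close> form a characteristic subgroup of the cyclic
  \<open>p\<close>-group \<open>T / K\<close>. As a chief factor admits only trivial invariant
  subgroups, it is trivial or everything, and the latter is impossible in a nontrivial
  \<open>p\<close>-group.\<close>

lemma cyclic_chief_prime:
  assumes p: "prime p" and G: "is_subgroup G" "finite G" and ch: "chief G T K"
    and z: "z \<in> T" "T \<subseteq> cyc z * K" and pp: "prime_power_of p (idx T K)"
  shows "idx T K = p"
proof -
  note T' = is_normalD[OF chiefD(1)[OF ch]] and K' = is_normalD[OF chiefD(2)[OF ch]]
  have zG: "z \<in> G" using z T' by blast
  have Tz: "T = cyc z * K"
    using z set_times_least[OF T'(1) cyc_subset[OF T'(1) z(1)] chiefD(3)[OF ch]] by blast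
  have sub: "is_subgroup (cyc z * K)" using T'(1) by (simp flip: Tz)
  obtain m where m: "m > 0" "\<And>n. z ^ n \<in> K \<longleftrightarrow> m dvd n" "idx T K = m"
    using relative_order[OF G zG K'(1,2) sub] by (auto simp flip: Tz)
  have m1: "m \<noteq> 1"
  proof
    assume "m = 1"
    then have "z \<in> K" using m(2)[of 1] by simp
    then have "T \<subseteq> K" using z set_times_least[OF K'(1) cyc_subset[OF K'(1)] order_refl] by blast
    then show False using chiefD(3,4)[OF ch] by blast
  qed
  then have pm: "p dvd m" using prime_power_of_eq_1 pp m(3) by blast
  let ?w = "z ^ p"
  have wT: "?w \<in> T" using z T' by (simp add: is_subgroupD)
  have wG: "?w \<in> G" using wT T' by blast
  have V: "is_subgroup (cyc ?w * K)"
    by (rule is_subgroup_times_normal[OF is_subgroup_cyc[OF G wG] cyc_subset[OF G(1) wG] chiefD(2)[OF ch]])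
  have VT: "cyc ?w * K \<subseteq> T" using set_times_least[OF T'(1) cyc_subset[OF T'(1) wT] chiefD(3)[OF ch]] .
  have "normalizes G (cyc ?w * K)"
    unfolding normalizes_def
  proof (intro ballI)
    fix g v assume g: "g \<in> G" and "v \<in> cyc ?w * K"
    then obtain j k where v: "k \<in> K" "v = ?w ^ j * k" by (auto simp: cyc_def set_times_mem)
    have "g * z * inverse g \<in> cyc z * K" using z T' g normalizesD by blast
    then obtain i k1 where k1: "k1 \<in> K" "g * z * inverse g = z ^ i * k1" by (auto simp: cyc_def set_times_mem)
    obtain k2 where k2: "k2 \<in> K" "(z ^ i * k1) ^ (p * j) = (z ^ i) ^ (p * j) * k2"
      using mult_power_mod[OF K'(1,3) G(1), of "z ^ i" k1] k1 zG G by (metis is_subgroupD(4))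
    have "g * v * inverse g = (g * z * inverse g) ^ (p * j) * (g * k * inverse g)"
      unfolding group_power_conj by (simp add: v group_word power_mult)
    also have "\<dots> = (z ^ i) ^ (p * j) * k2 * (g * k * inverse g)" by (simp only: k1(2) k2(2))
    also have "(z ^ i) ^ (p * j) = ?w ^ (i * j)" by (simp add: mult.left_commute flip: power_mult)
    also have "?w ^ (i * j) * k2 * (g * k * inverse g) = ?w ^ (i * j) * (k2 * (g * k * inverse g))"
      by (rule mult.assoc)
    also have "\<dots> \<in> cyc ?w * K"
      using k2 v g K' by (intro set_times_intro power_in_cyc) (simp add: is_subgroupD normalizesD)
    finally show "g * v * inverse g \<in> cyc ?w * K" .
  qed
  then have "is_normal (cyc ?w * K) G" using V VT T' by (simp add: is_normal_def)
  then have "cyc ?w * K = K \<or> cyc ?w * K = T"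
    using chiefD(5)[OF ch] VT set_times_superset2[OF is_subgroup_cyc[OF G wG]] by blast
  then show ?thesis
  proof
    assume "cyc ?w * K = K"
    then have "?w \<in> K" using set_times_superset1[OF K'(1), of "cyc ?w"] cyc_self by blast
    then have "m dvd p" using m by blast
    then show ?thesis using m(3) m1 p unfolding prime_nat_iff by blast
  next
    assume "cyc ?w * K = T"
    then have "z \<in> cyc ?w * K" using z by simp
    then obtain j k where v: "k \<in> K" "z = ?w ^ j * k" by (auto simp: cyc_def set_times_mem)
    show ?thesis
    proof (cases "j = 0")
      case True
      then have "z ^ 1 \<in> K" using v by simp
      then show ?thesis using m m1 by (metis nat_dvd_1_iff_1)
    next
      case False
      then have "Suc (p * j - 1) = p * j" using p by (simp add: prime_gt_0_nat)
      \<comment> \<open>Cancelling one \<open>z\<close> puts \<open>z ^ (p * j - 1)\<close> into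
        \<open>K\<close>, so \<open>m\<close>, and with it \<open>p\<close>, divides
        \<open>p * j - 1\<close>, which is absurd. As \<open>j\<close> is not 0, the subtraction is
        not truncated.\<close>
      then have "?w ^ j = z * z ^ (p * j - 1)" by (metis power_mult power_Suc)
      then have "z * 1 = z * (z ^ (p * j - 1) * k)" using v(2) by (simp add: mult.assoc)
      then have "z ^ (p * j - 1) * k = 1" by (simp only: group_left_cancel)
      then have "z ^ (p * j - 1) \<in> K" using is_subgroup_right_iff[OF K'(1) v(1)] K' is_subgroupD(1) by metis
      then have "p dvd p * j - 1" using m pm dvd_trans by blast
      moreover have "p * j > 0" using False p by (simp add: prime_gt_0_nat)
      ultimately have "p dvd 1" by (metis dvd_diffD1 dvd_triv_left less_eq_Suc_le One_nat_def)
      then show ?thesis using p by simp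
    qed
  qed
qed

lemma maxsub_conjugate:
  assumes "maxsub M P" "conjugate g P = P"
  shows "maxsub (conjugate g M) P"
  unfolding maxsub_def
proof (intro conjI allI impI)
  note M' = maxsubD[OF assms(1)]
  show "is_subgroup (conjugate g M)" using M' is_subgroup_conjugate by blast
  have iP: "conjugate (inverse g) P = P" using assms(2) conjugate_swap[of g P P] by simp
  have "conjugate g M \<subseteq> P" using conjugate_mono[OF M'(2), of g] assms(2) by simp
  moreover have "conjugate g M \<noteq> P" using M'(3) iP conjugate_swap[of g M P] by simp
  ultimately show "conjugate g M \<subset> P" by blast
  fix U assume U: "is_subgroup U \<and> conjugate g M \<subseteq> U \<and> U \<subseteq> P"
  have "M \<subseteq> conjugate (inverse g) U"
    using U conjugate_mono[of "conjugate g M" U "inverse g"] by (simp add: conjugate_conjugate)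
  moreover have "conjugate (inverse g) U \<subseteq> P" using U conjugate_mono[of U P "inverse g"] iP by simp
  ultimately have "conjugate (inverse g) U = M \<or> conjugate (inverse g) U = P"
    using M'(4) U is_subgroup_conjugate by blast
  then show "U = conjugate g M \<or> U = P"
    using conjugate_swap[of "inverse g" U] assms(2) by auto
qed

lemma maxsub_commutator:
  assumes p: "prime p" and P: "is_subgroup P" "finite P" "prime_power_of p (card P)" and M: "maxsub M P"
    and xy: "x \<in> P" "y \<in> P"
  shows "commutator x y \<in> M"
proof (rule commutator_mem_of_prime_idx[OF p P(1,2)])
  show "is_subgroup M" "M \<subseteq> P" "normalizes P M" "idx P M = p" "is_subgroup M" "normalizes P M"
    using p_group_maxsub[OF p P M] maxsubD(1,2)[OF M] by blast+
  then show "\<And>x m. x \<in> P \<Longrightarrow> m \<in> M \<Longrightarrow> commutator x m \<in> M" by (intro commutator_mem_normal)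
qed (fact xy)+

lemma maxsub_power:
  assumes p: "prime p" and P: "is_subgroup P" "finite P" "prime_power_of p (card P)" and M: "maxsub M P"
    and x: "x \<in> P"
  shows "x ^ p \<in> M"
  using power_idx_mem[OF P(1,2), of M x] p_group_maxsub[OF p P M] maxsubD[OF M] x
  by (simp add: is_normal_def)

section \<open>The \<open>IC\<close>-\<open>\<Pi>\<close>-property\<close>

declare set_times_intro [rule del]

text \<open>\<open>IC_Pi\<close> is the \<Pi>-property pulled back from \<open>G / K\<close> to
  \<open>G\<close>. The section \<open>(M \<inter> [M, G]) K \<inter> L\<close> over
  \<open>K\<close> is a \<open>p\<close>-group, so the index of its normalizer can only be a power
  of \<open>p\<close>; see \<open>Pi_property_prime_power\<close>.\<close>

locale sylow_setting =
  fixes G N P :: "'g::group_mult set" and p :: nat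
  assumes p: "prime p" and G: "is_subgroup G" "finite G" and N: "is_normal N G" and P: "is_sylow p P N"
    and IC_Pi: "\<And>M L K. maxsub M P \<Longrightarrow> chief G L K \<Longrightarrow>
      prime_power_of p (idx G (normalizer_in G ((M \<inter> com M G) * K \<inter> L)))"
begin

lemma fin: "A \<subseteq> G \<Longrightarrow> finite A"
  using G finite_subset by blast

lemma NG: "is_subgroup N" "N \<subseteq> G" "normalizes G N"
  using is_normalD[OF N] .

lemma PN: "is_subgroup P" "P \<subseteq> N" "prime_power_of p (card P)" "\<not> p dvd idx N P"
  using is_sylowD[OF P] .

lemma PG: "P \<subseteq> G"
  using PN NG by blast

lemma finP: "finite P"
  using fin PG .

lemma maxP:
  assumes "maxsub M P"
  shows "is_subgroup M" "M \<subseteq> P" "M \<subseteq> G" "finite M" "normalizes P M" "idx P M = p" "prime_power_of p (card M)"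
proof -
  show M: "is_subgroup M" "M \<subseteq> P" using maxsubD[OF assms] by blast+
  show "M \<subseteq> G" using M PG by blast
  then show "finite M" using fin by blast
  show "normalizes P M" "idx P M = p" using p_group_maxsub[OF p PN(1) finP PN(3) assms] by blast+
  show "prime_power_of p (card M)"
    using prime_power_of_dvd[OF p PN(3)] lagrange_idx[OF M(1) PN(1) M(2) finP] by simp
qed

lemma pp_subgroup: "is_subgroup Q \<Longrightarrow> Q \<subseteq> P \<Longrightarrow> prime_power_of p (card Q)"
  using prime_power_of_dvd[OF p PN(3)] lagrange_idx[OF _ PN(1) _ finP, of Q] by simp

lemma pp_idx: "is_subgroup Q \<Longrightarrow> Q \<subseteq> P \<Longrightarrow> is_subgroup R \<Longrightarrow> R \<subseteq> Q \<Longrightarrow> prime_power_of p (idx Q R)"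
  using prime_power_of_dvd[OF p pp_subgroup[of Q]] lagrange_idx[of R Q] finP finite_subset[of Q P] by simp

lemma normal_in_subgroup: "is_normal A G \<Longrightarrow> A \<subseteq> H \<Longrightarrow> H \<subseteq> G \<Longrightarrow> is_normal A H"
  using normalizes_mono by (auto simp: is_normal_def)

lemma sylow_Int: "is_normal A G \<Longrightarrow> A \<subseteq> N \<Longrightarrow> is_sylow p (P \<inter> A) A"
  using sylow_Int_normal[OF p NG(1) fin[OF NG(2)] P] normal_in_subgroup NG by blast

lemma idx_times_normal:
  assumes "is_subgroup Q" "Q \<subseteq> G" "is_normal K G"
  shows "is_subgroup (Q * K)" "Q * K \<subseteq> G" "K \<subseteq> Q * K" "Q \<subseteq> Q * K" "idx (Q * K) K = idx Q (Q \<inter> K)"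
proof -
  note K' = is_normalD[OF assms(3)]
  show "is_subgroup (Q * K)" using is_subgroup_times_normal assms by blast
  show "Q * K \<subseteq> G" using set_times_least G assms K' by blast
  show "K \<subseteq> Q * K" using set_times_superset2 assms by blast
  show "Q \<subseteq> Q * K" using set_times_superset1 K' by blast
  show "idx (Q * K) K = idx Q (Q \<inter> K)" using idx_times assms K' fin by blast
qed

lemma pp_times_normal:
  assumes "is_subgroup Q" "Q \<subseteq> G" "prime_power_of p (card Q)" "is_normal K G"
    and "is_subgroup T" "K \<subseteq> T" "T \<subseteq> Q * K"
  shows "prime_power_of p (idx T K)"
proof -
  note QK = idx_times_normal[OF assms(1,2,4)] and K' = is_normalD[OF assms(4)]
  have "card Q = idx Q (Q \<inter> K) * card (Q \<inter> K)"
    by (rule lagrange_idx) (use assms K' fin is_subgroup_Int in auto)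
  then have "idx Q (Q \<inter> K) dvd card Q" by (metis dvd_triv_left)
  moreover have "idx T K dvd idx (Q * K) K"
    by (rule idx_dvd_trans(2)) (use assms QK K' fin in auto)
  ultimately show ?thesis using QK(5) prime_power_of_dvd[OF p assms(3)] dvd_trans by metis
qed

lemma normal_eq_times:
  assumes T: "is_normal T G" "T \<subseteq> N" and K: "is_normal K G" "K \<subseteq> T" and "prime_power_of p (idx T K)"
  shows "T = (P \<inter> T) * K"
  by (rule sylow_times_normal[OF p is_normalD(1)[OF T(1)] fin sylow_Int[OF T] normal_in_subgroup[OF K] assms(5)])
    (use is_normalD[OF T(1)] in auto)

lemma not_P_Int_subset:
  assumes T: "is_normal T G" "T \<subseteq> N" and K: "is_subgroup K" "K \<subseteq> T" and "p dvd idx T K"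
  shows "\<not> P \<inter> T \<subseteq> K"
proof
  assume sub: "P \<inter> T \<subseteq> K"
  note S = is_sylowD[OF sylow_Int[OF T]] and T' = is_normalD[OF T(1)]
  have "idx T K dvd idx T (P \<inter> T)"
    by (rule idx_dvd_trans(1)) (use K S T' sub fin in auto)
  then show False using assms(5) S(4) dvd_trans by blast
qed

lemma com_alternative:
  assumes M: "is_subgroup M" "M \<subseteq> G" and ch: "chief G T K"
  shows "T \<subseteq> com M G * K \<or> is_normal (M * K \<inter> T) G"
proof (cases "T \<subseteq> com M G * K")
  case False
  note T' = is_normalD[OF chiefD(1)[OF ch]] and K' = is_normalD[OF chiefD(2)[OF ch]]
  let ?A = "com M G"
  have A: "is_normal ?A G" using com_is_normal G M by blast
  have AK: "is_normal (?A * K) G" using is_normal_times[OF A chiefD(2)[OF ch] G(1)] .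
  have AKT: "?A * K \<inter> T = K"
    using chief_Int_cases[OF ch AK set_times_superset2[OF com_subgroup]] False by blast
  note MK = idx_times_normal[OF M chiefD(2)[OF ch]]
  have "normalizes G (M * K \<inter> T)"
    unfolding normalizes_def
  proof (intro ballI)
    fix g x assume g: "g \<in> G" and x: "x \<in> M * K \<inter> T"
    then obtain m k where mk: "m \<in> M" "k \<in> K" "x = m * k" by (auto simp: set_times_mem)
    have xT: "g * x * inverse g \<in> T" using g x T' normalizesD by blast
    \<comment> \<open>Modulo \<open>K\<close> only the factor \<open>m\<close> contributes, the rest
      being a conjugate of an element of \<open>K\<close>. So the commutator lies in
      \<open>[M, G] K \<inter> T\<close>, which is \<open>K\<close> in this case.\<close>
    have "commutator g x = commutator g m * (m * ((g * k * inverse g) * inverse k) * inverse m)"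
      by (simp add: mk commutator_def group_word)
    also have "\<dots> \<in> ?A * K"
      using mk g M K' com_commutator[OF G(1) M(1) mk(1) g] normalizesD[OF K'(3)]
      by (intro set_times_intro) (auto simp: is_subgroupD)
    finally have "commutator g x \<in> ?A * K" .
    moreover have "commutator g x \<in> T"
      using commutator_mem_normal[OF T'(1,3) g] x by blast
    ultimately have "commutator g x \<in> M * K" using AKT MK(3) by blast
    then have "commutator g x * x \<in> M * K" using x MK(1) by (simp add: is_subgroupD)
    then show "g * x * inverse g \<in> M * K \<inter> T" using xT by (simp add: conj_eq_commutator)
  qed
  then have "is_normal (M * K \<inter> T) G" using MK T' by (auto simp: is_normal_def is_subgroup_Int)
  then show ?thesis ..
qed simp

context
  fixes M T K
  assumes M: "maxsub M P" and ch: "chief G T K"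
begin

lemma IC_Pi_times: "is_sylow p S G \<Longrightarrow> G = S * normalizer_in G ((M \<inter> com M G) * K \<inter> T)"
  using times_sylow_eq[OF p G _ is_subgroup_normalizer_in[OF G(1)] _ IC_Pi[OF M ch]]
  by (simp add: normalizer_in_def subset_eq)

lemma IC_Pi_subgroup:
  "is_subgroup (M \<inter> com M G)" "M \<inter> com M G \<subseteq> G" "is_subgroup ((M \<inter> com M G) * K \<inter> T)"
  "K \<subseteq> (M \<inter> com M G) * K \<inter> T"
proof -
  show H: "is_subgroup (M \<inter> com M G)" using maxP[OF M] com_subgroup is_subgroup_Int by blast
  show HG: "M \<inter> com M G \<subseteq> G" using maxP[OF M] by blast
  note HK = idx_times_normal[OF H HG chiefD(2)[OF ch]]
  show "is_subgroup ((M \<inter> com M G) * K \<inter> T)" 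
    using HK(1) is_normalD(1)[OF chiefD(1)[OF ch]] is_subgroup_Int by blast
  show "K \<subseteq> (M \<inter> com M G) * K \<inter> T" using HK(3) chiefD(3)[OF ch] by blast
qed

lemma IC_Pi_p_chief:
  assumes "(M \<inter> com M G) * K \<inter> T \<noteq> K"
  shows "prime_power_of p (idx T K)"
proof -
  let ?H = "M \<inter> com M G"
  let ?B = "?H * K \<inter> T"
  note T' = is_normalD[OF chiefD(1)[OF ch]] and K' = is_normalD[OF chiefD(2)[OF ch]]
  note H = IC_Pi_subgroup
  have "prime_power_of p (card ?H)" using pp_subgroup[OF H(1)] maxP[OF M] by blast
  then obtain S where S: "is_sylow p S G" "?H \<subseteq> S" using sylow_contains[OF p G H(1,2)] by blast
  note S' = is_sylowD[OF S(1)]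
  note SK = idx_times_normal[OF S'(1,2) chiefD(2)[OF ch]]
  \<comment> \<open>The core of \<open>S K \<inter> T\<close> in \<open>G\<close>, a normal subgroup
    between \<open>K\<close> and \<open>T\<close>. As soon as it is larger than \<open>K\<close> it
    is \<open>T\<close>, and then \<open>T \<subseteq> S K\<close>.\<close>
  define D where "D = {t \<in> T. \<forall>g\<in>G. g * t * inverse g \<in> S * K}"
  have KD: "K \<subseteq> D" using K' SK(3) chiefD(3)[OF ch] normalizesD[OF K'(3)] by (auto simp: D_def)
  have BD: "?B \<subseteq> D"
    unfolding D_def
  proof (intro subsetI CollectI conjI ballI)
    fix b g assume b: "b \<in> ?B" and g: "g \<in> G"
    \<comment> \<open>The factor \<open>n\<close> keeps \<open>b\<close> inside \<open>?B\<close>,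
      which lies in \<open>S K\<close> because \<open>S\<close> was chosen to contain
      \<open>H\<close>; the factor \<open>s\<close> then keeps it inside \<open>S K\<close>.\<close>
    then obtain s n where sn: "s \<in> S" "n \<in> normalizer_in G ?B" "g = s * n"
      using IC_Pi_times[OF S(1)] set_times_mem by blast
    have "n * b * inverse n \<in> conjugate n ?B" using b by (auto simp: conjugate_def)
    then have "n * b * inverse n \<in> ?H * K" using sn(2) by (auto simp: normalizer_in_def)
    then have "n * b * inverse n \<in> S * K" using S(2) set_times_mono2[of ?H S K K] by blast
    then have "s * (n * b * inverse n) * inverse s \<in> S * K"
      using sn(1) SK(1,4) by (auto simp: is_subgroupD subset_eq)
    then show "g * b * inverse g \<in> S * K" by (simp add: sn group_word)
  qed auto
  have "is_normal D G"
    unfolding is_normal_def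
  proof (intro conjI)
    show "D \<subseteq> G" using T' by (auto simp: D_def)
    show "normalizes G D"
      unfolding normalizes_def
    proof (intro ballI)
      fix g t assume g: "g \<in> G" and t: "t \<in> D"
      have "h * (g * t * inverse g) * inverse h \<in> S * K" if "h \<in> G" for h
      proof -
        have "h * (g * t * inverse g) * inverse h = (h * g) * t * inverse (h * g)" by (simp add: group_word)
        then show ?thesis using t g that G by (simp add: D_def is_subgroupD)
      qed
      then show "g * t * inverse g \<in> D" using t g T' normalizesD[OF T'(3)] by (simp add: D_def)
    qed
    show "is_subgroup D"
      unfolding is_subgroup_def
    proof (intro conjI ballI)
      show "1 \<in> D" using T' SK by (simp add: D_def is_subgroupD)
      fix x assume x: "x \<in> D"
      have "g * inverse x * inverse g \<in> S * K" if "g \<in> G" for g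
      proof -
        have "g * inverse x * inverse g = inverse (g * x * inverse g)" by (simp add: group_word)
        then show ?thesis using x that SK by (simp add: D_def is_subgroupD)
      qed
      then show "inverse x \<in> D" using x T' by (simp add: D_def is_subgroupD)
      fix y assume y: "y \<in> D"
      have "g * (x * y) * inverse g \<in> S * K" if "g \<in> G" for g
      proof -
        have "g * (x * y) * inverse g = (g * x * inverse g) * (g * y * inverse g)" by (simp add: group_word)
        then show ?thesis using x y that SK by (simp add: D_def is_subgroupD)
      qed
      then show "x * y \<in> D" using x y T' by (simp add: D_def is_subgroupD)
    qed
  qed
  moreover have "D \<noteq> K" using BD H(4) assms by blast
  ultimately have "D = T" using chiefD(5)[OF ch _ KD] by (auto simp: D_def)
  have "T \<subseteq> S * K"
  proof
    fix t assume "t \<in> T"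
    then have "1 * t * inverse 1 \<in> S * K" using \<open>D = T\<close> G unfolding D_def by (blast dest: is_subgroupD(1))
    then show "t \<in> S * K" by simp
  qed
  then show ?thesis
    using pp_times_normal[OF S'(1,2,3) chiefD(2)[OF ch] T'(1) chiefD(3)[OF ch]] by blast
qed

lemma IC_Pi_normal:
  assumes S: "is_sylow p S G" and n: "normalizes S ((M \<inter> com M G) * K \<inter> T)"
  shows "is_normal ((M \<inter> com M G) * K \<inter> T) G"
proof -
  let ?B = "(M \<inter> com M G) * K \<inter> T"
  have "g * b * inverse g \<in> ?B" if g: "g \<in> G" and b: "b \<in> ?B" for g b
  proof -
    obtain s n' where sn: "s \<in> S" "n' \<in> normalizer_in G ?B" "g = s * n'"
      using IC_Pi_times[OF S] set_times_mem g by blast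
    have "n' * b * inverse n' \<in> conjugate n' ?B" unfolding conjugate_def using b by (rule imageI)
    then have "n' * b * inverse n' \<in> ?B" using sn(2) by (simp add: normalizer_in_def)
    then have "s * (n' * b * inverse n') * inverse s \<in> ?B" using normalizesD[OF n sn(1)] by blast
    then show ?thesis by (simp add: sn group_word)
  qed
  then show ?thesis
    using IC_Pi_subgroup is_normalD(2)[OF chiefD(1)[OF ch]] by (auto simp: is_normal_def normalizes_def)
qed

text \<open>Let \<open>A = [M, G]\<close>. Since \<open>M\<close> is a Sylow subgroup of
  \<open>M K\<close>, the group \<open>M \<inter> A\<close> is one of the normal subgroup
  \<open>Z = A \<inter> M K\<close>. Modulo \<open>A \<inter> K\<close> the group \<open>Z\<close>
  is a \<open>p\<close>-group, so \<open>Z = (M \<inter> A) (A \<inter> K)\<close>, and multiplying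
  by \<open>K\<close> gives the claim by the modular law.\<close>

lemma com_Int_times:
  assumes PK: "P \<inter> K \<subseteq> M" and KN: "K \<subseteq> N"
  shows "(M * K) \<inter> (com M G * K) = (M \<inter> com M G) * K"
proof -
  let ?A = "com M G"
  have nK: "is_normal K G" using chiefD[OF ch] by blast
  note K' = is_normalD[OF nK] and M' = maxP[OF M]
  note MK = idx_times_normal[OF M'(1,3) nK]
  have finMK: "finite (M * K)" using MK(2) fin by blast
  have A: "is_normal ?A G" using com_is_normal G M' by blast
  note A' = is_normalD[OF A]
  have KM: "K \<inter> M = P \<inter> K" using PK M' by blast
  have "M * K = K * M" using set_times_commute[OF M'(1)] normalizes_mono[OF K'(3) M'(3)] by blast
  then have "idx (M * K) M = idx K (P \<inter> K)"
    using idx_times[OF K'(1) M'(1) fin[OF K'(2)] M'(4)] KM by simp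
  then have "is_sylow p M (M * K)"
    using is_sylowD(4)[OF sylow_Int[OF nK KN]] M' MK by (simp add: is_sylow_def)
  define Z where "Z = ?A \<inter> (M * K)"
  have Z: "is_normal Z (M * K)"
    unfolding Z_def using A' MK normalizes_mono[OF A'(3) MK(2)] normalizes_subgroup[OF MK(1)]
    by (simp add: is_normal_def is_subgroup_Int normalizes_Int)
  note Z' = is_normalD[OF Z]
  have "is_sylow p (M \<inter> Z) Z"
    using sylow_Int_normal[OF p MK(1) finMK \<open>is_sylow p M (M * K)\<close> Z] .
  moreover have "M \<inter> Z = M \<inter> ?A" using MK(4) by (auto simp: Z_def)
  ultimately have sy: "is_sylow p (M \<inter> ?A) Z" by simp
  have ZG: "Z \<subseteq> G" using Z' MK by blast
  have AK: "Z \<inter> K = ?A \<inter> K" using MK(3) by (auto simp: Z_def)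
  have nAK: "is_normal (?A \<inter> K) Z"
    using normal_in_subgroup[OF is_normal_Int[OF A nK]] ZG AK by blast
  have "idx Z (?A \<inter> K) = idx (Z * K) K"
    using idx_times_normal(5)[OF Z'(1) ZG nK] AK by simp
  moreover have "prime_power_of p (idx (Z * K) K)"
    using idx_times_normal[OF Z'(1) ZG nK] set_times_least[OF MK(1) Z'(2) MK(3)]
    by (intro pp_times_normal[OF M'(1,3,7) nK]) auto
  ultimately have "Z = (M \<inter> ?A) * (?A \<inter> K)"
    using sylow_times_normal[OF p Z'(1) fin[OF ZG] sy nAK] by simp
  then have "Z * K = (M \<inter> ?A) * K"
    using set_times_absorb1[OF K'(1) is_subgroup_Int[OF A'(1) K'(1)]] by (simp add: mult.assoc)
  moreover have "(M * K) \<inter> (?A * K) = Z * K"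
    using dedekind_right[OF MK(1,3), of ?A] by (simp add: Z_def Int_commute)
  ultimately show ?thesis by simp
qed

end

lemma P_Int_subgroup: "is_normal K G \<Longrightarrow> is_subgroup (P \<inter> K)"
  by (rule is_subgroup_Int[OF PN(1) is_normalD(1)])

text \<open>If \<open>T / K\<close> were not a \<open>p\<close>-group, then
  \<open>M K \<inter> T = K\<close> for every maximal \<open>M\<close> over
  \<open>P \<inter> K\<close>. An \<open>M\<close> over \<open>P \<inter> T\<close> would put
  \<open>P \<inter> T\<close> into \<open>K\<close>; and if \<open>P \<subseteq> T\<close>, then
  \<open>M = P \<inter> K\<close>, whose index is only \<open>p\<close>.\<close>

lemma large_idx_p_chief:
  assumes ch: "chief G T K" and TN: "T \<subseteq> N" and pd: "p dvd idx T K" and p2: "p * p dvd idx P (P \<inter> K)"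
  shows "prime_power_of p (idx T K)"
proof (rule ccontr)
  assume np: "\<not> prime_power_of p (idx T K)"
  note nT = chiefD(1)[OF ch] and nK = chiefD(2)[OF ch] and KT = chiefD(3)[OF ch]
  note T' = is_normalD[OF nT] and K' = is_normalD[OF nK]
  have KN: "K \<subseteq> N" using KT TN by blast
  have key: "M * K \<inter> T = K" if M: "maxsub M P" "P \<inter> K \<subseteq> M" for M
  proof -
    note M' = maxP[OF M(1)] and MK = idx_times_normal[OF maxP(1,3)[OF M(1)] nK]
    show ?thesis
    proof (rule ccontr)
      assume neq: "M * K \<inter> T \<noteq> K"
      from com_alternative[OF M'(1,3) ch] show False
      proof
        assume "T \<subseteq> com M G * K"
        then have "M * K \<inter> T = ((M * K) \<inter> (com M G * K)) \<inter> T" by (simp add: Int_assoc Int_absorb1)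
        then have "M * K \<inter> T = (M \<inter> com M G) * K \<inter> T"
          by (simp only: com_Int_times[OF M(1) ch M(2) KN])
        then show False using IC_Pi_p_chief[OF M(1) ch] neq np by simp
      next
        assume "is_normal (M * K \<inter> T) G"
        then have "M * K \<inter> T = T" using chiefD(5)[OF ch] neq MK(3) KT by blast
        then show False using pp_times_normal[OF M'(1,3,7) nK T'(1) KT] np by blast
      qed
    qed
  qed
  have nsub: "\<not> P \<inter> T \<subseteq> K" using not_P_Int_subset[OF nT TN K'(1) KT pd] .
  show False
  proof (cases "P \<inter> T = P")
    case False
    then obtain M where M: "maxsub M P" "P \<inter> T \<subseteq> M"
      using maxsub_exists[OF finP P_Int_subgroup[OF nT]] by blast
    then have "M * K \<inter> T = K" using key KT by blast
    then show False using nsub M(2) idx_times_normal(4)[OF maxP(1,3)[OF M(1)] nK] by blast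
  next
    case True
    then have "P \<inter> K \<noteq> P" using nsub by blast
    then obtain M where M: "maxsub M P" "P \<inter> K \<subseteq> M"
      using maxsub_exists[OF finP P_Int_subgroup[OF nK]] by blast
    then have "M * K \<inter> T = K" using key by blast
    then have "M \<subseteq> K" using idx_times_normal(4)[OF maxP(1,3)[OF M(1)] nK] maxP(2)[OF M(1)] True by blast
    then have "M = P \<inter> K" using M maxP(2)[OF M(1)] by blast
    then have "p * p dvd p" using maxP(6)[OF M(1)] p2 by simp
    then have "p * p \<le> p" using prime_gt_0_nat[OF p] by (rule dvd_imp_le)
    moreover have "2 * p \<le> p * p" using prime_ge_2_nat[OF p] by (rule mult_le_mono1)
    ultimately show False using prime_gt_0_nat[OF p] by linarith
  qed
qed

text \<open>\<open>P \<inter> T\<close> is the only maximal subgroup of \<open>P\<close> over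
  \<open>P \<inter> K\<close>. So any \<open>y\<close> in \<open>P\<close> outside \<open>T\<close>
  generates \<open>P\<close> over \<open>P \<inter> K\<close>, and \<open>y ^ p\<close> generates
  \<open>T\<close> over \<open>K\<close>, which makes \<open>T / K\<close> cyclic.\<close>

lemma frattini_case:
  assumes ch: "chief G T K" and TN: "T \<subseteq> N" and pp: "prime_power_of p (idx T K)"
    and fr: "\<And>M. maxsub M P \<Longrightarrow> P \<inter> K \<subseteq> M \<Longrightarrow> P \<inter> T \<subseteq> M" and ip: "idx P (P \<inter> T) = p"
  shows "idx T K = p"
proof -
  note nT = chiefD(1)[OF ch] and nK = chiefD(2)[OF ch] and KT = chiefD(3)[OF ch]
  note T' = is_normalD[OF nT] and K' = is_normalD[OF nK]
  note PT = P_Int_subgroup[OF nT] and PK = P_Int_subgroup[OF nK]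
  have mPT: "maxsub (P \<inter> T) P" using maxsub_of_prime_idx[OF p PN(1) finP PT _ ip] by blast
  have "P \<inter> T \<noteq> P" using maxsubD(3)[OF mPT] .
  then obtain y where y: "y \<in> P" "y \<notin> T" by blast
  have cy: "is_subgroup (cyc y)" "cyc y \<subseteq> P" using is_subgroup_cyc[OF PN(1) finP y(1)] cyc_subset[OF PN(1) y(1)] .
  have "normalizes (cyc y) (P \<inter> K)"
    by (rule normalizes_Int[OF normalizes_mono[OF normalizes_subgroup[OF PN(1)] cy(2)]
          normalizes_mono[OF K'(3) subset_trans[OF cy(2) PG]]])
  then have W: "is_subgroup (cyc y * (P \<inter> K))" using is_subgroup_times[OF cy(1) PK] by blast
  have WP: "cyc y * (P \<inter> K) \<subseteq> P" using set_times_least[OF PN(1) cy(2)] by blast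
  have W_eq: "cyc y * (P \<inter> K) = P"
  proof (rule ccontr)
    assume "cyc y * (P \<inter> K) \<noteq> P"
    then obtain M where M: "maxsub M P" "cyc y * (P \<inter> K) \<subseteq> M"
      using maxsub_exists[OF finP W] WP by blast
    have "P \<inter> K \<subseteq> M" using M(2) set_times_superset2[OF cy(1)] by blast
    then have "P \<inter> T \<subseteq> M" using fr M by blast
    then have "M = P \<inter> T" using maxsubD(4)[OF mPT maxP(1)[OF M(1)] _ maxP(2)[OF M(1)]] maxsubD(3)[OF M(1)] by blast
    moreover have "y \<in> M" using M(2) set_times_superset1[OF PK, of "cyc y"] cyc_self by blast
    ultimately show False using y by blast
  qed
  have yp: "y ^ p \<in> T" using maxsub_power[OF p PN(1) finP PN(3) mPT y(1)] by blast
  have "T \<subseteq> cyc (y ^ p) * K"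
  proof
    fix x assume "x \<in> T"
    then have "x \<in> (P \<inter> T) * K" by (subst (asm) normal_eq_times[OF nT TN nK KT pp])
    then obtain w k where w: "w \<in> P" "w \<in> T" "k \<in> K" "x = w * k"
      by (auto simp: set_times_mem)
    then have "w \<in> cyc y * (P \<inter> K)" using W_eq by simp
    then obtain i k' where i: "k' \<in> P \<inter> K" "w = y ^ i * k'" unfolding set_times_mem cyc_def by blast
    have "y ^ i \<in> T" using w(2) i KT is_subgroup_right_iff[OF T'(1), of k' "y ^ i"] by auto
    \<comment> \<open>For \<open>i\<close> prime to \<open>p\<close>, the elements
      \<open>y ^ p\<close> and \<open>y ^ i\<close> of \<open>T\<close> would generate
      \<open>y\<close>.\<close>
    have "p dvd i"
    proof (rule ccontr)
      assume "\<not> p dvd i"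
      then have "coprime p i" using p prime_imp_coprime by blast
      then show False using coprime_powers_mem[OF T'(1) yp \<open>y ^ i \<in> T\<close>] y by blast
    qed
    then obtain j where "i = p * j" by blast
    then have "x = (y ^ p) ^ j * (k' * k)" using w i by (simp add: mult.assoc flip: power_mult)
    moreover have "k' * k \<in> K" using i w K' by (simp add: is_subgroupD)
    ultimately show "x \<in> cyc (y ^ p) * K" using set_times_intro[OF power_in_cyc] by simp
  qed
  then show ?thesis using cyclic_chief_prime[OF p G ch yp _ pp] by blast
qed

end

lemma finite_maximal_set:
  assumes "finite F" "V \<in> F"
  shows "\<exists>M\<in>F. \<forall>U\<in>F. M \<subseteq> U \<longrightarrow> M = U"
  using finite_has_maximal[of F] assms by blast

text \<open>In the elementary abelian quotient by a subgroup maximal with respect to avoiding \<open>t\<close>, every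
  subgroup of order \<open>p\<close> contains the image of \<open>t\<close>, so the quotient has order \<open>p\<close>.\<close>

lemma maxsub_avoiding:
  assumes p: "prime p" and P: "is_subgroup P" "finite P"
    and V: "is_subgroup V" "V \<subseteq> P" "t \<notin> V" and t: "t \<in> P"
    and c: "\<And>x y. x \<in> P \<Longrightarrow> y \<in> P \<Longrightarrow> commutator x y \<in> V" and pw: "\<And>x. x \<in> P \<Longrightarrow> x ^ p \<in> V"
  shows "\<exists>M. maxsub M P \<and> V \<subseteq> M \<and> t \<notin> M"
proof -
  let ?F = "{U. is_subgroup U \<and> V \<subseteq> U \<and> U \<subseteq> P \<and> t \<notin> U}"
  have finF: "finite ?F" by (rule finite_subset[of _ "Pow P"]) (use P in auto)
  have VF: "V \<in> ?F" using V by simp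
  obtain M where MF: "M \<in> ?F" and mx: "\<forall>U\<in>?F. M \<subseteq> U \<longrightarrow> M = U"
    using finite_maximal_set[OF finF VF] by (rule bexE)
  have max: "M = U" if "U \<in> ?F" "M \<subseteq> U" for U
    using bspec[OF mx that(1)] that(2) by (rule mp)
  from MF have M: "is_subgroup M" "V \<subseteq> M" "M \<subseteq> P" "t \<notin> M" by simp_all
  have n: "normalizes P M"
    unfolding normalizes_def
  proof (intro ballI)
    fix x m assume xm: "x \<in> P" "m \<in> M"
    then have "commutator x m \<in> M" using c M by blast
    then show "x * m * inverse x \<in> M" using xm M by (simp add: conj_eq_commutator is_subgroupD)
  qed
  have "W = M \<or> W = P" if W: "is_subgroup W" "M \<subseteq> W" "W \<subseteq> P" for W
  proof (rule ccontr)
    assume neq: "\<not> (W = M \<or> W = P)"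
    have tW: "t \<in> W"
    proof (rule ccontr)
      assume "t \<notin> W"
      then have "W \<in> ?F" using W M by auto
      then show False using max W neq by blast
    qed
    \<comment> \<open>By maximality of \<open>M\<close>, \<open>t\<close> lies both in
      \<open>W\<close> and in \<open>cyc y * M\<close>. Comparing the two gives a power
      \<open>y ^ i\<close> in \<open>W\<close> with \<open>p\<close> not dividing \<open>i\<close>;
      as \<open>y ^ p\<close> lies in \<open>M\<close>, this forces \<open>y\<close> into
      \<open>W\<close>.\<close>
    obtain y where y: "y \<in> P" "y \<notin> W" using W neq by blast
    have cy: "is_subgroup (cyc y)" "cyc y \<subseteq> P" using is_subgroup_cyc[OF P y(1)] cyc_subset[OF P(1) y(1)] .
    have s: "is_subgroup (cyc y * M)" using is_subgroup_times[OF cy(1) M(1) normalizes_mono[OF n cy(2)]] .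
    have yM: "y \<notin> M" using y W by blast
    have "t \<in> cyc y * M"
    proof (rule ccontr)
      assume "t \<notin> cyc y * M"
      then have "cyc y * M \<in> ?F"
        using s M set_times_superset2[OF cy(1), of M] set_times_least[OF P(1) cy(2) M(3)] by auto
      then have "M = cyc y * M" using max set_times_superset2[OF cy(1)] by blast
      then show False using yM set_times_superset1[OF M(1), of "cyc y"] cyc_self[of y] by blast
    qed
    then obtain i m where im: "m \<in> M" "t = y ^ i * m" by (auto simp: cyc_def set_times_mem)
    have ypM: "y ^ p \<in> M" using pw y M by blast
    have "\<not> p dvd i"
    proof
      assume "p dvd i"
      then have "y ^ i \<in> M" using ypM M(1) by (auto simp: power_mult is_subgroupD elim!: dvdE)
      then show False using im M by (simp add: is_subgroupD)
    qed
    then have "coprime i p" using p prime_imp_coprime coprime_commute by blast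
    moreover have "y ^ i \<in> W" using tW im W is_subgroup_right_iff[OF W(1), of m "y ^ i"] by auto
    moreover have "y ^ p \<in> W" using ypM W by blast
    ultimately show False using coprime_powers_mem[OF W(1)] y by blast
  qed
  moreover have "M \<noteq> P" using M t by blast
  ultimately have "maxsub M P" using M by (simp add: maxsub_def psubset_eq)
  then show ?thesis using M by blast
qed

section \<open>Chief factors not contained in the Frattini subgroup\<close>

context sylow_setting
begin

lemma sylow_of_G:
  obtains S where "is_sylow p S G" "P \<subseteq> S" "normalizes S P"
proof -
  obtain S where S: "is_sylow p S G" "P \<subseteq> S" using sylow_contains[OF p G PN(1) PG PN(3)] by blast
  note S' = is_sylowD[OF S(1)]
  have sy: "is_sylow p (S \<inter> N) N" using sylow_Int_normal[OF p G S(1) N] .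
  note sy' = is_sylowD[OF sy]
  have "P = S \<inter> N"
  proof (rule card_seteq)
    show "finite (S \<inter> N)" using fin NG by blast
    show "P \<subseteq> S \<inter> N" using S PN by blast
    show "card (S \<inter> N) \<le> card P"
      using sylow_card_le[OF p NG(1) fin[OF NG(2)] P sy'(1,2,3)] .
  qed
  moreover have "normalizes S (S \<inter> N)"
    by (rule normalizes_Int[OF normalizes_subgroup[OF S'(1)] normalizes_mono[OF NG(3) S'(2)]])
  ultimately show thesis using that S by simp
qed

lemma supplement_case:
  assumes ch: "chief G T K" and TN: "T \<subseteq> N" and pp: "prime_power_of p (idx T K)"
    and M0: "maxsub M0 P" "P \<inter> K \<subseteq> M0" "\<not> P \<inter> T \<subseteq> M0"
  shows "idx T K = p"
proof -
  note nT = chiefD(1)[OF ch] and nK = chiefD(2)[OF ch] and KT = chiefD(3)[OF ch]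
  note T' = is_normalD[OF nT] and K' = is_normalD[OF nK]
  note PT = P_Int_subgroup[OF nT] and PK = P_Int_subgroup[OF nK]
  obtain S where S: "is_sylow p S G" "P \<subseteq> S" "normalizes S P" using sylow_of_G .
  note S' = is_sylowD[OF S(1)]
  have finPT: "finite (P \<inter> T)" using finP by blast
  have nSPT: "normalizes S (P \<inter> T)" by (rule normalizes_Int[OF S(3) normalizes_mono[OF T'(3) S'(2)]])
  have nSPK: "normalizes S (P \<inter> K)" by (rule normalizes_Int[OF S(3) normalizes_mono[OF K'(3) S'(2)]])
  \<comment> \<open>The Frattini subgroup of \<open>P\<close> modulo \<open>P \<inter> K\<close>.
    Since \<open>S\<close> normalizes \<open>P\<close> and \<open>P \<inter> K\<close>, conjugation
    by \<open>S\<close> permutes the maximal subgroups in the intersection, so \<Phi> is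
    \<open>S\<close>-invariant.\<close>
  define \<Phi> where "\<Phi> = \<Inter>{M. maxsub M P \<and> P \<inter> K \<subseteq> M}"
  have \<Phi>: "is_subgroup \<Phi>" unfolding \<Phi>_def using maxsubD(1) by (intro is_subgroup_Inter) blast
  have \<Phi>M0: "\<Phi> \<subseteq> M0" using M0 by (auto simp: \<Phi>_def)
  have \<Phi>P: "\<Phi> \<subseteq> P" using \<Phi>M0 maxP(2)[OF M0(1)] by blast
  have PK\<Phi>: "P \<inter> K \<subseteq> \<Phi>" by (auto simp: \<Phi>_def)
  have nS\<Phi>: "normalizes S \<Phi>"
    unfolding normalizes_def
  proof (intro ballI)
    fix s x assume s: "s \<in> S" and x: "x \<in> \<Phi>"
    have sI: "inverse s \<in> S" using s S' by (simp add: is_subgroupD)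
    have "s * x * inverse s \<in> M" if M: "maxsub M P" "P \<inter> K \<subseteq> M" for M
    proof -
      have "maxsub (conjugate (inverse s) M) P"
        by (rule maxsub_conjugate[OF M(1) conjugate_normal[OF S(3) S'(1) sI]])
      moreover have "P \<inter> K \<subseteq> conjugate (inverse s) M"
        using conjugate_mono[OF M(2), of "inverse s"] conjugate_normal[OF nSPK S'(1) sI] by simp
      ultimately have "x \<in> conjugate (inverse s) M" using x by (auto simp: \<Phi>_def)
      then show ?thesis by (simp add: conjugate_mem)
    qed
    then show "s * x * inverse s \<in> \<Phi>" by (simp add: \<Phi>_def)
  qed
  \<comment> \<open>\<open>U\<close> will be a maximal \<open>S\<close>-invariant proper subgroup of
    \<open>P \<inter> T\<close> over \<open>P \<inter> T \<inter> \<Phi>\<close>. It exists because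
    \<open>\<Phi> \<subseteq> M0\<close> does not contain \<open>P \<inter> T\<close>.\<close>
  let ?F = "{U. is_subgroup U \<and> normalizes S U \<and> P \<inter> T \<inter> \<Phi> \<subseteq> U \<and> U \<subset> P \<inter> T}"
  have finF: "finite ?F" by (rule finite_subset[of _ "Pow P"]) (use finP in auto)
  have PT\<Phi>: "P \<inter> T \<inter> \<Phi> \<in> ?F"
    using is_subgroup_Int[OF PT \<Phi>] normalizes_Int[OF nSPT nS\<Phi>] \<Phi>M0 M0(3) by blast
  obtain U where UF: "U \<in> ?F" and mx: "\<forall>U'\<in>?F. U \<subseteq> U' \<longrightarrow> U = U'"
    using finite_maximal_set[OF finF PT\<Phi>] by (rule bexE)
  have max: "U = U'" if "U' \<in> ?F" "U \<subseteq> U'" for U'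
    using bspec[OF mx that(1)] that(2) by (rule mp)
  from UF have U: "is_subgroup U" "normalizes S U" "P \<inter> T \<inter> \<Phi> \<subseteq> U" "U \<subset> P \<inter> T" by simp_all
  have nPTU: "normalizes (P \<inter> T) U" using normalizes_mono[OF U(2)] S(2) by blast
  \<comment> \<open>The points of \<open>P \<inter> T\<close> modulo \<open>U\<close> fixed by
    \<open>S\<close> form an \<open>S\<close>-invariant subgroup, nontrivial because
    \<open>S\<close> is a \<open>p\<close>-group. By maximality of \<open>U\<close> the action is
    trivial, so every subgroup between \<open>U\<close> and \<open>P \<inter> T\<close> is
    \<open>S\<close>-invariant.\<close>
  let ?Z = "centralizer_mod (P \<inter> T) S U"
  obtain t0 where t0: "t0 \<in> P \<inter> T" "t0 \<notin> U" "\<forall>s\<in>S. commutator s t0 \<in> U"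
    using p_group_fixed_coset[OF p S'(1) fin[OF S'(2)] S'(3) PT finPT nSPT U(1,4,2) nPTU pp_idx[OF PT _ U(1)]] U(4)
    by blast
  have Z: "is_subgroup ?Z" by (rule is_subgroup_centralizer_mod[OF PT U(1) nPTU])
  have nZ: "normalizes S ?Z"
    by (rule normalizes_centralizer_mod[OF S'(1) normalizes_subgroup[OF S'(1)] nSPT U(2)])
  have UZ: "U \<subseteq> ?Z" using U(4) commutator_mem_normal[OF U(1,2)] by (auto simp: centralizer_mod_def)
  have "?Z = P \<inter> T"
  proof (rule ccontr)
    assume "?Z \<noteq> P \<inter> T"
    then have "?Z \<in> ?F" using Z nZ UZ U(3) by (auto simp: centralizer_mod_def)
    then have "U = ?Z" using max UZ by blast
    then show False using t0 by (auto simp: centralizer_mod_def)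
  qed
  then have cU: "commutator s x \<in> U" if "s \<in> S" "x \<in> P \<inter> T" for s x
    using that by (auto simp: centralizer_mod_def)
  have UP: "U \<subseteq> P" using U(4) by blast
  have nPU: "normalizes \<Phi> U" using normalizes_mono[OF U(2)] S(2) \<Phi>P by blast
  \<comment> \<open>\<open>P / V\<close> is elementary abelian and \<open>t0\<close> is nontrivial
    in it, so \<open>maxsub_avoiding\<close> provides a maximal subgroup over \<open>V\<close> that
    misses \<open>t0\<close>.\<close>
  define V where "V = \<Phi> * U"
  have V: "is_subgroup V" "V \<subseteq> P" "\<Phi> \<subseteq> V" "U \<subseteq> V"
    unfolding V_def using is_subgroup_times[OF \<Phi> U(1) nPU] set_times_least[OF PN(1) \<Phi>P UP]
      set_times_superset1[OF U(1)] set_times_superset2[OF \<Phi>] .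
  have tV: "t0 \<notin> V"
  proof
    assume "t0 \<in> V"
    then obtain f u where fu: "f \<in> \<Phi>" "u \<in> U" "t0 = f * u" by (auto simp: V_def set_times_mem)
    then have "f \<in> P \<inter> T" using is_subgroup_right_iff[OF PT, of u f] t0 U(4) by blast
    then have "f \<in> U" using fu U(3) by blast
    then show False using fu t0 U(1) by (simp add: is_subgroupD)
  qed
  have c\<Phi>: "commutator x y \<in> V" if "x \<in> P" "y \<in> P" for x y
  proof -
    have "commutator x y \<in> \<Phi>" using maxsub_commutator[OF p PN(1) finP PN(3) _ that] by (auto simp: \<Phi>_def)
    then show ?thesis using V by blast
  qed
  have p\<Phi>: "x ^ p \<in> V" if "x \<in> P" for x
  proof -
    have "x ^ p \<in> \<Phi>" using maxsub_power[OF p PN(1) finP PN(3) _ that] by (auto simp: \<Phi>_def)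
    then show ?thesis using V by blast
  qed
  obtain M where M: "maxsub M P" "V \<subseteq> M" "t0 \<notin> M"
    using maxsub_avoiding[OF p PN(1) finP V(1,2) tV _ c\<Phi> p\<Phi>] t0 by blast
  note M' = maxP[OF M(1)] and MK = idx_times_normal[OF maxP(1,3)[OF M(1)] nK]
  have PKM: "P \<inter> K \<subseteq> M" using PK\<Phi> V M by blast
  have MKT: "M * K \<inter> T = (M \<inter> T) * K" using dedekind_right[OF T'(1) KT] .
  have "normalizes S (M \<inter> T)"
    unfolding normalizes_def
  proof (intro ballI)
    fix s x assume s: "s \<in> S" and x: "x \<in> M \<inter> T"
    have "commutator s x \<in> M \<inter> T" using cU[OF s, of x] x M'(2) U(4) V(4) M(2) by blast
    then show "s * x * inverse s \<in> M \<inter> T"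
      using x is_subgroupD(2)[OF is_subgroup_Int[OF M'(1) T'(1)]] by (simp add: conj_eq_commutator)
  qed
  then have nS: "normalizes S (M * K \<inter> T)"
    unfolding MKT by (rule normalizes_times) (rule normalizes_mono[OF K'(3) S'(2)])
  have "is_normal (M * K \<inter> T) G"
    using com_alternative[OF M'(1,3) ch]
  proof
    assume "T \<subseteq> com M G * K"
    then have "M * K \<inter> T = ((M * K) \<inter> (com M G * K)) \<inter> T" by (simp add: Int_assoc Int_absorb1)
    then have eq: "M * K \<inter> T = (M \<inter> com M G) * K \<inter> T"
      by (simp only: com_Int_times[OF M(1) ch PKM subset_trans[OF KT TN]])
    show ?thesis using IC_Pi_normal[OF M(1) ch S(1)] nS by (simp only: eq)
  qed
  then have "M * K \<inter> T = K \<or> M * K \<inter> T = T" using chiefD(5)[OF ch] MK(3) KT by blast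
  \<comment> \<open>The alternative \<open>M K \<inter> T = T\<close> would put \<open>t0\<close>
    into \<open>M (K \<inter> P)\<close>, which is contained in \<open>M\<close>.\<close>
  then have MKT_K: "M * K \<inter> T = K"
  proof
    assume "M * K \<inter> T = T"
    then have "t0 \<in> M * K \<inter> P" using t0 by blast
    also have "M * K \<inter> P = M * (K \<inter> P)" using dedekind_left[OF PN(1) M'(2)] .
    also have "\<dots> \<subseteq> M" using set_times_least[OF M'(1) order_refl] PKM by blast
    finally show ?thesis using M(3) by blast
  qed
  have MTK: "M \<inter> T \<subseteq> K" using MK(4) MKT_K by blast
  have eq: "(P \<inter> T) \<inter> K = (P \<inter> T) \<inter> M" using MTK PKM KT by blast
  have PTG: "P \<inter> T \<subseteq> G" using PG by blast
  \<comment> \<open>\<open>P \<inter> T\<close> meets \<open>K\<close> and \<open>M\<close> in the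
    same subgroup, and \<open>M\<close> supplements it in \<open>P\<close>; so the order of
    \<open>T / K\<close> is the index of \<open>M\<close>.\<close>
  have "idx T K = idx ((P \<inter> T) * K) K" using normal_eq_times[OF nT TN nK KT pp] by simp
  also have "\<dots> = idx (P \<inter> T) ((P \<inter> T) \<inter> K)" using idx_times_normal(5)[OF PT PTG nK] .
  also have "\<dots> = idx ((P \<inter> T) * M) M" unfolding eq by (rule idx_times[OF PT M'(1) finPT M'(4), symmetric])
  also have "(P \<inter> T) * M = P"
  proof -
    have s: "is_subgroup ((P \<inter> T) * M)" using is_subgroup_times[OF PT M'(1)] normalizes_mono[OF M'(5)] by blast
    have "(P \<inter> T) * M = M \<or> (P \<inter> T) * M = P"
      by (rule maxsubD(4)[OF M(1) s set_times_superset2[OF PT] set_times_least[OF PN(1) _ M'(2)]]) blast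
    moreover have "t0 \<in> (P \<inter> T) * M" using t0 set_times_superset1[OF M'(1)] by blast
    ultimately show ?thesis using M(3) by blast
  qed
  finally show ?thesis using M'(6) by simp
qed

end

section \<open>Abelian actions of exponent dividing \<open>p - 1\<close>\<close>

text \<open>Multiplication by a primitive root \<open>g\<close> permutes the nonzero residues, so
  the sum is unchanged modulo \<open>p\<close> by the factor \<open>g ^ j\<close>. Since
  \<open>j\<close> is positive and below the order \<open>p - 1\<close> of \<open>g\<close>, this
  factor is not 1 and the sum vanishes.\<close>

lemma prime_dvd_power_sum:
  fixes p j :: nat
  assumes p: "prime p" and j: "0 < j" "j < p - 1"
  shows "p dvd (\<Sum>l\<in>{1..<p}. l ^ j)"
proof -
  obtain g where g: "residue_primroot p g"
    using prime_primitive_root_exists[of p] p prime_gt_1_nat[OF p] by auto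
  have cop: "coprime p g" and ord: "ord p g = p - 1"
    using g totient_prime[OF p] by (auto simp: residue_primroot_def)
  have ndvd: "\<not> p dvd g" using cop p by (metis coprime_absorb_left not_prime_unit)
  let ?S = "\<Sum>l\<in>{1..<p}. l ^ j"
  have img: "(\<lambda>l. g * l mod p) ` {1..<p} = {1..<p}"
  proof (rule card_subset_eq)
    show sub: "(\<lambda>l. g * l mod p) ` {1..<p} \<subseteq> {1..<p}"
    proof clarify
      fix l assume l: "l \<in> {1..<p}"
      have "\<not> p dvd l" using l by (auto dest: dvd_imp_le)
      then have "\<not> p dvd g * l" using ndvd p prime_dvd_mult_iff by blast
      then have "g * l mod p \<noteq> 0" by (simp add: dvd_eq_mod_eq_0)
      then show "g * l mod p \<in> {1..<p}" using prime_gt_0_nat[OF p] by simp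
    qed
    have "inj_on (\<lambda>l. g * l mod p) {1..<p}"
    proof (rule inj_onI)
      fix a b assume ab: "a \<in> {1..<p}" "b \<in> {1..<p}" "g * a mod p = g * b mod p"
      then have "[g * a = g * b] (mod p)" by (simp add: cong_def)
      then have "[a = b] (mod p)" using cong_mult_lcancel_nat[of g p a b] cop by (simp add: coprime_commute)
      then show "a = b" using ab by (simp add: cong_def)
    qed
    then show "card ((\<lambda>l. g * l mod p) ` {1..<p}) = card {1..<p}" by (rule card_image)
  qed simp
  have inj: "inj_on (\<lambda>l. g * l mod p) {1..<p}"
    using img by (metis eq_card_imp_inj_on finite_atLeastLessThan)
  have "?S = (\<Sum>l\<in>(\<lambda>l. g * l mod p) ` {1..<p}. l ^ j)" by (simp only: img)
  also have "\<dots> = (\<Sum>l\<in>{1..<p}. (g * l mod p) ^ j)" using inj by (simp add: sum.reindex)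
  finally have S: "?S = (\<Sum>l\<in>{1..<p}. (g * l mod p) ^ j)" .
  have "[(\<Sum>l\<in>{1..<p}. (g * l mod p) ^ j) = (\<Sum>l\<in>{1..<p}. (g * l) ^ j)] (mod p)"
    by (rule cong_sum) (simp add: cong_pow)
  then have "[?S = g ^ j * ?S] (mod p)"
    by (simp only: S[symmetric] power_mult_distrib sum_distrib_left)
  then have cg: "[g ^ j * ?S = 1 * ?S] (mod p)" by (simp add: cong_sym)
  show ?thesis
  proof (rule ccontr)
    assume "\<not> p dvd ?S"
    then have "coprime ?S p" using p by (metis coprime_commute prime_imp_coprime)
    then have "[g ^ j = 1] (mod p)" using cg cong_mult_rcancel_nat by blast
    then have "ord p g dvd j" using ord_divides by blast
    then show False using j ord by (auto dest: dvd_imp_le)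
  qed
qed

text \<open>The element \<open>t l\<close> of the proof is the component of \<open>y\<close> for the eigenvalue \<open>l\<^sup>-\<^sup>1\<close>, up to a scalar:
  the power sums make the product of the \<open>t l\<close> equal to \<open>y [^] (p - 1)\<close>, so some \<open>t l\<close> is not trivial.\<close>

lemma (in comm_group) hom_eigenvector:
  assumes f: "f \<in> hom G G" and p: "prime (p::nat)"
    and exp: "\<And>x. x \<in> carrier G \<Longrightarrow> x [^] p = \<one>"
    and per: "\<And>x. x \<in> carrier G \<Longrightarrow> (f ^^ (p - 1)) x = x"
    and y: "y \<in> carrier G" "y \<noteq> \<one>"
  shows "\<exists>v\<in>carrier G. v \<noteq> \<one> \<and> (\<exists>i::nat. f v = v [^] i)"
proof -
  interpret f: group_hom G G f
    using f by unfold_locales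
  define a where "a j = (f ^^ j) y" for j
  have a: "a j \<in> carrier G" for j
    by (induction j) (use y in \<open>simp_all add: a_def\<close>)
  have pow_cong: "x [^] m = x [^] n" if "x \<in> carrier G" "[m = n] (mod p)" for x and m n :: nat
  proof -
    have red: "x [^] m = x [^] (m mod p)" for m :: nat
    proof -
      have "x [^] m = x [^] (p * (m div p) + m mod p)" by simp
      also have "\<dots> = (x [^] p) [^] (m div p) \<otimes> x [^] (m mod p)"
        using that by (simp add: nat_pow_mult nat_pow_pow)
      finally show ?thesis using that exp by simp
    qed
    show ?thesis using that red[of m] red[of n] by (simp add: cong_def)
  qed
  define t where "t l = (\<Otimes>j\<in>{..<p - 1}. a j [^] (l ^ j))" for l :: nat
  have t: "t l \<in> carrier G" for l unfolding t_def using a by (intro finprod_closed) auto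
  \<comment> \<open>By Fermat, \<open>l ^ (p - 2)\<close> represents the inverse of \<open>l\<close>
    modulo \<open>p\<close>. Applying \<open>f\<close> shifts the index \<open>j\<close> by one,
    cyclically because the iterate of order \<open>p - 1\<close> fixes \<open>y\<close>, and the
    shift costs one factor \<open>l\<close> in the exponent.\<close>
  have eig: "f (t l) = t l [^] (l ^ (p - 2))" if l: "l \<in> {1..<p}" for l
  proof -
    have "p - 1 = Suc (p - 2)" using prime_ge_2_nat[OF p] by simp
    then have p1: "{..<p - 1} = insert 0 (Suc ` {..<p - 2})"
      by (simp only: lessThan_Suc_eq_insert_0)
    have ndvd: "\<not> p dvd l" using l by (auto dest: dvd_imp_le)
    have fermat: "[l ^ (p - 1) = 1] (mod p)" using fermat_theorem[OF p ndvd] .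
    have "f (t l) = (\<Otimes>j\<in>{..<p - 1}. f (a j [^] (l ^ j)))"
    proof -
      have "f (\<Otimes>j\<in>A. a j [^] (l ^ j)) = (\<Otimes>j\<in>A. f (a j [^] (l ^ j)))" if "finite A" for A
        using that by (induction A) (use a in \<open>simp_all add: Pi_def\<close>)
      then show ?thesis by (simp add: t_def)
    qed
    also have "\<dots> = (\<Otimes>j\<in>{..<p - 1}. a (Suc j) [^] (l ^ j))"
      by (rule finprod_cong') (use a in \<open>simp_all add: Pi_def f.hom_nat_pow a_def\<close>)
    also have "{..<p - 1} = insert (p - 2) {..<p - 2}" using prime_ge_2_nat[OF p] by auto
    also have "(\<Otimes>j\<in>insert (p - 2) {..<p - 2}. a (Suc j) [^] (l ^ j)) =
        a (Suc (p - 2)) [^] (l ^ (p - 2)) \<otimes> (\<Otimes>j\<in>{..<p - 2}. a (Suc j) [^] (l ^ j))"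
      using a by (subst finprod_insert) auto
    also have "a (Suc (p - 2)) = a 0"
    proof -
      have "Suc (p - 2) = p - 1" using prime_ge_2_nat[OF p] by simp
      then show ?thesis using per[OF y(1)] by (simp add: a_def)
    qed
    also have "(\<Otimes>j\<in>{..<p - 2}. a (Suc j) [^] (l ^ j)) = (\<Otimes>j\<in>{..<p - 2}. a (Suc j) [^] (l ^ Suc j * l ^ (p - 2)))"
    proof (rule finprod_cong')
      fix j
      have "Suc j + (p - 2) = j + (p - 1)" using prime_ge_2_nat[OF p] by simp
      then have "l ^ Suc j * l ^ (p - 2) = l ^ j * l ^ (p - 1)" by (metis power_add)
      moreover have "[l ^ j * l ^ (p - 1) = l ^ j * 1] (mod p)" using fermat by (intro cong_mult) simp_all
      ultimately have "[l ^ j = l ^ Suc j * l ^ (p - 2)] (mod p)" by (metis cong_sym mult.right_neutral)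
      then show "a (Suc j) [^] (l ^ j) = a (Suc j) [^] (l ^ Suc j * l ^ (p - 2))" using pow_cong a by blast
    qed (use a in auto)
    also have "\<dots> = (\<Otimes>j\<in>Suc ` {..<p - 2}. a j [^] (l ^ j * l ^ (p - 2)))"
      using a by (subst finprod_reindex) (auto simp: Pi_def)
    also have "a 0 [^] (l ^ (p - 2)) \<otimes> \<dots> = (\<Otimes>j\<in>{..<p - 1}. a j [^] (l ^ j * l ^ (p - 2)))"
      unfolding p1 using a by (subst finprod_insert) auto
    also have "\<dots> = (\<Otimes>j\<in>{..<p - 1}. (a j [^] (l ^ j)) [^] (l ^ (p - 2)))"
      using a by (simp add: nat_pow_pow)
    also have "\<dots> = t l [^] (l ^ (p - 2))"
    proof -
      have "(\<Otimes>j\<in>A. (a j [^] (l ^ j)) [^] m) = (\<Otimes>j\<in>A. a j [^] (l ^ j)) [^] m" if "finite A" for A and m :: nat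
        using that by (induction A) (use a in \<open>simp_all add: Pi_def nat_pow_distrib\<close>)
      then show ?thesis by (simp add: t_def)
    qed
    finally show ?thesis .
  qed
  have prod: "(\<Otimes>l\<in>A. t l) = (\<Otimes>j\<in>{..<p - 1}. a j [^] (\<Sum>l\<in>A. l ^ j))" if "finite A" for A
    using that
  proof (induction A)
    case empty
    then show ?case using a by (simp add: finprod_one_eqI)
  next
    case (insert x A)
    have "(\<Otimes>l\<in>insert x A. t l) = t x \<otimes> (\<Otimes>j\<in>{..<p - 1}. a j [^] (\<Sum>l\<in>A. l ^ j))"
      using insert t by (simp add: Pi_def)
    also have "\<dots> = (\<Otimes>j\<in>{..<p - 1}. a j [^] (x ^ j) \<otimes> a j [^] (\<Sum>l\<in>A. l ^ j))"
      unfolding t_def using a by (intro finprod_multf[symmetric]) auto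
    also have "\<dots> = (\<Otimes>j\<in>{..<p - 1}. a j [^] (\<Sum>l\<in>insert x A. l ^ j))"
      using insert a by (simp add: nat_pow_mult)
    finally show ?case .
  qed
  \<comment> \<open>The exponent of \<open>a j\<close> is a power sum, which is \<open>p - 1\<close>
    for \<open>j = 0\<close> and divisible by \<open>p\<close> otherwise.\<close>
  have "(\<Otimes>l\<in>{1..<p}. t l) = (\<Otimes>j\<in>{..<p - 1}. if 0 = j then a j [^] (p - 1) else \<one>)"
    unfolding prod[OF finite_atLeastLessThan]
  proof (rule finprod_cong')
    fix j assume j: "j \<in> {..<p - 1}"
    show "a j [^] (\<Sum>l\<in>{1..<p}. l ^ j) = (if 0 = j then a j [^] (p - 1) else \<one>)"
    proof (cases "j = 0")
      case False
      then have "[(\<Sum>l\<in>{1..<p}. l ^ j) = 0] (mod p)" using prime_dvd_power_sum[OF p, of j] j by (simp add: cong_0_iff)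
      then show ?thesis using False pow_cong[OF a] by (metis nat_pow_0)
    qed simp
  qed (use a in auto)
  also have "\<dots> = a 0 [^] (p - 1)"
    using finprod_singleton[of 0 "{..<p - 1}" "\<lambda>j. a j [^] (p - 1)"] a prime_ge_2_nat[OF p]
    by auto
  finally have pr: "(\<Otimes>l\<in>{1..<p}. t l) = y [^] (p - 1)" by (simp add: a_def)
  have "\<exists>l\<in>{1..<p}. t l \<noteq> \<one>"
  proof (rule ccontr)
    assume "\<not> (\<exists>l\<in>{1..<p}. t l \<noteq> \<one>)"
    then have "(\<Otimes>l\<in>{1..<p}. t l) = \<one>" by (intro finprod_one_eqI) blast
    then have "y [^] (p - 1) = \<one>" using pr by metis
    moreover have "y [^] (p - 1) \<otimes> y = y [^] p"
      using y nat_pow_Suc[of y "p - 1"] prime_gt_0_nat[OF p] by simp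
    ultimately show False using y exp[OF y(1)] by simp
  qed
  then show ?thesis using eig t by blast
qed

text \<open>The section \<open>T / K\<close> as a record group gives access to finite products in
  commutative groups, here for eigenvectors and later for the transfer. Set multiplication is the
  product of cosets once \<open>T\<close> normalizes \<open>K\<close>.\<close>

definition coset_group :: "'g::group_mult set \<Rightarrow> 'g set \<Rightarrow> 'g set monoid"
  where "coset_group T K = \<lparr>carrier = left_cosets T K, monoid.mult = (*), one = K\<rparr>"

lemma coset_mult:
  assumes K: "is_subgroup K" and n: "normalizes T K" and T: "is_subgroup T" and y: "y \<in> T"
  shows "(x *o K) * (y *o K) = (x * y) *o K"
proof (intro equalityI subsetI)
  fix z assume "z \<in> (x *o K) * (y *o K)"
  then obtain k k' where k: "k \<in> K" "k' \<in> K" "z = (x * k) * (y * k')"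
    by (auto simp: set_times_mem elt_set_times_def)
  have "inverse (x * y) * z = (inverse y * k * y) * k'" by (simp add: k group_word)
  moreover have "(inverse y * k * y) * k' \<in> K" using normalizesD2[OF n T y k(1)] k K by (simp add: is_subgroupD)
  ultimately show "z \<in> (x * y) *o K" by (simp add: elt_set_times_mem)
next
  fix z assume "z \<in> (x * y) *o K"
  then obtain k where k: "k \<in> K" "z = x * y * k" by (auto simp: elt_set_times_def)
  have "x * 1 \<in> x *o K" "y * k \<in> y *o K" using k K by (simp_all add: elt_set_times_mem is_subgroupD)
  then have "(x * 1) * (y * k) \<in> (x *o K) * (y *o K)" by (rule set_times_intro)
  then show "z \<in> (x *o K) * (y *o K)" by (simp add: k mult.assoc)
qed

lemma coset_eq_self_iff: "is_subgroup K \<Longrightarrow> x *o K = K \<longleftrightarrow> x \<in> K"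
proof -
  assume K: "is_subgroup K"
  have "1 *o K = x *o K \<longleftrightarrow> inverse 1 * x \<in> K" by (rule left_coset_eq_iff[OF K])
  then show ?thesis by (auto simp: elt_set_times_eq_image)
qed

lemma coset_in_left_cosets: "x \<in> T \<Longrightarrow> x *o K \<in> left_cosets T K"
  by (simp add: left_cosets_def)

context
  fixes T K :: "'g::group_mult set"
  assumes T: "is_subgroup T" and K: "is_subgroup K" "K \<subseteq> T" and ab: "\<And>x y. x \<in> T \<Longrightarrow> y \<in> T \<Longrightarrow> commutator x y \<in> K"
begin

lemma abelian_mod_normalizes: "normalizes T K"
  unfolding normalizes_def
proof (intro ballI)
  fix x k assume "x \<in> T" "k \<in> K"
  then show "x * k * inverse x \<in> K" using ab[of x k] K by (auto simp: conj_eq_commutator is_subgroupD)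
qed

lemma comm_group_coset_group: "comm_group (coset_group T K)"
proof (rule comm_groupI)
  note m = coset_mult[OF K(1) abelian_mod_normalizes T]
  have K1: "K = 1 *o K" by (simp add: elt_set_times_eq_image)
  show "\<one>\<^bsub>coset_group T K\<^esub> \<in> carrier (coset_group T K)"
    using coset_in_left_cosets[OF is_subgroupD(1)[OF T], of K] by (simp add: coset_group_def flip: K1)
  fix x assume "x \<in> carrier (coset_group T K)"
  then obtain a where a: "a \<in> T" "x = a *o K" by (auto simp: coset_group_def left_cosets_def)
  have "\<one>\<^bsub>coset_group T K\<^esub> \<otimes>\<^bsub>coset_group T K\<^esub> x = (1 *o K) * (a *o K)"
    by (simp add: coset_group_def a flip: K1)
  then show "\<one>\<^bsub>coset_group T K\<^esub> \<otimes>\<^bsub>coset_group T K\<^esub> x = x" using m[OF a(1), of 1] a by simp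
  have "(inverse a *o K) * (a *o K) = K" using m[OF a(1), of "inverse a"] K1 by simp
  then show "\<exists>y\<in>carrier (coset_group T K). y \<otimes>\<^bsub>coset_group T K\<^esub> x = \<one>\<^bsub>coset_group T K\<^esub>"
    using coset_in_left_cosets[OF is_subgroupD(3)[OF T a(1)], of K] by (auto simp: coset_group_def a)
  fix y assume "y \<in> carrier (coset_group T K)"
  then obtain b where b: "b \<in> T" "y = b *o K" by (auto simp: coset_group_def left_cosets_def)
  show "x \<otimes>\<^bsub>coset_group T K\<^esub> y \<in> carrier (coset_group T K)"
    using coset_in_left_cosets[OF is_subgroupD(2)[OF T a(1) b(1)], of K] by (simp add: coset_group_def a b m)
  have "(a * b) *o K = (b * a) *o K"
  proof -
    have "inverse (a * b) * (b * a) = commutator (inverse b) (inverse a)"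
      by (simp add: commutator_def group_word)
    also have "\<dots> \<in> K" using ab a b T by (simp add: is_subgroupD)
    finally show ?thesis by (simp only: left_coset_eq_iff[OF K(1)])
  qed
  then show "x \<otimes>\<^bsub>coset_group T K\<^esub> y = y \<otimes>\<^bsub>coset_group T K\<^esub> x"
    by (simp add: coset_group_def a b m)
  fix z
  show "x \<otimes>\<^bsub>coset_group T K\<^esub> y \<otimes>\<^bsub>coset_group T K\<^esub> z = x \<otimes>\<^bsub>coset_group T K\<^esub> (y \<otimes>\<^bsub>coset_group T K\<^esub> z)"
    by (simp add: coset_group_def mult.assoc)
qed

lemma coset_group_pow: "x \<in> T \<Longrightarrow> (x *o K) [^]\<^bsub>coset_group T K\<^esub> (n::nat) = (x ^ n) *o K"
proof (induction n)
  case 0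
  interpret comm_group "coset_group T K" by (rule comm_group_coset_group)
  show ?case by (simp add: elt_set_times_eq_image) (simp add: coset_group_def)
next
  case (Suc n)
  interpret comm_group "coset_group T K" by (rule comm_group_coset_group)
  have "(x *o K) [^]\<^bsub>coset_group T K\<^esub> Suc n = ((x ^ n) *o K) * (x *o K)"
    using Suc by simp (simp add: coset_group_def)
  then show ?case using coset_mult[OF K(1) abelian_mod_normalizes T Suc.prems, of "x ^ n"]
    by (simp add: power_commutes)
qed

lemma abelian_mod_power: "x \<in> T \<Longrightarrow> y \<in> T \<Longrightarrow> \<exists>k\<in>K. (x * y) ^ n = x ^ n * y ^ n * k"
proof -
  assume x: "x \<in> T" and y: "y \<in> T"
  interpret comm_group "coset_group T K" by (rule comm_group_coset_group)
  note m = coset_mult[OF K(1) abelian_mod_normalizes T]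
  have xc: "x *o K \<in> carrier (coset_group T K)" "y *o K \<in> carrier (coset_group T K)"
    using x y coset_in_left_cosets by (auto simp: coset_group_def)
  have e1: "(x *o K) \<otimes>\<^bsub>coset_group T K\<^esub> (y *o K) = (x * y) *o K"
    by (simp add: coset_group_def m[OF y])
  have e2: "((x ^ n) *o K) \<otimes>\<^bsub>coset_group T K\<^esub> ((y ^ n) *o K) = (x ^ n * y ^ n) *o K"
    by (simp add: coset_group_def m[OF is_subgroupD(4)[OF T y]])
  have "((x * y) ^ n) *o K = ((x * y) *o K) [^]\<^bsub>coset_group T K\<^esub> n"
    by (rule coset_group_pow[OF is_subgroupD(2)[OF T x y], symmetric])
  also have "\<dots> = ((x *o K) \<otimes>\<^bsub>coset_group T K\<^esub> (y *o K)) [^]\<^bsub>coset_group T K\<^esub> n"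
    by (simp only: e1)
  also have "\<dots> = (x *o K) [^]\<^bsub>coset_group T K\<^esub> n \<otimes>\<^bsub>coset_group T K\<^esub> (y *o K) [^]\<^bsub>coset_group T K\<^esub> n"
    by (rule nat_pow_distrib[OF xc])
  also have "\<dots> = (x ^ n * y ^ n) *o K"
    by (simp only: coset_group_pow[OF x] coset_group_pow[OF y] e2)
  finally have "(x ^ n * y ^ n) *o K = ((x * y) ^ n) *o K" ..
  then have "inverse (x ^ n * y ^ n) * (x * y) ^ n \<in> K" using left_coset_eq_iff[OF K(1)] by blast
  then show ?thesis by (intro bexI) auto
qed

end

text \<open>Conjugations that act on \<open>z\<close> modulo \<open>K\<close> by exponents compose
  by multiplying the exponents; this is why such actions commute.\<close>

lemma conj_mult_power:
  assumes K: "is_normal K G" and G: "is_subgroup G" and zG: "z \<in> G" and g: "g \<in> G"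
    and k: "k1 \<in> K" "g * z * inverse g = z ^ a * k1" "k2 \<in> K"
  shows "\<exists>k\<in>K. g * (z ^ b * k2) * inverse g = z ^ (a * b) * k"
proof -
  note K' = is_normalD[OF K]
  have zaG: "z ^ a \<in> G" using zG G by (simp add: is_subgroupD)
  obtain k' where k': "k' \<in> K" "(z ^ a * k1) ^ b = (z ^ a) ^ b * k'"
    using mult_power_mod[OF K'(1,3) G zaG k(1)] by blast
  have "g * (z ^ b * k2) * inverse g = (g * z * inverse g) ^ b * (g * k2 * inverse g)"
    unfolding group_power_conj by (simp add: group_word)
  also have "\<dots> = (z ^ a) ^ b * k' * (g * k2 * inverse g)" by (simp only: k(2) k'(2))
  also have "\<dots> = z ^ (a * b) * (k' * (g * k2 * inverse g))" by (simp only: power_mult mult.assoc)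
  finally show ?thesis using k' k g K' by (auto simp: is_subgroupD normalizesD)
qed

text \<open>The action on a factor of order \<open>p\<close> is by powers, so it is abelian of exponent dividing \<open>p - 1\<close>.\<close>

context
  fixes G L K :: "'g::group_mult set" and p :: nat
  assumes p: "prime p" and G: "is_subgroup G" "finite G" and L: "is_normal L G" and K: "is_normal K G"
    and KL: "K \<subseteq> L" and ip: "idx L K = p"
begin

lemma prime_factor_centralizer:
  "is_subgroup (centralizer_mod G L K)" "normalizes G (centralizer_mod G L K)"
  using is_subgroup_centralizer_mod[OF G(1) is_normalD(1,3)[OF K]]
    normalizes_centralizer_mod[OF G(1) is_normalD(3)[OF L] normalizes_subgroup[OF G(1)] is_normalD(3)[OF K]] .

lemma prime_factor_maxsub: "maxsub K L"
  using maxsub_of_prime_idx[OF p is_normalD(1)[OF L] _ is_normalD(1)[OF K] KL ip] is_normalD(2)[OF L] G(2) finite_subset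
  by blast

text \<open>The elements of \<open>L\<close> that commute with \<open>x\<close> modulo
  \<open>K\<close> form a subgroup over \<open>K\<close>. As \<open>K\<close> is maximal in
  \<open>L\<close>, a single \<open>z\<close> outside \<open>K\<close> decides.\<close>

lemma prime_factor_centralizerI:
  assumes x: "x \<in> G" and z: "z \<in> L" "z \<notin> K" "commutator x z \<in> K"
  shows "x \<in> centralizer_mod G L K"
proof -
  note K' = is_normalD[OF K] and L' = is_normalD[OF L]
  let ?W = "centralizer_mod L {x} K"
  have "is_subgroup ?W"
    using is_subgroup_centralizer_mod[OF L'(1) K'(1) normalizes_mono[OF K'(3) L'(2)]] .
  moreover have "K \<subseteq> ?W" using KL commutator_mem_normal[OF K'(1,3) x] by (auto simp: centralizer_mod_def)
  moreover have "?W \<subseteq> L" by (auto simp: centralizer_mod_def)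
  moreover have "?W \<noteq> K" using z by (auto simp: centralizer_mod_def)
  ultimately have "?W = L" using maxsubD(4)[OF prime_factor_maxsub] by blast
  then have "commutator y x \<in> K" if "y \<in> L" for y
    using that commutator_mem_commute[OF K'(1), of x y] by (auto simp: centralizer_mod_def)
  then show ?thesis using x by (auto simp: centralizer_mod_def)
qed

lemma prime_factor_generator:
  obtains z where "z \<in> L" "z \<notin> K" "z \<in> G" "z ^ p \<in> K" "\<forall>y\<in>L. \<exists>i. \<exists>k\<in>K. y = z ^ i * k"
proof -
  note K' = is_normalD[OF K] and L' = is_normalD[OF L]
  have finL: "finite L" using L'(2) G(2) finite_subset by blast
  obtain z where z: "z \<in> L" "z \<notin> K" using maxsubD(2,3)[OF prime_factor_maxsub] by blast
  have nKL: "is_normal K L" using K' KL normalizes_mono[OF K'(3) L'(2)] by (simp add: is_normal_def)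
  have cz: "is_subgroup (cyc z)" "cyc z \<subseteq> L" using is_subgroup_cyc[OF L'(1) finL z(1)] cyc_subset[OF L'(1) z(1)] .
  have "cyc z * K = L"
    using maxsubD(4)[OF prime_factor_maxsub is_subgroup_times_normal[OF cz nKL] set_times_superset2[OF cz(1)]
        set_times_least[OF L'(1) cz(2) KL]] set_times_superset1[OF K'(1), of "cyc z"] cyc_self[of z] z by blast
  then have gen: "\<forall>y\<in>L. \<exists>i. \<exists>k\<in>K. y = z ^ i * k"
    using set_times_mem[of _ "cyc z" K] by (auto simp: cyc_def)
  have zp: "z ^ p \<in> K" using power_idx_mem[OF L'(1) finL nKL z(1)] ip by simp
  show thesis by (rule that[OF z subsetD[OF L'(2) z(1)] zp gen])
qed

lemma commutator_centralizes_prime_factor: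
  assumes g: "g \<in> G" and h: "h \<in> G"
  shows "commutator g h \<in> centralizer_mod G L K"
proof -
  note K' = is_normalD[OF K] and L' = is_normalD[OF L]
  obtain z where z: "z \<in> L" "z \<notin> K" "z \<in> G" "z ^ p \<in> K" "\<forall>y\<in>L. \<exists>i. \<exists>k\<in>K. y = z ^ i * k"
    using prime_factor_generator .
  obtain a k1 where a: "k1 \<in> K" "g * z * inverse g = z ^ a * k1" using z L' g normalizesD by blast
  obtain b k2 where b: "k2 \<in> K" "h * z * inverse h = z ^ b * k2" using z L' h normalizesD by blast
  obtain k3 where k3: "k3 \<in> K" "g * (z ^ b * k2) * inverse g = z ^ (a * b) * k3"
    using conj_mult_power[OF K G(1) z(3) g a b(1)] by blast
  obtain k4 where k4: "k4 \<in> K" "h * (z ^ a * k1) * inverse h = z ^ (b * a) * k4"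
    using conj_mult_power[OF K G(1) z(3) h b a(1)] by blast
  \<comment> \<open>\<open>w\<close> is \<open>z\<close> conjugated by \<open>h * g\<close>, and
    conjugation by \<open>commutator g h\<close> turns it into \<open>z\<close> conjugated by
    \<open>g * h\<close>. Both equal \<open>z ^ (a * b)\<close> modulo \<open>K\<close>.\<close>
  define w where "w = h * (g * z * inverse g) * inverse h"
  have w: "w = z ^ (a * b) * k4" using k4 a by (simp add: w_def mult.commute)
  have "commutator g h * w * inverse (commutator g h) = g * (h * z * inverse h) * inverse g"
    by (simp add: w_def commutator_def group_word)
  also have "\<dots> = z ^ (a * b) * k3" using k3 b by simp
  also have "\<dots> = w * (inverse k4 * k3)" by (simp add: w group_word)
  finally have "commutator (commutator g h) w = w * (inverse k4 * k3) * inverse w"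
    by (simp add: commutator_def[of "commutator g h"])
  moreover have wG: "w \<in> L" using z L' g h by (simp add: w_def normalizesD)
  ultimately have "commutator (commutator g h) w \<in> K"
    using K' k3 k4 L' by (auto simp: is_subgroupD intro!: normalizesD)
  moreover have "w \<notin> K"
  proof
    assume "w \<in> K"
    then have "inverse h * w * h \<in> K" using normalizesD2[OF K'(3) G(1) h] by blast
    then have "inverse g * (inverse h * w * h) * g \<in> K" using normalizesD2[OF K'(3) G(1) g] by blast
    then show False using z by (simp add: w_def group_word)
  qed
  moreover have "commutator g h \<in> G" using g h G by (simp add: commutator_def is_subgroupD)
  ultimately show ?thesis using prime_factor_centralizerI wG by blast
qed

lemma power_centralizes_prime_factor:
  assumes g: "g \<in> G"
  shows "g ^ (p - 1) \<in> centralizer_mod G L K"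
proof -
  note K' = is_normalD[OF K] and L' = is_normalD[OF L]
  obtain z where z: "z \<in> L" "z \<notin> K" "z \<in> G" "z ^ p \<in> K" "\<forall>y\<in>L. \<exists>i. \<exists>k\<in>K. y = z ^ i * k"
    using prime_factor_generator .
  obtain a k1 where a: "k1 \<in> K" "g * z * inverse g = z ^ a * k1" using z L' g normalizesD by blast
  have "\<exists>k\<in>K. g ^ n * z * inverse (g ^ n) = z ^ (a ^ n) * k" for n
  proof (induction n)
    case 0
    then show ?case using K' by (auto simp: is_subgroupD intro: bexI[of _ 1])
  next
    case (Suc n)
    then obtain k where k: "k \<in> K" "g ^ n * z * inverse (g ^ n) = z ^ (a ^ n) * k" by blast
    have "g ^ Suc n * z * inverse (g ^ Suc n) = g * (g ^ n * z * inverse (g ^ n)) * inverse g"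
      by (simp add: group_word)
    then show ?case using conj_mult_power[OF K G(1) z(3) g a k(1), of "a ^ n"] by (simp add: k)
  qed
  then obtain k where k: "k \<in> K" "g ^ (p - 1) * z * inverse (g ^ (p - 1)) = z ^ (a ^ (p - 1)) * k" by blast
  \<comment> \<open>Conjugation by \<open>g\<close> is injective on \<open>L / K\<close>, so it
    cannot send \<open>z\<close> into \<open>K\<close>.\<close>
  have "\<not> p dvd a"
  proof
    assume "p dvd a"
    then have "z ^ a \<in> K" using z(4) K' by (auto simp: power_mult is_subgroupD elim!: dvdE)
    then have "g * z * inverse g \<in> K" using a K' by (simp add: is_subgroupD)
    then have "inverse g * (g * z * inverse g) * g \<in> K" using normalizesD2[OF K'(3) G(1) g] by blast
    then show False using z by (simp add: group_word)
  qed
  then have "[a ^ (p - 1) = 1] (mod p)" using fermat_theorem[OF p] by blast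
  moreover have "a ^ (p - 1) \<ge> 1" using \<open>\<not> p dvd a\<close> by (cases "a = 0") auto
  ultimately obtain m where m: "a ^ (p - 1) = 1 + m * p"
    using cong_le_nat[of 1 "a ^ (p - 1)" p] by (metis add.commute)
  have zm: "z ^ (m * p) \<in> K" using z(4) K' by (subst mult.commute) (simp add: power_mult is_subgroupD)
  have "commutator (g ^ (p - 1)) z = z ^ (a ^ (p - 1)) * k * inverse z"
    by (simp only: commutator_def k(2))
  also have "\<dots> = z * (z ^ (m * p) * k) * inverse z"
    by (simp only: m power_add power_one_right mult.assoc)
  also have "\<dots> \<in> K" using zm k z K' by (intro normalizesD[OF K'(3)]) (simp_all add: is_subgroupD)
  finally show ?thesis using prime_factor_centralizerI[OF is_subgroupD(4)[OF G(1) g]] z by blast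
qed

lemma p_element_centralizes_prime_factor:
  assumes "x \<in> G" "x ^ (p ^ n) = 1"
  shows "x \<in> centralizer_mod G L K"
proof (rule coprime_powers_mem[OF prime_factor_centralizer(1)])
  show "x ^ (p - 1) \<in> centralizer_mod G L K" using power_centralizes_prime_factor[OF assms(1)] .
  show "x ^ (p ^ n) \<in> centralizer_mod G L K" using assms prime_factor_centralizer(1) by (simp add: is_subgroupD)
  have "coprime (p - 1) p" using coprime_diff_one_left_nat[of p] p by (simp add: prime_gt_0_nat)
  then show "coprime (p - 1) (p ^ n)" by simp
qed

end

lemma is_subgroup_finite:
  assumes "is_subgroup G" "finite G" "A \<subseteq> G" "1 \<in> A" "\<And>x y. x \<in> A \<Longrightarrow> y \<in> A \<Longrightarrow> x * y \<in> A"
  shows "is_subgroup A"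
  unfolding is_subgroup_def
proof (intro conjI ballI)
  fix x assume x: "x \<in> A"
  have pw: "x ^ n \<in> A" for n by (induction n) (use assms x in auto)
  have "is_subgroup (cyc x)" using is_subgroup_cyc assms x by blast
  then have "inverse x \<in> cyc x" using cyc_self is_subgroupD(3) by blast
  then show "inverse x \<in> A" using pw by (auto simp: cyc_def)
qed (use assms in auto)

text \<open>A version of Schur's lemma. The elements with \<open>p\<close>-th power in
  \<open>K\<close> form a normal subgroup, so \<open>T / K\<close> is elementary abelian. Each
  \<open>g\<close> has an eigenvector by \<open>hom_eigenvector\<close>; its eigenspace is invariant
  because commutators act trivially, hence is everything, and \<open>g\<close> acts by a scalar. So
  \<open>cyc z * K\<close> is normal and \<open>T / K\<close> is cyclic.\<close>

lemma chief_of_abelian_action: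
  assumes p: "prime p" and G: "is_subgroup G" "finite G" and ch: "chief G T K" and pp: "prime_power_of p (idx T K)"
    and ab: "\<And>x y. x \<in> T \<Longrightarrow> y \<in> T \<Longrightarrow> commutator x y \<in> K"
    and cc: "\<And>g h t. g \<in> G \<Longrightarrow> h \<in> G \<Longrightarrow> t \<in> T \<Longrightarrow> commutator (commutator g h) t \<in> K"
    and cp: "\<And>g t. g \<in> G \<Longrightarrow> t \<in> T \<Longrightarrow> commutator (g ^ (p - 1)) t \<in> K"
  shows "idx T K = p"
proof -
  note nT = chiefD(1)[OF ch] and nK = chiefD(2)[OF ch] and KT = chiefD(3)[OF ch]
  note T' = is_normalD[OF nT] and K' = is_normalD[OF nK]
  have finT: "finite T" using T'(2) G(2) finite_subset by blast
  have nKT: "is_normal K T" using K' KT normalizes_mono[OF K'(3) T'(2)] by (simp add: is_normal_def)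
  have apow: "\<exists>k\<in>K. (x * y) ^ n = x ^ n * y ^ n * k" if "x \<in> T" "y \<in> T" for x y n
    by (rule abelian_mod_power[OF T'(1) K'(1) KT]) (use ab that in auto)
  obtain z where z: "z \<in> T" "z \<notin> K" using chiefD(3,4)[OF ch] by blast
  have zG: "z \<in> G" using z T' by blast
  have elem: "t ^ p \<in> K" if t: "t \<in> T" for t
  proof -
    let ?E = "{t \<in> T. t ^ p \<in> K}"
    have s: "is_subgroup ?E"
    proof (rule is_subgroup_finite[OF T'(1) finT])
      show "1 \<in> ?E" using T' K' by (simp add: is_subgroupD)
      fix x y assume xy: "x \<in> ?E" "y \<in> ?E"
      then obtain k where "k \<in> K" "(x * y) ^ p = x ^ p * y ^ p * k" using apow[of x y p] by blast
      then show "x * y \<in> ?E" using xy T' K' by (simp add: is_subgroupD)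
    qed auto
    have "normalizes G ?E"
      using T' K' by (simp add: normalizes_def group_power_conj)
    then have "is_normal ?E G" using s T' by (auto simp: is_normal_def)
    moreover have "K \<subseteq> ?E" using KT K' by (auto simp: is_subgroupD)
    moreover have "?E \<noteq> K"
    proof -
      obtain k where k: "idx T K = p ^ k" using pp by (auto simp: prime_power_of_def)
      have ex: "z ^ (p ^ k) \<in> K" using power_idx_mem[OF T'(1) finT nKT z(1)] k by simp
      define j where "j = (LEAST j. z ^ (p ^ j) \<in> K)"
      have j: "z ^ (p ^ j) \<in> K" using LeastI[of "\<lambda>j. z ^ (p ^ j) \<in> K", OF ex] by (simp add: j_def)
      have "j \<noteq> 0" using j z by (metis power_0 power_one_right)
      then obtain i where i: "j = Suc i" by (metis not0_implies_Suc)
      have "z ^ (p ^ i) \<notin> K" using not_less_Least[of i "\<lambda>j. z ^ (p ^ j) \<in> K"] i by (simp add: j_def)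
      moreover have "(z ^ (p ^ i)) ^ p \<in> K" using j by (simp add: i mult.commute flip: power_mult)
      moreover have "z ^ (p ^ i) \<in> T" using z T' by (simp add: is_subgroupD)
      ultimately show ?thesis by blast
    qed
    ultimately have "?E = T" using chiefD(5)[OF ch, of ?E] by blast
    then show ?thesis using t by blast
  qed
  have eigen: "\<exists>v\<in>T. v \<notin> K \<and> (\<exists>i. \<exists>k\<in>K. g * v * inverse g = v ^ i * k)" if g: "g \<in> G" for g
  proof -
    interpret V: comm_group "coset_group T K" by (rule comm_group_coset_group[OF T'(1) K'(1) KT ab])
    have cpow: "(x *o K) [^]\<^bsub>coset_group T K\<^esub> (n::nat) = (x ^ n) *o K" if "x \<in> T" for x n
      by (rule coset_group_pow[OF T'(1) K'(1) KT]) (use ab that in auto)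
    have nTK: "normalizes T K" using is_normalD(3)[OF nKT] .
    have carr: "carrier (coset_group T K) = left_cosets T K" by (simp add: coset_group_def)
    have conjc: "conjugate h (x *o K) = (h * x * inverse h) *o K" if "h \<in> G" for h x
      using conjugate_normal[OF K'(3) G(1) that] by (simp add: conjugate_coset)
    have hom: "conjugate g \<in> hom (coset_group T K) (coset_group T K)"
    proof (rule homI)
      fix x assume "x \<in> carrier (coset_group T K)"
      then show "conjugate g x \<in> carrier (coset_group T K)"
        using g T' by (auto simp: carr left_cosets_def conjc normalizesD)
      fix y assume "y \<in> carrier (coset_group T K)"
      show "conjugate g (x \<otimes>\<^bsub>coset_group T K\<^esub> y) = conjugate g x \<otimes>\<^bsub>coset_group T K\<^esub> conjugate g y"
        by (simp add: coset_group_def conjugate_times)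
    qed
    have iter: "(conjugate g ^^ n) x = conjugate (g ^ n) x" for n x
      by (induction n) (simp_all add: conjugate_conjugate)
    have "\<exists>v\<in>carrier (coset_group T K). v \<noteq> \<one>\<^bsub>coset_group T K\<^esub> \<and>
        (\<exists>i::nat. conjugate g v = v [^]\<^bsub>coset_group T K\<^esub> i)"
    proof (rule V.hom_eigenvector[OF hom p])
      fix x assume "x \<in> carrier (coset_group T K)"
      then obtain t where t: "t \<in> T" "x = t *o K" by (auto simp: carr left_cosets_def)
      show "x [^]\<^bsub>coset_group T K\<^esub> p = \<one>\<^bsub>coset_group T K\<^esub>"
        using elem[OF t(1)] t coset_eq_self_iff[OF K'(1)] by (simp add: cpow) (simp add: coset_group_def)
      have gG: "g ^ (p - 1) \<in> G" using g G by (simp add: is_subgroupD)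
      let ?g = "g ^ (p - 1)"
      have "inverse t * (?g * t * inverse ?g) = inverse t * commutator ?g t * t"
        by (simp add: commutator_def group_word)
      also have "\<dots> \<in> K" using normalizesD2[OF nTK T'(1) t(1) cp[OF g t(1)]] .
      finally have "t *o K = (?g * t * inverse ?g) *o K" using left_coset_eq_iff[OF K'(1)] by blast
      then have "(?g * t * inverse ?g) *o K = x" by (simp only: t)
      moreover have "(conjugate g ^^ (p - 1)) x = (?g * t * inverse ?g) *o K" by (simp only: iter t conjc[OF gG])
      ultimately show "(conjugate g ^^ (p - 1)) x = x" by (simp only:)
    next
      show "z *o K \<in> carrier (coset_group T K)" using z by (simp add: carr coset_in_left_cosets)
      show "z *o K \<noteq> \<one>\<^bsub>coset_group T K\<^esub>" using z coset_eq_self_iff[OF K'(1)] by (simp add: coset_group_def)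
    qed
    then obtain v and i :: nat where v: "v \<in> carrier (coset_group T K)" "v \<noteq> \<one>\<^bsub>coset_group T K\<^esub>"
      "conjugate g v = v [^]\<^bsub>coset_group T K\<^esub> i" by blast
    then obtain t where t: "t \<in> T" "v = t *o K" by (auto simp: carr left_cosets_def)
    have "t \<notin> K" using v(2) t coset_eq_self_iff[OF K'(1)] by (simp add: coset_group_def)
    moreover have "(g * t * inverse g) *o K = (t ^ i) *o K" using v(3) t by (simp add: cpow conjc[OF g])
    then have "(t ^ i) *o K = (g * t * inverse g) *o K" ..
    then have "inverse (t ^ i) * (g * t * inverse g) \<in> K" using left_coset_eq_iff[OF K'(1)] by blast
    then have "\<exists>k\<in>K. g * t * inverse g = t ^ i * k" by (intro bexI) auto
    ultimately show ?thesis using t by blast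
  qed
  have scalar: "\<exists>i. \<exists>k\<in>K. g * z * inverse g = z ^ i * k" if g: "g \<in> G" for g
  proof -
    obtain v i where v: "v \<in> T" "v \<notin> K" "\<exists>k\<in>K. g * v * inverse g = v ^ i * k" using eigen[OF g] by blast
    let ?E = "{y \<in> T. \<exists>k\<in>K. g * y * inverse g = y ^ i * k}"
    have s: "is_subgroup ?E"
    proof (rule is_subgroup_finite[OF T'(1) finT])
      show "1 \<in> ?E" using T' K' by (auto simp: is_subgroupD)
      fix x y assume "x \<in> ?E" "y \<in> ?E"
      then obtain k1 k2 where xy: "x \<in> T" "y \<in> T" and k: "k1 \<in> K" "g * x * inverse g = x ^ i * k1"
        "k2 \<in> K" "g * y * inverse g = y ^ i * k2" by blast
      obtain k3 where k3: "k3 \<in> K" "(x * y) ^ i = x ^ i * y ^ i * k3" using apow[OF xy] by blast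
      have "g * (x * y) * inverse g = (g * x * inverse g) * (g * y * inverse g)" by (simp add: group_word)
      also have "\<dots> = (x * y) ^ i * (inverse k3 * ((inverse (y ^ i) * k1 * y ^ i) * k2))"
        by (simp only: k k3) (simp add: group_word)
      finally have "g * (x * y) * inverse g = (x * y) ^ i * (inverse k3 * ((inverse (y ^ i) * k1 * y ^ i) * k2))" .
      moreover have "inverse k3 * ((inverse (y ^ i) * k1 * y ^ i) * k2) \<in> K"
        using normalizesD2[OF is_normalD(3)[OF nKT] T'(1), of "y ^ i" k1] xy k k3 K' T' by (simp add: is_subgroupD)
      moreover have "x * y \<in> T" using xy T' by (simp add: is_subgroupD)
      ultimately show "x * y \<in> ?E" by blast
    qed auto
    have "normalizes G ?E"
      unfolding normalizes_def
    proof (intro ballI)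
      fix h y assume h: "h \<in> G" and "y \<in> ?E"
      then obtain k where y: "y \<in> T" and k: "k \<in> K" "g * y * inverse g = y ^ i * k" by blast
      define w where "w = h * (g * y * inverse g) * inverse h"
      have wT: "w \<in> T" using y T' g h by (simp add: w_def normalizesD)
      \<comment> \<open>The error made by exchanging \<open>g\<close> and \<open>h\<close>. It lies
        in \<open>K\<close> because \<open>commutator g h\<close> acts trivially on
        \<open>T / K\<close>.\<close>
      define c where "c = inverse w * commutator (commutator g h) w * w"
      have cK: "c \<in> K"
        unfolding c_def using normalizesD2[OF is_normalD(3)[OF nKT] T'(1) wT cc[OF g h wT]] .
      have w: "w = (h * y * inverse h) ^ i * (h * k * inverse h)"
        unfolding w_def k(2) group_power_conj by (simp add: group_word)
      have "g * (h * y * inverse h) * inverse g = commutator g h * w * inverse (commutator g h)"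
        by (simp add: w_def commutator_def group_word)
      also have "\<dots> = w * c"
        by (simp add: c_def commutator_def[of "commutator g h"] group_word)
      also have "\<dots> = (h * y * inverse h) ^ i * ((h * k * inverse h) * c)"
        by (simp only: w mult.assoc)
      finally have "g * (h * y * inverse h) * inverse g = (h * y * inverse h) ^ i * ((h * k * inverse h) * c)" .
      moreover have "(h * k * inverse h) * c \<in> K"
        using normalizesD[OF K'(3) h k(1)] cK K' by (simp add: is_subgroupD)
      moreover have "h * y * inverse h \<in> T" using y h T' normalizesD by blast
      ultimately show "h * y * inverse h \<in> ?E" by blast
    qed
    then have "is_normal ?E G" using s T' by (auto simp: is_normal_def)
    moreover have "K \<subseteq> ?E"
    proof
      fix y assume y: "y \<in> K"
      have "g * y * inverse g = y ^ i * (inverse (y ^ i) * (g * y * inverse g))" by simp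
      moreover have "inverse (y ^ i) * (g * y * inverse g) \<in> K" using y K' g by (simp add: is_subgroupD normalizesD)
      ultimately show "y \<in> ?E" using KT y by blast
    qed
    moreover have "?E \<noteq> K" using v by blast
    ultimately have "?E = T" using chiefD(5)[OF ch, of ?E] by blast
    then show ?thesis using z by blast
  qed
  have c: "is_subgroup (cyc z)" "cyc z \<subseteq> G" using is_subgroup_cyc[OF G zG] cyc_subset[OF G(1) zG] .
  have "normalizes G (cyc z * K)"
    unfolding normalizes_def
  proof (intro ballI)
    fix g v assume g: "g \<in> G" and "v \<in> cyc z * K"
    then obtain j k2 where v: "k2 \<in> K" "v = z ^ j * k2" by (auto simp: cyc_def set_times_mem)
    obtain i k1 where k1: "k1 \<in> K" "g * z * inverse g = z ^ i * k1" using scalar[OF g] by blast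
    obtain k where "k \<in> K" "g * v * inverse g = z ^ (i * j) * k"
      using conj_mult_power[OF nK G(1) zG g k1 v(1)] v(2) by blast
    then show "g * v * inverse g \<in> cyc z * K" using set_times_intro[OF power_in_cyc] by simp
  qed
  then have "is_normal (cyc z * K) G"
    using is_subgroup_times_normal[OF c nK] set_times_least[OF G(1) c(2) K'(2)] by (simp add: is_normal_def)
  then have "cyc z * K = K \<or> cyc z * K = T"
    using chiefD(5)[OF ch] set_times_superset2[OF c(1)] set_times_least[OF T'(1) cyc_subset[OF T'(1) z(1)] KT] by blast
  moreover have "z \<in> cyc z * K" using cyc_self set_times_superset1[OF K'(1)] by blast
  ultimately have "T \<subseteq> cyc z * K" using z by blast
  then show ?thesis using cyclic_chief_prime[OF p G ch z(1) _ pp] by blast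
qed

section \<open>Chief factors inside the Frattini subgroup\<close>

lemma contains_sylows_eq:
  assumes X: "is_subgroup X" "finite X" and Y: "is_subgroup Y" "Y \<subseteq> X"
    and sy: "\<And>q. prime q \<Longrightarrow> \<exists>S. is_sylow q S X \<and> S \<subseteq> Y"
  shows "Y = X"
proof (rule idx_eq_1[OF Y(1) X(1) Y(2) X(2)], rule ccontr)
  assume "idx X Y \<noteq> 1"
  then obtain q where q: "prime q" "q dvd idx X Y" using prime_factor_nat by blast
  obtain S where S: "is_sylow q S X" "S \<subseteq> Y" using sy[OF q(1)] by blast
  note S' = is_sylowD[OF S(1)]
  have "idx X Y dvd idx X S" by (rule idx_dvd_trans(1)) (use S S' X Y in auto)
  then show False using q S'(4) dvd_trans by blast
qed

context sylow_setting
begin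

context
  fixes T K :: "'g set"
  assumes ch: "chief G T K" and TN: "T \<subseteq> N" and pp: "prime_power_of p (idx T K)"
    and above: "\<And>L' K'. chief G L' K' \<Longrightarrow> T \<subseteq> K' \<Longrightarrow> L' \<subseteq> N \<Longrightarrow> p dvd idx L' K' \<Longrightarrow> idx L' K' = p"
begin

text \<open>\<open>G\<close> is inserted so that the intersection stays inside \<open>G\<close> even
  if there is no \<open>p\<close>-chief factor between \<open>T\<close> and
  \<open>N\<close>.\<close>

definition upper_centralizer :: "'g set"
  where "upper_centralizer = \<Inter>(insert G {centralizer_mod G L' K' | L' K'.
    chief G L' K' \<and> T \<subseteq> K' \<and> L' \<subseteq> N \<and> p dvd idx L' K'})"

abbreviation (input) "X \<equiv> upper_centralizer"

lemma upper_centralizerD: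
  assumes "x \<in> X" "chief G L' K'" "T \<subseteq> K'" "L' \<subseteq> N" "p dvd idx L' K'" "y \<in> L'"
  shows "commutator y x \<in> K'"
  using assms unfolding upper_centralizer_def centralizer_mod_def by blast

lemma upper_centralizerI:
  assumes "x \<in> G"
    "\<And>L' K'. chief G L' K' \<Longrightarrow> T \<subseteq> K' \<Longrightarrow> L' \<subseteq> N \<Longrightarrow> p dvd idx L' K' \<Longrightarrow> idx L' K' = p \<Longrightarrow>
      x \<in> centralizer_mod G L' K'"
  shows "x \<in> X"
  unfolding upper_centralizer_def using assms above by blast

lemma upper_centralizer_subset: "X \<subseteq> G"
  unfolding upper_centralizer_def by blast

lemma is_subgroup_upper_centralizer: "is_subgroup X"
  unfolding upper_centralizer_def
proof (rule is_subgroup_Inter)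
  fix A assume "A \<in> insert G {centralizer_mod G L' K' | L' K'.
    chief G L' K' \<and> T \<subseteq> K' \<and> L' \<subseteq> N \<and> p dvd idx L' K'}"
  then consider "A = G" | L' K' where "A = centralizer_mod G L' K'" "chief G L' K'" by blast
  then show "is_subgroup A"
  proof cases
    case 2
    then show ?thesis
      using is_subgroup_centralizer_mod[OF G(1) is_normalD(1,3)[OF chiefD(2)[OF 2(2)]]] by simp
  qed (use G in simp)
qed

lemma normalizes_upper_centralizer: "normalizes G X"
  unfolding normalizes_def
proof (intro ballI)
  fix g x assume g: "g \<in> G" and x: "x \<in> X"
  show "g * x * inverse g \<in> X"
  proof (rule upper_centralizerI)
    show "g * x * inverse g \<in> G" using g x upper_centralizer_subset G by (auto simp: is_subgroupD)
    fix L' K' assume h: "chief G L' K'" "T \<subseteq> K'" "L' \<subseteq> N" "p dvd idx L' K'"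
    have "normalizes G (centralizer_mod G L' K')"
      by (rule normalizes_centralizer_mod[OF G(1) is_normalD(3)[OF chiefD(1)[OF h(1)]]
            normalizes_subgroup[OF G(1)] is_normalD(3)[OF chiefD(2)[OF h(1)]]])
    moreover have "x \<in> centralizer_mod G L' K'"
      using upper_centralizerD[OF x h] x upper_centralizer_subset by (auto simp: centralizer_mod_def)
    ultimately show "g * x * inverse g \<in> centralizer_mod G L' K'" using g normalizesD by blast
  qed
qed

lemma subset_upper_centralizer: "T \<subseteq> X"
proof
  fix t assume t: "t \<in> T"
  have tG: "t \<in> G" using t is_normalD(2)[OF chiefD(1)[OF ch]] by blast
  show "t \<in> X"
  proof (rule upper_centralizerI[OF tG])
    fix L' K' assume h: "chief G L' K'" "T \<subseteq> K'"
    have "commutator y t \<in> K'" if "y \<in> L'" for y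
      using commutator_mem_normal[OF is_normalD(1,3)[OF chiefD(2)[OF h(1)]], of y t] t h(2) that
        is_normalD(2)[OF chiefD(1)[OF h(1)]] by blast
    then show "t \<in> centralizer_mod G L' K'" using tG by (simp add: centralizer_mod_def)
  qed
qed

lemma
  shows commutator_in_upper_centralizer: "g \<in> G \<Longrightarrow> h \<in> G \<Longrightarrow> commutator g h \<in> X"
    and power_in_upper_centralizer: "g \<in> G \<Longrightarrow> g ^ (p - 1) \<in> X"
    and P_upper_centralizer: "P \<subseteq> X"
proof -
  show "commutator g h \<in> X" if "g \<in> G" "h \<in> G"
  proof (rule upper_centralizerI)
    show "commutator g h \<in> G" using that G by (simp add: commutator_def is_subgroupD)
    fix L' K' assume h: "chief G L' K'" "idx L' K' = p"
    show "commutator g h \<in> centralizer_mod G L' K'"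
      by (rule commutator_centralizes_prime_factor[OF p G chiefD(1,2,3)[OF h(1)] h(2) that])
  qed
  show "g ^ (p - 1) \<in> X" if "g \<in> G"
  proof (rule upper_centralizerI)
    show "g ^ (p - 1) \<in> G" using that G by (simp add: is_subgroupD)
    fix L' K' assume h: "chief G L' K'" "idx L' K' = p"
    show "g ^ (p - 1) \<in> centralizer_mod G L' K'"
      by (rule power_centralizes_prime_factor[OF p G chiefD(1,2,3)[OF h(1)] h(2) that])
  qed
  show "P \<subseteq> X"
  proof
    fix x assume x: "x \<in> P"
    then have xG: "x \<in> G" using PG by blast
    obtain n where n: "card P = p ^ n" using PN(3) by (auto simp: prime_power_of_def)
    have x1: "x ^ (p ^ n) = 1" using power_card_eq_one[OF PN(1) finP x] by (simp add: n)
    show "x \<in> X"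
    proof (rule upper_centralizerI[OF xG])
      fix L' K' assume h: "chief G L' K'" "idx L' K' = p"
      show "x \<in> centralizer_mod G L' K'"
        by (rule p_element_centralizes_prime_factor[OF p G chiefD(1,2,3)[OF h(1)] h(2) xG x1])
    qed
  qed
qed

context
  fixes q S assumes q: "prime q" "q \<noteq> p" and S: "is_sylow q S X"
begin

lemma SX: "is_subgroup S" "S \<subseteq> X" "prime_power_of q (card S)" "\<not> q dvd idx X S"
  using is_sylowD[OF S] .

text \<open>If \<open>A / B\<close> is a \<open>p\<close>-chief factor, then \<open>S\<close> centralizes it and the Frattini argument gives
  \<open>A \<inter> X = normalizer_in (A \<inter> X) S * (B \<inter> X)\<close>; otherwise the step contributes an index prime to \<open>p\<close>.\<close>

lemma idx_normalizer_times:
  "is_normal A G \<Longrightarrow> T \<subseteq> A \<Longrightarrow> A \<subseteq> N \<Longrightarrow> \<not> p dvd idx (A \<inter> X) (normalizer_in (A \<inter> X) S * T)"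
proof (induction "card A" arbitrary: A rule: less_induct)
  case (less A)
  note nT = chiefD(1)[OF ch]
  note T' = is_normalD[OF nT] and A' = is_normalD[OF less.prems(1)]
  note X' = is_subgroup_upper_centralizer upper_centralizer_subset
  have sub: "is_subgroup (B \<inter> X)" "B \<inter> X \<subseteq> G" "normalizes G (B \<inter> X)" if "is_normal B G" for B
    using that X' normalizes_upper_centralizer is_normalD[OF that]
    by (auto intro: is_subgroup_Int normalizes_Int)
  let ?n = "\<lambda>B. normalizer_in (B \<inter> X) S"
  have n: "is_subgroup (?n B)" "?n B \<subseteq> B \<inter> X" if "is_normal B G" for B
    using is_subgroup_normalizer_in[OF sub(1)[OF that]] by (auto simp: normalizer_in_def)
  have TX: "T \<subseteq> X" by (rule subset_upper_centralizer)
  show ?case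
  proof (cases "A = T")
    case True
    have "T \<inter> X = T" using TX by blast
    moreover have "?n T * T = T"
      using n[OF nT] set_times_absorb1[OF T'(1), of "?n T"] by blast
    ultimately have "idx (A \<inter> X) (?n A * T) = 1" using True idx_self[OF T'(1) fin[OF T'(2)]] by simp
    then show ?thesis using p by (metis nat_dvd_1_iff_1 not_prime_1)
  next
    case False
    let ?F = "{B. is_normal B G \<and> T \<subseteq> B \<and> B \<subset> A}"
    have finF: "finite ?F" by (rule finite_subset[of _ "Pow A"]) (use fin[OF A'(2)] in auto)
    have TF: "T \<in> ?F" using nT less.prems False by auto
    obtain B where BF: "B \<in> ?F" and mx: "\<forall>U\<in>?F. B \<subseteq> U \<longrightarrow> B = U"
      using finite_maximal_set[OF finF TF] by (rule bexE)
    have B: "is_normal B G" "T \<subseteq> B" "B \<subset> A" using BF by simp_all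
    note B' = is_normalD[OF B(1)]
    have chB: "chief G A B"
      unfolding chief_def
    proof (intro conjI allI impI)
      fix M assume M: "is_normal M G \<and> B \<subseteq> M \<and> M \<subseteq> A"
      show "M = B \<or> M = A"
      proof (rule ccontr)
        assume neq: "\<not> (M = B \<or> M = A)"
        then have "M \<in> ?F" using M B(2) by auto
        then show False using bspec[OF mx, of M] M neq by blast
      qed
    qed (use B less.prems in auto)
    have IH: "\<not> p dvd idx (B \<inter> X) (?n B * T)"
      using less.hyps[of B] B less.prems psubset_card_mono[OF fin[OF A'(2)] B(3)] by blast
    note sA = sub[OF less.prems(1)] and sB = sub[OF B(1)] and nA = n[OF less.prems(1)] and nB = n[OF B(1)]
    have finA: "finite (A \<inter> X)" and finB: "finite (B \<inter> X)" using fin sA(2) sB(2) by blast+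
    have nAG: "?n A \<subseteq> G" and nBG: "?n B \<subseteq> G" using nA nB sA sB by blast+
    have BA: "B \<inter> X \<subseteq> A \<inter> X" using B by blast
    have nnBX: "is_normal (B \<inter> X) G" using sB by (simp add: is_normal_def)
    let ?Y = "?n A * (B \<inter> X)"
    have Y: "is_subgroup ?Y" using is_subgroup_times_normal[OF nA(1) nAG nnBX] .
    have YA: "?Y \<subseteq> A \<inter> X" using set_times_least[OF sA(1) nA(2) BA] .
    have nAT: "is_subgroup (?n A * T)" using is_subgroup_times_normal[OF nA(1) nAG nT] .
    have TBX: "T \<subseteq> B \<inter> X" using B(2) TX by blast
    have nATY: "?n A * T \<subseteq> ?Y" using set_times_mono2[OF order_refl TBX] .
    have nATG: "?n A * T \<subseteq> G" using nATY YA sA(2) by blast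
    have Ycomm: "?Y = (B \<inter> X) * ?n A" using set_times_commute[OF nA(1) normalizes_mono[OF sB(3) nAG]] .
    \<comment> \<open>The index is split at \<open>?Y\<close>. The upper part divides
      \<open>idx A B\<close>, or is 1 by the Frattini argument; the lower part divides the index in
      the induction hypothesis for \<open>B\<close>.\<close>
    have "\<not> p dvd idx (A \<inter> X) ?Y"
    proof (cases "p dvd idx A B")
      case False
      have d1: "idx (A \<inter> X) ?Y dvd idx (A \<inter> X) (B \<inter> X)"
        by (rule idx_dvd_trans(1)[OF sB(1) Y sA(1) set_times_superset2[OF nA(1)] YA finA])
      have "(A \<inter> X) \<inter> B = B \<inter> X" using B(3) by blast
      then have d2: "idx (A \<inter> X) (B \<inter> X) = idx ((A \<inter> X) * B) B"
        using idx_times[OF sA(1) B'(1) finA fin[OF B'(2)]] by simp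
      have d3: "idx ((A \<inter> X) * B) B dvd idx A B"
      proof (rule idx_dvd_trans(2)[OF B'(1) _ A'(1) set_times_superset2[OF sA(1)] _ fin[OF A'(2)]])
        show "is_subgroup ((A \<inter> X) * B)" using is_subgroup_times_normal[OF sA(1,2) B(1)] .
        show "(A \<inter> X) * B \<subseteq> A" using B(3) by (intro set_times_least[OF A'(1)]) auto
      qed
      have "idx (A \<inter> X) ?Y dvd idx A B" using dvd_trans[OF d1] d2 d3 by simp
      then show ?thesis using False dvd_trans[of p] by auto
    next
      case True
      have "A \<inter> X \<subseteq> ?Y"
      proof
        fix a assume a: "a \<in> A \<inter> X"
        have SG: "S \<subseteq> G" using SX(2) X'(2) by blast
        let ?W = "S * (B \<inter> X)"
        have W: "is_subgroup ?W" using is_subgroup_times_normal[OF SX(1) SG nnBX] .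
        have WX: "?W \<subseteq> X" using set_times_least[OF X'(1) SX(2)] by blast
        have SW: "S \<subseteq> ?W" using set_times_superset1[OF sB(1)] .
        have Wcomm: "?W = (B \<inter> X) * S" using set_times_commute[OF SX(1) normalizes_mono[OF sB(3) SG]] .
        have "idx ?W S dvd idx X S"
          by (rule idx_dvd_trans(2)[OF SX(1) W X'(1) SW WX fin[OF X'(2)]])
        then have syW: "is_sylow q S ?W" using SX SW dvd_trans by (auto simp: is_sylow_def)
        have "conjugate a S \<subseteq> ?W"
        proof
          fix y assume "y \<in> conjugate a S"
          then obtain s where s: "s \<in> S" "y = a * s * inverse a" by (auto simp: conjugate_def)
          have "commutator a s \<in> B"
            using upper_centralizerD[of s A B a] s(1) SX(2) chB B(2) less.prems(3) True a by blast
          moreover have "commutator a s \<in> X"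
            using a s(1) SX(2) X'(1) by (auto simp: commutator_def is_subgroupD subset_eq)
          ultimately have "commutator a s * s \<in> (B \<inter> X) * S" using s(1) by (intro set_times_intro) auto
          then show "y \<in> ?W" by (simp add: s Wcomm conj_eq_commutator)
        qed
        then have "\<exists>w\<in>?W. conjugate a S = conjugate w S"
          by (rule frattini_conjugate[OF q(1) W fin[OF subset_trans[OF WX X'(2)]] syW])
        then obtain w where w: "w \<in> ?W" "conjugate a S = conjugate w S" by (rule bexE)
        \<comment> \<open>Conjugation by the factor \<open>s\<close> fixes \<open>S\<close>, so
          \<open>k\<close> in \<open>B \<inter> X\<close> alone carries \<open>S\<close> to
          \<open>conjugate a S\<close>.\<close>
        then obtain k s where ks: "k \<in> B \<inter> X" "s \<in> S" "w = k * s" unfolding Wcomm set_times_mem by auto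
        have "conjugate s S = S" by (rule conjugate_normal[OF normalizes_subgroup[OF SX(1)] SX(1) ks(2)])
        then have "conjugate a S = conjugate k S"
          using w(2) ks(3) conjugate_conjugate[of k s S] by simp
        then have "conjugate (inverse k * a) S = S"
          using conjugate_conjugate[of "inverse k" a S] conjugate_conjugate[of "inverse k" k S] by simp
        moreover have "inverse k * a \<in> A \<inter> X"
          using ks(1) a BA is_subgroupD(2,3)[OF sA(1)] by blast
        ultimately have "inverse k * a \<in> ?n A" by (simp add: normalizer_in_def)
        then have "k * (inverse k * a) \<in> (B \<inter> X) * ?n A" using ks(1) by (intro set_times_intro)
        then show "a \<in> ?Y" by (simp add: Ycomm)
      qed
      then have "A \<inter> X = ?Y" using YA by blast
      then have "idx (A \<inter> X) ?Y = 1" using idx_self[OF sA(1) finA] by simp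
      then show ?thesis using p by (metis nat_dvd_1_iff_1 not_prime_1)
    qed
    moreover have "\<not> p dvd idx ?Y (?n A * T)"
    proof -
      have "(?n A * T) * (B \<inter> X) = ?Y"
        using set_times_absorb2[OF sB(1) T'(1) TBX] set_times_absorb1[OF sB(1) T'(1) TBX] by (simp add: mult.assoc)
      moreover have "(?n A * T) * (B \<inter> X) = (B \<inter> X) * (?n A * T)"
        by (rule set_times_commute[OF nAT normalizes_mono[OF sB(3) nATG]])
      ultimately have "idx ?Y (?n A * T) = idx (B \<inter> X) ((B \<inter> X) \<inter> (?n A * T))"
        using idx_times[OF sB(1) nAT finB fin[OF nATG]] by simp
      moreover have "idx (B \<inter> X) ((B \<inter> X) \<inter> (?n A * T)) dvd idx (B \<inter> X) (?n B * T)"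
      proof (rule idx_dvd_trans(1)[OF is_subgroup_times_normal[OF nB(1) nBG nT] _ sB(1) _ _ finB])
        show "is_subgroup ((B \<inter> X) \<inter> (?n A * T))" using is_subgroup_Int[OF sB(1) nAT] .
        have "?n B \<subseteq> ?n A" using B(3) by (auto simp: normalizer_in_def)
        then show "?n B * T \<subseteq> (B \<inter> X) \<inter> (?n A * T)"
          using set_times_mono2[of "?n B" "?n A" T T] set_times_least[OF sB(1) nB(2) TBX] by blast
      qed auto
      ultimately show ?thesis using IH dvd_trans by metis
    qed
    moreover have "idx (A \<inter> X) (?n A * T) = idx (A \<inter> X) ?Y * idx ?Y (?n A * T)"
      by (rule idx_mult[OF nAT Y sA(1) nATY YA finA])
    ultimately show ?thesis using p prime_dvd_mult_iff by metis
  qed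
qed

text \<open>By \<open>idx_normalizer_times\<close> for \<open>A = N\<close>, some conjugate of the
  normalizer of \<open>S\<close> times \<open>T\<close> contains \<open>P\<close>. As
  \<open>P \<inter> T\<close> consists of nongenerators of \<open>P\<close> modulo \<open>K\<close>,
  already \<open>R\<close>, with \<open>K\<close> in place of \<open>T\<close>, contains
  \<open>P\<close> and hence \<open>T\<close>. So \<open>T\<close> lies in the normalizer of
  \<open>S\<close> times \<open>K\<close>, and its commutators with \<open>S\<close> lie in
  \<open>S K \<inter> T\<close>, which is \<open>K\<close> by coprimality.\<close>

lemma sylow_centralizes_frattini:
  assumes fr: "\<And>M. maxsub M P \<Longrightarrow> P \<inter> K \<subseteq> M \<Longrightarrow> P \<inter> T \<subseteq> M"
    and s: "s \<in> S" and t: "t \<in> T"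
  shows "commutator t s \<in> K"
proof -
  note nT = chiefD(1)[OF ch] and nK = chiefD(2)[OF ch] and KT = chiefD(3)[OF ch]
  note T' = is_normalD[OF nT] and K' = is_normalD[OF nK]
  note X' = is_subgroup_upper_centralizer upper_centralizer_subset
  let ?D = "N \<inter> X"
  let ?n = "normalizer_in ?D S"
  have D: "is_subgroup ?D" "?D \<subseteq> G" using is_subgroup_Int NG X' by auto
  have n: "is_subgroup ?n" "?n \<subseteq> ?D" using is_subgroup_normalizer_in[OF D(1)] by (auto simp: normalizer_in_def)
  have nG: "?n \<subseteq> G" using n D by blast
  have nT_D: "?n * T \<subseteq> ?D" using set_times_least[OF D(1) n(2)] TN subset_upper_centralizer by blast
  have "P \<subseteq> ?D" using PN P_upper_centralizer by blast
  then obtain d where d: "d \<in> ?D" "P \<subseteq> conjugate d (?n * T)"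
    using subgroup_in_conjugate[OF p D(1) fin[OF D(2)] is_subgroup_times_normal[OF n(1) nG nT] nT_D
        idx_normalizer_times[OF N TN order_refl] PN(1) _ PN(3)] by blast
  have dG: "d \<in> G" using d(1) D by blast
  define R where "R = conjugate d (?n * K)"
  have nK': "is_subgroup (?n * K)" using is_subgroup_times_normal[OF n(1) nG nK] .
  have R: "is_subgroup R" unfolding R_def by (rule is_subgroup_conjugate[OF nK'])
  have KR: "K \<subseteq> R"
    using conjugate_mono[OF set_times_superset2[OF n(1)], of d K] conjugate_normal[OF K'(3) G(1) dG]
    by (simp add: R_def)
  have T_eq: "T = (P \<inter> T) * K" by (rule normal_eq_times[OF nT TN nK KT pp])
  note PT = P_Int_subgroup[OF nT]
  have "T = K * (P \<inter> T)"
    using T_eq set_times_commute[OF PT normalizes_mono[OF K'(3)]] PG by (metis le_infI1)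
  then have "conjugate d (?n * T) = conjugate d ?n * (K * (P \<inter> T))"
    using conjugate_normal[OF T'(3) G(1) dG] conjugate_times[of d ?n T] by simp
  also have "\<dots> = R * (P \<inter> T)"
    using conjugate_normal[OF K'(3) G(1) dG] conjugate_times[of d ?n K] by (simp add: R_def mult.assoc)
  finally have PR: "P \<subseteq> R * (P \<inter> T)" using d(2) by simp
  have PR': "\<exists>r\<in>P \<inter> R. \<exists>u\<in>P \<inter> T. x = r * u" if x: "x \<in> P" for x
  proof -
    obtain r u where ru: "r \<in> R" "u \<in> P \<inter> T" "x = r * u" using PR x set_times_mem[of x R "P \<inter> T"] by blast
    have "r \<in> P" using ru x is_subgroup_right_iff[OF PN(1), of u r] by auto
    then show ?thesis using ru by blast
  qed
  have "P \<inter> R = P"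
  proof (rule ccontr)
    assume "P \<inter> R \<noteq> P"
    then obtain M where M: "maxsub M P" "P \<inter> R \<subseteq> M"
      using maxsub_exists[OF finP is_subgroup_Int[OF PN(1) R]] by blast
    then have "P \<inter> T \<subseteq> M" using fr KR by blast
    then have "P \<subseteq> M" using PR' M(2) is_subgroupD(2)[OF maxP(1)[OF M(1)]] by blast
    then show False using maxsubD(2,3)[OF M(1)] by blast
  qed
  then have "T \<subseteq> R" using T_eq set_times_least[OF R _ KR, of "P \<inter> T"] by blast
  then have "conjugate (inverse d) T \<subseteq> ?n * K"
    using conjugate_mono[of T R "inverse d"] by (simp add: R_def conjugate_conjugate)
  moreover have "conjugate (inverse d) T = T"
    using conjugate_normal[OF T'(3) G(1) is_subgroupD(3)[OF G(1) dG]] .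
  ultimately have "t \<in> ?n * K" using t by blast
  then obtain m k where mk: "m \<in> ?n" "k \<in> K" "t = m * k" unfolding set_times_mem by blast
  have sG: "s \<in> G" and SG: "S \<subseteq> G" using s SX X' by blast+
  have mG: "m \<in> G" using mk nG by blast
  have "m * s * inverse m \<in> conjugate m S" using s by (auto simp: conjugate_def)
  then have ms: "m * s * inverse m \<in> S" using mk(1) by (simp add: normalizer_in_def)
  have comm: "S * K = K * S" by (rule set_times_commute[OF SX(1) normalizes_mono[OF K'(3) SG]])
  note SK = idx_times_normal[OF SX(1) SG nK]
  have "commutator t s = (m * commutator k s * inverse m) * ((m * s * inverse m) * inverse s)"
    by (simp add: mk commutator_def group_word)
  moreover have "m * commutator k s * inverse m \<in> K"
    using normalizesD[OF K'(3) mG] commutator_mem_normal[OF K'(1,3) sG mk(2)] commutator_mem_commute[OF K'(1)] by blast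
  moreover have "(m * s * inverse m) * inverse s \<in> S" using ms s SX(1) by (simp add: is_subgroupD)
  ultimately have 1: "commutator t s \<in> S * K" unfolding comm using set_times_intro by metis
  have 2: "commutator t s \<in> T"
    using commutator_mem_normal[OF T'(1,3) sG t] commutator_mem_commute[OF T'(1)] by blast
  let ?V = "S * K \<inter> T"
  have V: "is_subgroup ?V" using is_subgroup_Int[OF SK(1) T'(1)] .
  have KV: "K \<subseteq> ?V" using SK(3) KT by blast
  have VG: "?V \<subseteq> G" using T' by blast
  have "idx ?V K dvd idx T K" by (rule idx_dvd_trans(2)[OF K'(1) V T'(1) KV _ fin[OF T'(2)]]) blast
  then have vp: "prime_power_of p (idx ?V K)" using prime_power_of_dvd[OF p pp] by blast
  have "idx ?V K dvd idx (S * K) K" by (rule idx_dvd_trans(2)[OF K'(1) V SK(1) KV _ fin[OF SK(2)]]) blast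
  also have "idx (S * K) K = idx S (S \<inter> K)" by (rule SK(5))
  also have "\<dots> dvd card S"
    using lagrange_idx[OF is_subgroup_Int[OF SX(1) K'(1)] SX(1) _ fin[OF SG]] by (metis dvd_triv_left inf_le1)
  finally have "prime_power_of q (idx ?V K)" using prime_power_of_dvd[OF q(1) SX(3)] by blast
  moreover have "\<not> q dvd idx ?V K"
  proof
    assume "q dvd idx ?V K"
    then obtain j where "q dvd p ^ j" using vp by (auto simp: prime_power_of_def)
    then show False using q p by (metis prime_dvd_power primes_dvd_imp_eq)
  qed
  ultimately have "idx ?V K = 1" using prime_power_of_eq_1 by blast
  then have "K = ?V" using idx_eq_1[OF K'(1) V KV fin[OF VG]] by blast
  then show ?thesis using 1 2 by blast
qed

end

lemma frattini_chief:
  assumes fr: "\<And>M. maxsub M P \<Longrightarrow> P \<inter> K \<subseteq> M \<Longrightarrow> P \<inter> T \<subseteq> M"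
  shows "idx T K = p"
proof -
  note nT = chiefD(1)[OF ch] and nK = chiefD(2)[OF ch] and KT = chiefD(3)[OF ch]
  note T' = is_normalD[OF nT] and K' = is_normalD[OF nK]
  note X' = is_subgroup_upper_centralizer upper_centralizer_subset
  have finX: "finite X" using fin X' by blast
  obtain Sp where Sp: "is_sylow p Sp X" using sylow_exists[OF p X'(1) finX] by blast
  note Sp' = is_sylowD[OF Sp]
  have SpG: "Sp \<subseteq> G" using Sp' X' by blast
  have KT': "K \<subset> T" using KT chiefD(4)[OF ch] by blast
  \<comment> \<open>A Sylow \<open>p\<close>-subgroup of \<open>X\<close> fixes some
    \<open>t\<close> outside \<open>K\<close> modulo \<open>K\<close>, and the other Sylow subgroups
    act trivially on \<open>T / K\<close>. So all of \<open>X\<close> fixes \<open>t\<close>; the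
    fixed points of \<open>X\<close> are \<open>G\<close>-invariant, hence all of
    \<open>T\<close>.\<close>
  obtain t where t: "t \<in> T" "t \<notin> K" "\<forall>s\<in>Sp. commutator s t \<in> K"
    using p_group_fixed_coset[OF p Sp'(1) fin[OF SpG] Sp'(3) T'(1) fin[OF T'(2)] normalizes_mono[OF T'(3) SpG]
        K'(1) KT' normalizes_mono[OF K'(3) SpG] normalizes_mono[OF K'(3) T'(2)] pp] by blast
  let ?Y = "centralizer_mod X {t} K"
  have YX: "?Y = X"
  proof (rule contains_sylows_eq[OF X'(1) finX])
    show "is_subgroup ?Y"
      by (rule is_subgroup_centralizer_mod[OF X'(1) K'(1) normalizes_mono[OF K'(3) X'(2)]])
    show "?Y \<subseteq> X" by (auto simp: centralizer_mod_def)
    fix q :: nat assume q: "prime q"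
    show "\<exists>S. is_sylow q S X \<and> S \<subseteq> ?Y"
    proof (cases "q = p")
      case True
      have "commutator t s \<in> K" if "s \<in> Sp" for s using t that commutator_mem_commute[OF K'(1)] by blast
      then have "Sp \<subseteq> ?Y" using Sp'(2) by (auto simp: centralizer_mod_def)
      then show ?thesis using True Sp by blast
    next
      case False
      obtain S where S: "is_sylow q S X" using sylow_exists[OF q X'(1) finX] by blast
      have "commutator t s \<in> K" if "s \<in> S" for s
        by (rule sylow_centralizes_frattini[OF q False S fr that t(1)])
      then have "S \<subseteq> ?Y" using is_sylowD(2)[OF S] by (auto simp: centralizer_mod_def)
      then show ?thesis using S by blast
    qed
  qed
  let ?C = "centralizer_mod T X K"
  have "is_subgroup ?C" by (rule is_subgroup_centralizer_mod[OF T'(1) K'(1) normalizes_mono[OF K'(3) T'(2)]])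
  moreover have "normalizes G ?C"
    by (rule normalizes_centralizer_mod[OF G(1) normalizes_upper_centralizer T'(3) K'(3)])
  moreover have "?C \<subseteq> T" by (auto simp: centralizer_mod_def)
  moreover have "K \<subseteq> ?C"
    using KT commutator_mem_normal[OF K'(1,3)] X'(2) by (auto simp: centralizer_mod_def)
  moreover have "t \<in> ?C"
  proof -
    have "commutator x t \<in> K" if "x \<in> X" for x
    proof -
      have "x \<in> ?Y" using that YX by simp
      then show ?thesis using commutator_mem_commute[OF K'(1), of x t] by (simp add: centralizer_mod_def)
    qed
    then show ?thesis using t by (simp add: centralizer_mod_def)
  qed
  ultimately have "?C = T" using chiefD(5)[OF ch, of ?C] t(2) T'(2) by (auto simp: is_normal_def)
  then have c: "commutator x y \<in> K" if "x \<in> X" "y \<in> T" for x y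
    using that unfolding centralizer_mod_def by blast
  show ?thesis
  proof (rule chief_of_abelian_action[OF p G ch pp])
    show "\<And>x y. x \<in> T \<Longrightarrow> y \<in> T \<Longrightarrow> commutator x y \<in> K" using c subset_upper_centralizer by blast
    show "\<And>g h t. g \<in> G \<Longrightarrow> h \<in> G \<Longrightarrow> t \<in> T \<Longrightarrow> commutator (commutator g h) t \<in> K"
      using c commutator_in_upper_centralizer by blast
    show "\<And>g t. g \<in> G \<Longrightarrow> t \<in> T \<Longrightarrow> commutator (g ^ (p - 1)) t \<in> K"
      using c power_in_upper_centralizer by blast
  qed
qed

end

end

section \<open>Transfer\<close>

text \<open>This is the transfer into the abelian group \<open>Q / E\<close>. The last clause
  evaluates it on elements that are central in \<open>C\<close> modulo \<open>E\<close>: such a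
  \<open>t\<close> fixes every coset of \<open>Q\<close> and contributes itself once for
  each.\<close>

lemma transfer_exists:
  fixes C Q E :: "'g::group_mult set"
  assumes C: "is_subgroup C" "finite C" and Q: "is_subgroup Q" "Q \<subseteq> C" and E: "is_subgroup E" "E \<subseteq> Q"
    and ab: "\<And>x y. x \<in> Q \<Longrightarrow> y \<in> Q \<Longrightarrow> commutator x y \<in> E"
  shows "\<exists>V. (\<forall>x\<in>C. V x \<in> left_cosets Q E) \<and> (\<forall>x\<in>C. \<forall>y\<in>C. V (x * y) = V x * V y) \<and>
    (\<forall>t\<in>Q. (\<forall>x\<in>C. inverse t * (inverse x * t * x) \<in> E) \<longrightarrow> V t = (t ^ idx C Q) *o E)"
proof -
  interpret A: comm_group "coset_group Q E"
    by (rule comm_group_coset_group[OF Q(1) E]) (use ab in auto)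
  have carr: "carrier (coset_group Q E) = left_cosets Q E"
    and mult: "\<And>x y. x \<otimes>\<^bsub>coset_group Q E\<^esub> y = x * y" by (simp_all add: coset_group_def)
  have nQE: "normalizes Q E" by (rule abelian_mod_normalizes[OF Q(1) E]) (use ab in auto)
  have cpow: "(x *o E) [^]\<^bsub>coset_group Q E\<^esub> (n::nat) = (x ^ n) *o E" if "x \<in> Q" for x n
    by (rule coset_group_pow[OF Q(1) E]) (use ab that in auto)
  define \<Omega> where "\<Omega> = left_cosets C Q"
  have fin\<Omega>: "finite \<Omega>" using C by (simp add: \<Omega>_def left_cosets_def)
  define sec where "sec c = (SOME b. b \<in> C \<and> c = b *o Q)" for c
  have sec: "sec c \<in> C" "sec c *o Q = c" if "c \<in> \<Omega>" for c
  proof -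
    have "\<exists>b. b \<in> C \<and> c = b *o Q" using that by (auto simp: \<Omega>_def left_cosets_def)
    from someI_ex[OF this] show "sec c \<in> C" "sec c *o Q = c" by (simp_all add: sec_def)
  qed
  have act: "x *o c \<in> \<Omega>" if "x \<in> C" "c \<in> \<Omega>" for x c
    using that C by (auto simp: \<Omega>_def left_cosets_def set_times_rearrange2 is_subgroupD)
  \<comment> \<open>The \<open>Q\<close>-component of \<open>x\<close> acting on coset
    representatives. The cocycle identity \<open>f (x * y) c = f x (y *o c) * f y c\<close>,
    together with the fact that \<open>y\<close> permutes the cosets, makes the product over
    \<open>\<Omega>\<close> multiplicative.\<close>
  define f where "f x c = inverse (sec (x *o c)) * x * sec c" for x c
  have f: "f x c \<in> Q" if x: "x \<in> C" and c: "c \<in> \<Omega>" for x c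
  proof -
    have "sec (x *o c) *o Q = x *o (sec c *o Q)" using sec(2)[OF act[OF x c]] sec(2)[OF c] by simp
    then have "sec (x *o c) *o Q = (x * sec c) *o Q" by (simp add: set_times_rearrange2)
    then have "inverse (sec (x *o c)) * (x * sec c) \<in> Q" using left_coset_eq_iff[OF Q(1)] by blast
    then show ?thesis by (simp add: f_def mult.assoc)
  qed
  define V where "V x = finprod (coset_group Q E) (\<lambda>c. f x c *o E) \<Omega>" for x
  have fc: "(\<lambda>c. f x c *o E) \<in> \<Omega> \<rightarrow> carrier (coset_group Q E)" if "x \<in> C" for x
    using f[OF that] coset_in_left_cosets by (auto simp: carr)
  have V1: "V x \<in> left_cosets Q E" if "x \<in> C" for x
    unfolding V_def using A.finprod_closed[OF fc[OF that]] by (simp add: carr)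
  have V2: "V (x * y) = V x * V y" if x: "x \<in> C" and y: "y \<in> C" for x y
  proof -
    have inj: "inj_on (\<lambda>c. y *o c) \<Omega>"
    proof (rule inj_onI)
      fix c d assume "y *o c = y *o d"
      then have "inverse y *o (y *o c) = inverse y *o (y *o d)" by simp
      then show "c = d" by (simp add: set_times_rearrange2 elt_set_times_eq_image[of 1])
    qed
    have img: "(\<lambda>c. y *o c) ` \<Omega> = \<Omega>"
      by (rule endo_inj_surj[OF fin\<Omega> _ inj]) (use act y in auto)
    have fy: "(\<lambda>c. f x (y *o c) *o E) \<in> \<Omega> \<rightarrow> carrier (coset_group Q E)"
      using fc[OF x] act[OF y] by auto
    have "V (x * y) = finprod (coset_group Q E) (\<lambda>c. (f x (y *o c) *o E) \<otimes>\<^bsub>coset_group Q E\<^esub> (f y c *o E)) \<Omega>"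
      unfolding V_def
    proof (rule A.finprod_cong')
      show "(\<lambda>c. (f x (y *o c) *o E) \<otimes>\<^bsub>coset_group Q E\<^esub> (f y c *o E)) \<in> \<Omega> \<rightarrow> carrier (coset_group Q E)"
        using fy fc[OF y] by (auto intro!: A.m_closed)
      fix c assume c: "c \<in> \<Omega>"
      have "f (x * y) c = f x (y *o c) * f y c"
        by (simp add: f_def group_word set_times_rearrange2)
      then show "f (x * y) c *o E = (f x (y *o c) *o E) \<otimes>\<^bsub>coset_group Q E\<^esub> (f y c *o E)"
        using coset_mult[OF E(1) nQE Q(1) f[OF y c]] by (simp add: mult)
    qed simp
    also have "\<dots> = finprod (coset_group Q E) (\<lambda>c. f x (y *o c) *o E) \<Omega> \<otimes>\<^bsub>coset_group Q E\<^esub> V y"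
      unfolding V_def by (rule A.finprod_multf[OF fy fc[OF y]])
    also have "finprod (coset_group Q E) (\<lambda>c. f x (y *o c) *o E) \<Omega> = V x"
      unfolding V_def using A.finprod_reindex[of "\<lambda>c. f x c *o E" "\<lambda>c. y *o c" \<Omega>] inj fc[OF x] by (simp add: img)
    finally show ?thesis by (simp add: mult)
  qed
  have V3: "V t = (t ^ idx C Q) *o E" if t: "t \<in> Q" and central: "\<forall>x\<in>C. inverse t * (inverse x * t * x) \<in> E" for t
  proof -
    have tC: "t \<in> C" using t Q by blast
    have "f t c *o E = t *o E" if c: "c \<in> \<Omega>" for c
    proof -
      have bE: "inverse t * (inverse (sec c) * t * sec c) \<in> E" using central sec(1)[OF c] by blast
      then have "t * (inverse t * (inverse (sec c) * t * sec c)) \<in> Q"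
        using is_subgroupD(2)[OF Q(1) t subsetD[OF E(2)]] by blast
      then have "inverse (sec c) * (t * sec c) \<in> Q" by (simp add: mult.assoc)
      then have "sec c *o Q = (t * sec c) *o Q" using left_coset_eq_iff[OF Q(1)] by blast
      also have "\<dots> = t *o (sec c *o Q)" by (simp add: set_times_rearrange2)
      finally have "t *o c = c" using sec(2)[OF c] by simp
      then have "f t c = inverse (sec c) * t * sec c" by (simp add: f_def)
      then have "t *o E = f t c *o E" using bE left_coset_eq_iff[OF E(1)] by metis
      then show ?thesis ..
    qed
    then have "V t = finprod (coset_group Q E) (\<lambda>c. t *o E) \<Omega>"
      unfolding V_def using t by (intro A.finprod_cong') (auto simp: carr coset_in_left_cosets)
    also have "\<dots> = (t *o E) [^]\<^bsub>coset_group Q E\<^esub> card \<Omega>"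
      using t by (intro A.finprod_const) (simp add: carr coset_in_left_cosets)
    also have "\<dots> = (t ^ card \<Omega>) *o E" by (rule cpow[OF t])
    also have "card \<Omega> = idx C Q" unfolding \<Omega>_def by (rule card_left_cosets_idx[OF Q(1) C(1) Q(2) C(2)])
    finally show ?thesis .
  qed
  show ?thesis using V1 V2 V3 by blast
qed

definition generated :: "'g::group_mult set \<Rightarrow> 'g set"
  where "generated S = \<Inter>{A. is_subgroup A \<and> S \<subseteq> A}"

lemma is_subgroup_generated: "is_subgroup (generated S)"
  unfolding generated_def by (rule is_subgroup_Inter) simp

lemma generated_superset: "S \<subseteq> generated S"
  unfolding generated_def by blast

lemma generated_least: "is_subgroup A \<Longrightarrow> S \<subseteq> A \<Longrightarrow> generated S \<subseteq> A"
  unfolding generated_def by blast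

lemma normalizes_generated:
  assumes "is_subgroup G" "normalizes G S"
  shows "normalizes G (generated S)"
  unfolding normalizes_def
proof (intro ballI)
  fix g a assume g: "g \<in> G" and a: "a \<in> generated S"
  have "generated S \<subseteq> conjugate (inverse g) (generated S)"
  proof (rule generated_least[OF is_subgroup_conjugate[OF is_subgroup_generated]])
    show "S \<subseteq> conjugate (inverse g) (generated S)"
    proof
      fix x assume "x \<in> S"
      then have "g * x * inverse g \<in> generated S" using normalizesD[OF assms(2) g] generated_superset by blast
      then show "x \<in> conjugate (inverse g) (generated S)" by (simp add: conjugate_mem)
    qed
  qed
  then show "g * a * inverse g \<in> generated S" using a by (auto simp: conjugate_mem)
qed

lemma prime_power_of_eq_prime:
  fixes p n :: nat
  assumes "prime p" "prime_power_of p n" "p dvd n" "\<not> p * p dvd n"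
  shows "n = p"
proof -
  obtain k where k: "n = p ^ k" using assms by (auto simp: prime_power_of_def)
  have "k \<noteq> 0" using assms k by (metis not_prime_unit power_0)
  moreover have "\<not> k \<ge> 2"
  proof
    assume "k \<ge> 2"
    then have "p ^ 2 dvd n" unfolding k by (rule le_imp_power_dvd)
    then show False using assms by (simp add: power2_eq_square)
  qed
  ultimately have "k = 1" by linarith
  then show ?thesis by (simp add: k)
qed

lemma not_square_dvd_prime: "prime p \<Longrightarrow> \<not> p * p dvd p" for p :: nat
proof
  assume p: "prime p" and "p * p dvd p"
  then have "p * p \<le> p" using prime_gt_0_nat[OF p] by (intro dvd_imp_le)
  moreover have "2 * p \<le> p * p" using prime_ge_2_nat[OF p] by (rule mult_le_mono1)
  ultimately show False using prime_gt_0_nat[OF p] by linarith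
qed

section \<open>Chief factors with \<open>P \<inter> K\<close> maximal in \<open>P\<close>, and the
  downward induction\<close>

context sylow_setting
begin

text \<open>Transfer from the centralizer of \<open>J / E\<close> is faithful on \<open>J / E\<close>, so the subgroup \<open>R\<close> generated by
  \<open>E\<close> and the \<open>p'\<close>-elements of that centralizer meets \<open>J\<close> in \<open>E\<close>. If \<open>T \<subseteq> R K\<close>, then \<open>P \<inter> R\<close> is a maximal
  subgroup of \<open>P\<close> to which the hypothesis applies.\<close>

lemma two_step_p_chief:
  assumes ch: "chief G T K" and TN: "T \<subseteq> N" and pd: "p dvd idx T K" and ipK: "idx P (P \<inter> K) = p"
    and J: "is_normal J G" "J \<subseteq> K" and E: "is_normal E G" "E \<subseteq> J" and ipJ: "idx J E = p"
    and PJ: "P \<inter> J = P \<inter> K" and ipE: "idx P (P \<inter> E) = p * p"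
  shows "prime_power_of p (idx T K)"
proof (rule ccontr)
  assume np: "\<not> prime_power_of p (idx T K)"
  note nT = chiefD(1)[OF ch] and nK = chiefD(2)[OF ch] and KT = chiefD(3)[OF ch]
  note T' = is_normalD[OF nT] and K' = is_normalD[OF nK] and J' = is_normalD[OF J(1)] and E' = is_normalD[OF E(1)]
  note PT = P_Int_subgroup[OF nT] and PK = P_Int_subgroup[OF nK] and PE = P_Int_subgroup[OF E(1)]
  have KN: "K \<subseteq> N" and JN: "J \<subseteq> N" and EN: "E \<subseteq> N" using KT TN J E by blast+
  have PTK: "\<not> P \<inter> T \<subseteq> K" by (rule not_P_Int_subset[OF nT TN K'(1) KT pd])
  have mPK: "maxsub (P \<inter> K) P" using maxsub_of_prime_idx[OF p PN(1) finP PK _ ipK] by blast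
  let ?Z = "centralizer_mod G J E"
  have Zsub: "is_subgroup ?Z" "normalizes G ?Z"
    using prime_factor_centralizer[OF p G J(1) E ipJ] .
  define C where "C = N \<inter> ?Z"
  have C: "is_normal C G"
    unfolding C_def is_normal_def using NG Zsub is_subgroup_Int normalizes_Int by blast
  note C' = is_normalD[OF C]
  have CN: "C \<subseteq> N" by (auto simp: C_def)
  have finC: "finite C" using fin C' by blast
  have cC: "commutator y x \<in> E" if "x \<in> C" "y \<in> J" for x y
    using that by (auto simp: C_def centralizer_mod_def)
  have PC: "P \<subseteq> C"
  proof
    fix x assume x: "x \<in> P"
    obtain n where n: "card P = p ^ n" using PN(3) by (auto simp: prime_power_of_def)
    have "x ^ (p ^ n) = 1" using power_card_eq_one[OF PN(1) finP x] by (simp add: n)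
    then have "x \<in> ?Z" using p_element_centralizes_prime_factor[OF p G J(1) E ipJ] x PG by blast
    then show "x \<in> C" using x PN(2) by (auto simp: C_def)
  qed
  have EC: "E \<subseteq> C"
  proof
    fix e assume e: "e \<in> E"
    have "commutator y e \<in> E" if "y \<in> J" for y
      using commutator_mem_normal[OF E'(1,3) _ e] that J' by blast
    then show "e \<in> C" using e EN E' by (auto simp: C_def centralizer_mod_def)
  qed
  have J_eq: "J = (P \<inter> J) * E"
    by (rule normal_eq_times[OF J(1) JN E]) (simp add: ipJ prime_power_of_self)
  \<comment> \<open>\<open>P \<inter> J\<close> has index \<open>p\<close> in \<open>P\<close> and
    is central modulo \<open>E\<close>, because \<open>P\<close> lies in \<open>C\<close>. So
    \<open>P\<close> is abelian modulo \<open>E\<close>, as the transfer requires.\<close>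
  have PPE: "commutator x y \<in> E" if "x \<in> P" "y \<in> P" for x y
  proof (rule commutator_mem_of_prime_idx[OF p PN(1) finP, of "P \<inter> J"])
    show "is_subgroup (P \<inter> J)" "P \<inter> J \<subseteq> P" using PN J' is_subgroup_Int by auto
    show "normalizes P (P \<inter> J)"
      by (rule normalizes_Int[OF normalizes_subgroup[OF PN(1)] normalizes_mono[OF J'(3) PG]])
    show "idx P (P \<inter> J) = p" using ipK by (simp add: PJ)
    show "is_subgroup E" "normalizes P E" using E' normalizes_mono[OF E'(3) PG] by blast+
    show "commutator x m \<in> E" if "x \<in> P" "m \<in> P \<inter> J" for x m
      using cC[of x m] that PC commutator_mem_commute[OF E'(1)] by blast
  qed (fact that)+
  define Q where "Q = P * E"
  note Q' = idx_times_normal[OF PN(1) PG E(1), folded Q_def]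
  have QC: "Q \<subseteq> C" unfolding Q_def by (rule set_times_least[OF C'(1) PC EC])
  have right: "commutator s (b * e) \<in> E" if "s \<in> G" "b \<in> G" "e \<in> E" "commutator s b \<in> E" for s b e
    unfolding commutator_mult_right
    using that commutator_mem_normal[OF E'(1,3) that(1,3)] normalizesD[OF E'(3) that(2)] E' by (simp add: is_subgroupD)
  have QE: "commutator x y \<in> E" if x: "x \<in> Q" and y: "y \<in> Q" for x y
  proof -
    obtain a e where ae: "a \<in> P" "e \<in> E" "x = a * e" using x by (auto simp: Q_def set_times_mem)
    obtain b d where bd: "b \<in> P" "d \<in> E" "y = b * d" using y by (auto simp: Q_def set_times_mem)
    have "commutator b x \<in> E" using right[of b a e] ae bd PG PPE by blast
    then have "commutator x b \<in> E" using commutator_mem_commute[OF E'(1)] by blast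
    then show ?thesis using right[of x b d] x bd PG Q'(2) by blast
  qed
  obtain V where V: "\<And>x. x \<in> C \<Longrightarrow> V x \<in> left_cosets Q E" "\<And>x y. x \<in> C \<Longrightarrow> y \<in> C \<Longrightarrow> V (x * y) = V x * V y"
    "\<And>t. t \<in> Q \<Longrightarrow> \<forall>x\<in>C. inverse t * (inverse x * t * x) \<in> E \<Longrightarrow> V t = (t ^ idx C Q) *o E"
    using transfer_exists[OF C'(1) finC Q'(1) QC E'(1) Q'(3) QE] by metis
  have JQ: "J \<subseteq> Q" using J_eq set_times_mono2[of "P \<inter> J" P E E] by (auto simp: Q_def)
  have VJ: "V t = (t ^ idx C Q) *o E" if t: "t \<in> J" for t
  proof (rule V(3))
    show "t \<in> Q" using t JQ by blast
    show "\<forall>x\<in>C. inverse t * (inverse x * t * x) \<in> E"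
    proof
      fix x assume x: "x \<in> C"
      have "inverse t * (inverse x * t * x) = commutator (inverse t) (inverse x)"
        by (simp add: commutator_def mult.assoc)
      also have "\<dots> \<in> E" using cC x t C' J' by (simp add: is_subgroupD)
      finally show "inverse t * (inverse x * t * x) \<in> E" .
    qed
  qed
  have nC: "\<not> p dvd idx C Q"
  proof -
    have "idx C Q dvd idx C P" by (rule idx_dvd_trans(1)[OF PN(1) Q'(1) C'(1) Q'(4) QC finC])
    moreover have "idx C P dvd idx N P" by (rule idx_dvd_trans(2)[OF PN(1) C'(1) NG(1) PC CN fin[OF NG(2)]])
    ultimately show ?thesis using PN(4) dvd_trans by blast
  qed
  have VE: "V e = E" if "e \<in> E" for e
    using VJ[OF subsetD[OF E(2) that]] coset_eq_self_iff[OF E'(1)] is_subgroupD(4)[OF E'(1) that] by simp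
  \<comment> \<open>The kernel of the transfer. It contains all elements of \<open>C\<close> of
    order prime to \<open>p\<close>, because \<open>Q / E\<close> has order
    \<open>p * p\<close>.\<close>
  define W where "W = {x \<in> C. V x = E}"
  have W: "is_subgroup W"
  proof (rule is_subgroup_finite[OF C'(1) finC])
    show "1 \<in> W" using VE C' E' by (simp add: W_def is_subgroupD)
    show "x * y \<in> W" if "x \<in> W" "y \<in> W" for x y
      using that V(2)[of x y] C' set_times_absorb1[OF E'(1) E'(1)] by (simp add: W_def is_subgroupD)
  qed (auto simp: W_def)
  have nQE: "is_normal E Q" using normal_in_subgroup[OF E(1) Q'(3,2)] .
  have coprime_W: "x \<in> W" if x: "x \<in> C" and m: "\<not> p dvd m" "x ^ m = 1" for x m
  proof -
    obtain u where u: "u \<in> Q" "V x = u *o E" using V(1)[OF x] by (auto simp: left_cosets_def)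
    have "V (x ^ n) = (u ^ n) *o E" for n
    proof (induction n)
      case 0
      then show ?case using VE[OF is_subgroupD(1)[OF E'(1)]] by (simp add: elt_set_times_eq_image)
    next
      case (Suc n)
      have "V (x ^ Suc n) = V x * V (x ^ n)" using V(2)[OF x is_subgroupD(4)[OF C'(1) x]] by simp
      also have "\<dots> = (u * u ^ n) *o E"
        unfolding u(2) Suc using coset_mult[OF E'(1) is_normalD(3)[OF nQE] Q'(1) is_subgroupD(4)[OF Q'(1) u(1)]] .
      finally show ?case by simp
    qed
    from this[of m] have "(u ^ m) *o E = E" using m(2) VE[OF is_subgroupD(1)[OF E'(1)]] by simp
    then have um: "u ^ m \<in> E" using coset_eq_self_iff[OF E'(1)] by blast
    have "u ^ idx Q E \<in> E" by (rule power_idx_mem[OF Q'(1) fin[OF Q'(2)] nQE u(1)])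
    moreover have "idx Q E = p * p" using Q'(5) ipE by simp
    ultimately have "u ^ (p * p) \<in> E" by simp
    moreover have "coprime m (p * p)" using prime_imp_coprime[OF p m(1)] by (simp add: coprime_commute)
    ultimately have "u \<in> E" using coprime_powers_mem[OF E'(1) um] by blast
    then have "V x = E" using u(2) coset_eq_self_iff[OF E'(1)] by simp
    then show ?thesis using x by (simp add: W_def)
  qed
  \<comment> \<open>Conjugation by \<open>G\<close> permutes these elements, so they generate a
    normal subgroup. \<open>E\<close> is included so that \<open>P \<inter> R\<close> meets
    \<open>P \<inter> K\<close> exactly in \<open>P \<inter> E\<close>.\<close>
  define S0 where "S0 = {x \<in> C. \<exists>m. \<not> p dvd m \<and> x ^ m = 1} \<union> E"
  define R where "R = generated S0"
  have S0W: "S0 \<subseteq> W" using coprime_W VE EC by (auto simp: S0_def W_def)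
  have RW: "R \<subseteq> W" unfolding R_def by (rule generated_least[OF W S0W])
  have RC: "R \<subseteq> C" using RW by (auto simp: W_def)
  have S0R: "S0 \<subseteq> R" unfolding R_def by (rule generated_superset)
  have "normalizes G S0"
    unfolding normalizes_def
  proof (intro ballI)
    fix g a assume g: "g \<in> G" and a: "a \<in> S0"
    show "g * a * inverse g \<in> S0"
    proof (cases "a \<in> E")
      case True
      then show ?thesis using normalizesD[OF E'(3) g] by (auto simp: S0_def)
    next
      case False
      then obtain m where m: "a \<in> C" "\<not> p dvd m" "a ^ m = 1" using a by (auto simp: S0_def)
      then have "(g * a * inverse g) ^ m = 1" by (simp add: group_power_conj)
      then show ?thesis using m(1,2) normalizesD[OF C'(3) g] by (auto simp: S0_def)
    qed
  qed
  then have nR: "is_normal R G"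
    using normalizes_generated[OF G(1)] is_subgroup_generated RC C'(2) by (auto simp: is_normal_def R_def)
  note R' = is_normalD[OF nR]
  have RN: "R \<subseteq> N" using RC CN by blast
  \<comment> \<open>On \<open>J\<close> the transfer raises elements to the power
    \<open>idx C Q\<close>, which is prime to \<open>p\<close>, while \<open>J / E\<close> has order
    \<open>p\<close>. So its kernel meets \<open>J\<close> only in \<open>E\<close>.\<close>
  have RJ: "R \<inter> J \<subseteq> E"
  proof
    fix x assume x: "x \<in> R \<inter> J"
    then have "(x ^ idx C Q) *o E = E" using VJ[of x] RW by (auto simp: W_def)
    then have "x ^ idx C Q \<in> E" using coset_eq_self_iff[OF E'(1)] by blast
    moreover have "x ^ p \<in> E"
      using power_idx_mem[OF J'(1) fin[OF J'(2)] normal_in_subgroup[OF E J'(2)]] x ipJ by simp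
    moreover have "coprime (idx C Q) p" using prime_imp_coprime[OF p nC] by (simp add: coprime_commute)
    ultimately show "x \<in> E" using coprime_powers_mem[OF E'(1)] by blast
  qed
  have nRK: "is_normal (R * K) G" by (rule is_normal_times[OF nR nK G(1)])
  note RK = idx_times_normal[OF R'(1,2) nK]
  from chief_Int_cases[OF ch nRK RK(3)] show False
  proof
    \<comment> \<open>The elements of \<open>T \<inter> C\<close> of order prime to \<open>p\<close>
      lie in \<open>R\<close>, hence in \<open>K\<close>. Since \<open>T \<inter> C\<close> contains
      \<open>P \<inter> T\<close>, it covers \<open>T / K\<close>; so no prime other than
      \<open>p\<close> divides the order of the factor.\<close>
    assume RKT: "R * K \<inter> T = K"
    have nTC: "is_normal (T \<inter> C) G" by (rule is_normal_Int[OF nT C])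
    note TC' = is_normalD[OF nTC]
    note TCK = idx_times_normal[OF TC'(1,2) nK]
    have "(T \<inter> C) * K = K \<or> (T \<inter> C) * K = T"
      using chiefD(5)[OF ch is_normal_times[OF nTC nK G(1)] TCK(3)] set_times_least[OF T'(1) _ KT, of "T \<inter> C"] by simp
    moreover have "P \<inter> T \<subseteq> (T \<inter> C) * K" using PC TCK(4) by auto
    ultimately have "(T \<inter> C) * K = T" using PTK by blast
    then have id: "idx T K = idx (T \<inter> C) ((T \<inter> C) \<inter> K)" using TCK(5) by simp
    have finTC: "finite (T \<inter> C)" using finC by blast
    have sTCK: "is_subgroup ((T \<inter> C) \<inter> K)" by (rule is_subgroup_Int[OF TC'(1) K'(1)])
    have "prime_power_of p (idx T K)"
    proof (rule prime_power_ofI[OF _ _ p])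
      show "idx T K > 0" by (rule idx_pos[OF K'(1) T'(1) KT fin[OF T'(2)]])
      fix q assume q: "prime q" "q dvd idx T K"
      show "q = p"
      proof (rule ccontr)
        assume qp: "q \<noteq> p"
        obtain S where S: "is_sylow q S (T \<inter> C)" using sylow_exists[OF q(1) TC'(1) finTC] by blast
        note S' = is_sylowD[OF S]
        have finS: "finite S" using S'(2) finTC finite_subset by blast
        obtain j where j: "card S = q ^ j" using S'(3) by (auto simp: prime_power_of_def)
        have npj: "\<not> p dvd q ^ j"
          using qp p q(1) by (metis prime_dvd_power primes_dvd_imp_eq)
        have "S \<subseteq> (T \<inter> C) \<inter> K"
        proof
          fix x assume x: "x \<in> S"
          have "x ^ (q ^ j) = 1" using power_card_eq_one[OF S'(1) finS x] j by simp
          then have "x \<in> S0" using x S'(2) npj by (auto simp: S0_def)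
          then have "x \<in> R * K" using S0R RK(4) by blast
          then have "x \<in> K" using RKT x S'(2) by blast
          then show "x \<in> (T \<inter> C) \<inter> K" using x S'(2) by blast
        qed
        then have "idx (T \<inter> C) ((T \<inter> C) \<inter> K) dvd idx (T \<inter> C) S"
          by (intro idx_dvd_trans(1)[OF S'(1) sTCK TC'(1) _ _ finTC]) auto
        then show False using S'(4) q(2) id dvd_trans by metis
      qed
    qed
    then show False using np by contradiction
  next
    assume TRK: "T \<subseteq> R * K"
    define M where "M = P \<inter> R"
    have M: "is_subgroup M" "M \<subseteq> P" "M \<subseteq> G" "M \<subseteq> R" using is_subgroup_Int[OF PN(1) R'(1)] PG by (auto simp: M_def)
    \<comment> \<open>A normal subgroup covering \<open>T / K\<close> has a Sylow
      \<open>p\<close>-subgroup outside \<open>K\<close>, as \<open>p\<close> divides the order of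
      the factor. This is used for \<open>R\<close> and for \<open>[M, G]\<close>.\<close>
    have not_sub: "\<not> P \<inter> B \<subseteq> K" if B: "is_normal B G" "B \<subseteq> N" "T \<subseteq> B * K" for B
    proof -
      note B' = is_normalD[OF B(1)]
      note BK = idx_times_normal[OF B'(1,2) nK]
      have "idx T K dvd idx (B * K) K" by (rule idx_dvd_trans(2)[OF K'(1) T'(1) BK(1) KT B(3) fin[OF BK(2)]])
      then have "p dvd idx B (B \<inter> K)" using pd BK(5) dvd_trans by metis
      then have "\<not> P \<inter> B \<subseteq> B \<inter> K"
        using not_P_Int_subset[OF B(1,2) is_subgroup_Int[OF B'(1) K'(1)]] by blast
      then show ?thesis by blast
    qed
    have MK_P: "H * (P \<inter> K) = P" if H: "is_subgroup H" "H \<subseteq> P" "\<not> H \<subseteq> K" for H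
    proof -
      have n: "normalizes H (P \<inter> K)"
        using normalizes_mono[OF maxP(5)[OF mPK] H(2)] .
      have "H * (P \<inter> K) = P \<inter> K \<or> H * (P \<inter> K) = P"
        using maxsubD(4)[OF mPK is_subgroup_times[OF H(1) PK n] set_times_superset2[OF H(1)]
            set_times_least[OF PN(1) H(2)]] by blast
      then show ?thesis using set_times_superset1[OF PK, of H] H(3) by blast
    qed
    have MnK: "\<not> M \<subseteq> K" unfolding M_def by (rule not_sub[OF nR RN TRK])
    have MP: "M * (P \<inter> K) = P" by (rule MK_P[OF M(1,2) MnK])
    have "M \<inter> (P \<inter> K) = P \<inter> E"
    proof
      show "M \<inter> (P \<inter> K) \<subseteq> P \<inter> E" using RJ PJ by (auto simp: M_def)
      show "P \<inter> E \<subseteq> M \<inter> (P \<inter> K)" using S0R E J by (auto simp: M_def S0_def)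
    qed
    then have "idx P (P \<inter> K) = idx M (P \<inter> E)"
      using idx_times[OF M(1) PK] fin[OF M(3)] finP MP by simp
    moreover have "P \<inter> E \<subseteq> M" using S0R by (auto simp: M_def S0_def)
    then have "idx P (P \<inter> E) = idx P M * idx M (P \<inter> E)"
      by (intro idx_mult[OF PE M(1) PN(1) _ M(2) finP])
    ultimately have "idx P M = p" using ipE ipK p by (simp add: prime_gt_0_nat)
    then have mM: "maxsub M P" by (rule maxsub_of_prime_idx[OF p PN(1) finP M(1,2)])
    from com_alternative[OF M(1,3) ch] show False
    proof
      assume TA: "T \<subseteq> com M G * K"
      let ?A = "com M G"
      have A: "is_normal ?A G" by (rule com_is_normal[OF G(1) M(3)])
      \<comment> \<open>Because \<open>[M, G] \<subseteq> R\<close>, the group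
        \<open>M \<inter> [M, G]\<close> is all of \<open>P \<inter> [M, G]\<close>, a Sylow
        subgroup of \<open>[M, G]\<close>. So nothing is lost by passing from \<open>M\<close> to
        \<open>H\<close>, although \<open>M\<close> does not contain
        \<open>P \<inter> K\<close>.\<close>
      have AR: "?A \<subseteq> R" by (rule com_subset_normal[OF nR G(1) M(4)])
      let ?H = "M \<inter> ?A"
      have H: "is_subgroup ?H" "?H \<subseteq> P" using is_subgroup_Int[OF M(1) com_subgroup] M(2) by auto
      have "\<not> P \<inter> ?A \<subseteq> K" by (rule not_sub[OF A subset_trans[OF AR RN] TA])
      then have "\<not> ?H \<subseteq> K" using AR by (auto simp: M_def)
      then have "?H * (P \<inter> K) = P" by (rule MK_P[OF H])
      then have "P \<subseteq> ?H * K" using set_times_mono2[of ?H ?H "P \<inter> K" K] by blast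
      then have "P \<inter> T \<subseteq> ?H * K \<inter> T" by blast
      then have "?H * K \<inter> T \<noteq> K" using PTK by blast
      then show False using IC_Pi_p_chief[OF mM ch] np by blast
    next
      assume n: "is_normal (M * K \<inter> T) G"
      note MK = idx_times_normal[OF M(1,3) nK]
      have "P \<subseteq> M * K" using MP set_times_mono2[of M M "P \<inter> K" K] by blast
      then have "M * K \<inter> T \<noteq> K" using PTK by blast
      then have "M * K \<inter> T = T" using chiefD(5)[OF ch n] MK(3) KT by blast
      then have "T \<subseteq> M * K" by blast
      then show False using pp_times_normal[OF M(1,3) pp_subgroup[OF M(1,2)] nK T'(1) KT] np by blast
    qed
  qed
qed

text \<open>\<open>E\<close> is taken maximal among the normal subgroups in \<open>K\<close> for
  which \<open>p * p\<close> divides the index of \<open>P \<inter> E\<close>, and \<open>J\<close>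
  minimal over it. Then \<open>P \<inter> J\<close> has index \<open>p\<close>, so it is
  \<open>P \<inter> K\<close>, while \<open>J / E\<close> falls under the case of large
  index.\<close>

lemma small_idx_chief:
  assumes ch: "chief G T K" and TN: "T \<subseteq> N" and pd: "p dvd idx T K" and ipK: "idx P (P \<inter> K) = p"
    and p2: "p * p dvd card P"
  shows "idx T K = p"
proof -
  note nT = chiefD(1)[OF ch] and nK = chiefD(2)[OF ch] and KT = chiefD(3)[OF ch]
  note T' = is_normalD[OF nT] and K' = is_normalD[OF nK]
  note PT = P_Int_subgroup[OF nT] and PK = P_Int_subgroup[OF nK]
  have KN: "K \<subseteq> N" using KT TN by blast
  let ?F = "{R. is_normal R G \<and> R \<subseteq> K \<and> p * p dvd idx P (P \<inter> R)}"
  have finF: "finite ?F" by (rule finite_subset[of _ "Pow K"]) (use fin[OF K'(2)] in auto)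
  have "P \<inter> {1} = {1}" using is_subgroupD(1)[OF PN(1)] by blast
  moreover have "is_normal {1} G" using G by (simp add: is_normal_def is_subgroup_def normalizes_def)
  \<comment> \<open>The bound on the order of \<open>P\<close> enters here: it makes the trivial
    subgroup a candidate for \<open>E\<close>.\<close>
  ultimately have oneF: "{1} \<in> ?F" using p2 is_subgroupD(1)[OF K'(1)] by (simp add: idx_def)
  obtain E where EF: "E \<in> ?F" and mxE: "\<forall>U\<in>?F. E \<subseteq> U \<longrightarrow> E = U"
    using finite_maximal_set[OF finF oneF] by (rule bexE)
  have E: "is_normal E G" "E \<subseteq> K" "p * p dvd idx P (P \<inter> E)" using EF by simp_all
  note E' = is_normalD[OF E(1)] and PE = P_Int_subgroup[OF E(1)]
  have EK: "E \<noteq> K" using E(3) ipK not_square_dvd_prime[OF p] by metis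
  let ?J = "{R. is_normal R G \<and> E \<subset> R \<and> R \<subseteq> K}"
  have finJ: "finite ?J" by (rule finite_subset[of _ "Pow K"]) (use fin[OF K'(2)] in auto)
  have "?J \<noteq> {}" using nK E(2) EK by auto
  then have "\<exists>J\<in>?J. \<forall>U\<in>?J. U \<le> J \<longrightarrow> J = U" by (rule finite_has_minimal[OF finJ])
  then obtain J where JF: "J \<in> ?J" and mnJ: "\<forall>U\<in>?J. U \<le> J \<longrightarrow> J = U" by (rule bexE)
  have J: "is_normal J G" "E \<subset> J" "J \<subseteq> K" using JF by simp_all
  note J' = is_normalD[OF J(1)] and PJ = P_Int_subgroup[OF J(1)]
  have EJ: "E \<subseteq> J" using J(2) by blast
  have chJ: "chief G J E"
    unfolding chief_def
  proof (intro conjI allI impI)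
    fix M assume M: "is_normal M G \<and> E \<subseteq> M \<and> M \<subseteq> J"
    show "M = E \<or> M = J"
    proof (rule ccontr)
      assume neq: "\<not> (M = E \<or> M = J)"
      then have "M \<in> ?J" using M J(3) by auto
      then show False using bspec[OF mnJ, of M] M neq by blast
    qed
  qed (use J E in auto)
  have JN: "J \<subseteq> N" using J(3) KN by blast
  have nJF: "\<not> p * p dvd idx P (P \<inter> J)"
  proof
    assume "p * p dvd idx P (P \<inter> J)"
    then have "J \<in> ?F" using J by simp
    then show False using bspec[OF mxE, of J] J(2) by blast
  qed
  have "idx P (P \<inter> J) = idx P (P \<inter> K) * idx (P \<inter> K) (P \<inter> J)"
    by (rule idx_mult[OF PJ PK PN(1) _ _ finP]) (use J(3) in auto)
  then have iPJ: "idx P (P \<inter> J) = p * idx (P \<inter> K) (P \<inter> J)" by (simp add: ipK)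
  have ipJ: "idx P (P \<inter> J) = p"
    by (rule prime_power_of_eq_prime[OF p pp_idx[OF PN(1) order_refl PJ] _ nJF]) (simp_all add: iPJ)
  then have "idx (P \<inter> K) (P \<inter> J) = 1" using iPJ p by (simp add: prime_gt_0_nat)
  then have PJK: "P \<inter> J = P \<inter> K"
    by (intro idx_eq_1[OF PJ PK]) (use J(3) finP in auto)
  have iPE: "idx P (P \<inter> E) = p * idx (P \<inter> J) (P \<inter> E)"
    using idx_mult[OF PE PJ PN(1) _ _ finP] EJ ipJ by auto
  then have "p * p dvd p * idx (P \<inter> J) (P \<inter> E)" using E(3) by simp
  then have pJE: "p dvd idx (P \<inter> J) (P \<inter> E)" using p by (simp add: prime_gt_0_nat)
  have PJG: "P \<inter> J \<subseteq> G" using PG by blast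
  note PJE = idx_times_normal[OF PJ PJG E(1)]
  have "(P \<inter> J) \<inter> E = P \<inter> E" using EJ by blast
  moreover have "idx ((P \<inter> J) * E) E dvd idx J E"
    by (rule idx_dvd_trans(2)[OF E'(1) PJE(1) J'(1) PJE(3) _ fin[OF J'(2)]]) (rule set_times_least[OF J'(1) _ EJ], blast)
  ultimately have dJE: "idx (P \<inter> J) (P \<inter> E) dvd idx J E" using PJE(5) by simp
  have ppJ: "prime_power_of p (idx J E)"
    by (rule large_idx_p_chief[OF chJ JN dvd_trans[OF pJE dJE] E(3)])
  have ipJE: "idx J E = p"
  \<comment> \<open>In the second case \<open>frattini_chief\<close> would be circular, since it
    needs the orders of the \<open>p\<close>-chief factors above \<open>J\<close>, among them
    \<open>T / K\<close>. Here \<open>P \<inter> J\<close> is maximal in \<open>P\<close>, so the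
    cyclic argument of \<open>frattini_case\<close> is available instead.\<close>
  proof (cases "\<exists>M. maxsub M P \<and> P \<inter> E \<subseteq> M \<and> \<not> P \<inter> J \<subseteq> M")
    case True
    then show ?thesis using supplement_case[OF chJ JN ppJ] by blast
  next
    case False
    then show ?thesis by (intro frattini_case[OF chJ JN ppJ _ ipJ]) blast
  qed
  have "idx (P \<inter> J) (P \<inter> E) = p" using pJE dJE ipJE dvd_antisym by simp
  then have "idx P (P \<inter> E) = p * p" using iPE by simp
  then have pp: "prime_power_of p (idx T K)"
    using two_step_p_chief[OF ch TN pd ipK J(1,3) E(1) EJ ipJE PJK] by blast
  have PTG: "P \<inter> T \<subseteq> G" using PG by blast
  have "idx T K = idx (P \<inter> T) ((P \<inter> T) \<inter> K)"
    using normal_eq_times[OF nT TN nK KT pp] idx_times_normal(5)[OF PT PTG nK] by simp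
  also have "(P \<inter> T) \<inter> K = P \<inter> K" using KT by blast
  finally have eq: "idx T K = idx (P \<inter> T) (P \<inter> K)" .
  have "idx (P \<inter> T) (P \<inter> K) dvd idx P (P \<inter> K)"
    by (rule idx_dvd_trans(2)[OF PK PT PN(1) _ _ finP]) (use KT in auto)
  then have "idx T K dvd p" using eq ipK by simp
  then show ?thesis using pd dvd_antisym by blast
qed

theorem p_chief_prime:
  assumes p2: "p * p dvd card P"
  shows "chief G T K \<Longrightarrow> T \<subseteq> N \<Longrightarrow> p dvd idx T K \<Longrightarrow> idx T K = p"
proof (induction "card N - card T" arbitrary: T K rule: less_induct)
  case (less T K)
  note ch = less.prems(1) and TN = less.prems(2) and pd = less.prems(3)
  note nT = chiefD(1)[OF ch] and nK = chiefD(2)[OF ch] and KT = chiefD(3)[OF ch]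
  note T' = is_normalD[OF nT] and K' = is_normalD[OF nK]
  note PK = P_Int_subgroup[OF nK]
  have finN: "finite N" using fin NG by blast
  have above: "idx L' K1 = p" if h: "chief G L' K1" "T \<subseteq> K1" "L' \<subseteq> N" "p dvd idx L' K1" for L' K1
  proof (rule less.hyps[OF _ h(1,3,4)])
    have "T \<subset> L'" using h(2) chiefD(3,4)[OF h(1)] by blast
    then have "card T < card L'" using psubset_card_mono finite_subset[OF h(3) finN] by blast
    moreover have "card L' \<le> card N" using card_mono[OF finN h(3)] .
    ultimately show "card N - card L' < card N - card T" by linarith
  qed
  have ppK: "prime_power_of p (idx P (P \<inter> K))" by (rule pp_idx[OF PN(1) order_refl PK]) blast
  have pK: "p dvd idx P (P \<inter> K)"
  proof (rule ccontr)
    assume "\<not> p dvd idx P (P \<inter> K)"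
    then have "idx P (P \<inter> K) = 1" using prime_power_of_eq_1[OF ppK] by blast
    then have "P \<inter> K = P" using idx_eq_1[OF PK PN(1) _ finP] by blast
    then show False using not_P_Int_subset[OF nT TN K'(1) KT pd] by blast
  qed
  show ?case
  proof (cases "p * p dvd idx P (P \<inter> K)")
    case False
    then have "idx P (P \<inter> K) = p" using prime_power_of_eq_prime[OF p ppK pK] by blast
    then show ?thesis using small_idx_chief[OF ch TN pd _ p2] by blast
  next
    case True
    have pp: "prime_power_of p (idx T K)" by (rule large_idx_p_chief[OF ch TN pd True])
    show ?thesis
    proof (cases "\<exists>M. maxsub M P \<and> P \<inter> K \<subseteq> M \<and> \<not> P \<inter> T \<subseteq> M")
      case True
      then show ?thesis using supplement_case[OF ch TN pp] by blast
    next
      case False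
      show ?thesis by (rule frattini_chief[OF ch TN pp above]) (use False in blast)+
    qed
  qed
qed

end

section \<open>Quotients and the Cayley embedding\<close>

lemma (in group) prime_order_cyclic:
  assumes "prime (order G)"
  shows "cyclic_group G"
proof -
  have fin: "finite (carrier G)" by (rule order_gt_0_iff_finite[THEN iffD1, OF prime_gt_0_nat[OF assms]])
  have "carrier G \<noteq> {\<one>}" using assms by (auto simp: order_def)
  then obtain x where x: "x \<in> carrier G" "x \<noteq> \<one>" by blast
  have s: "subgroup (generate G {x}) G" using x generate_is_subgroup by blast
  have "card (generate G {x}) dvd order G" using lagrange[OF s] by (metis dvd_triv_right)
  moreover have "card (generate G {x}) \<noteq> 1"
  proof
    assume "card (generate G {x}) = 1"
    then obtain z where "generate G {x} = {z}" by (auto simp: card_1_singleton_iff)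
    moreover have "x \<in> generate G {x}" "\<one> \<in> generate G {x}" by (auto intro: generate.intros)
    ultimately show False using x by auto
  qed
  ultimately have "card (generate G {x}) = order G" using assms by (metis prime_nat_iff)
  then have "generate G {x} = carrier G"
    using fin generate_incl[of "{x}"] x by (intro card_subset_eq) (auto simp: order_def)
  then show ?thesis unfolding cyclic_group using x generate_pow[OF x(1)] by (auto simp: full_SetCompr_eq)
qed

lemma carrier_quot: "carrier (quot G B K) = (\<lambda>x. K #>\<^bsub>G\<^esub> x) ` B"
  by (auto simp: FactGroup_def RCOSETS_def r_coset_def)

lemma (in group) card_quot:
  assumes "subgroup B G" "K \<lhd> G" "K \<subseteq> B"
  shows "card (carrier (quot G B K)) * card K = card B"
proof -
  interpret B: group "G\<lparr>carrier := B\<rparr>" using assms subgroup_imp_group by blast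
  have "subgroup K (G\<lparr>carrier := B\<rparr>)"
    using subgroup_incl assms normal_imp_subgroup by blast
  then have "card (rcosets\<^bsub>G\<lparr>carrier := B\<rparr>\<^esub> K) * card K = order (G\<lparr>carrier := B\<rparr>)" by (rule B.lagrange)
  then show ?thesis by (simp add: FactGroup_def order_def)
qed

text \<open>Correspondence under the quotient map. \<open>Nz\<close> is given by a one-sided
  inclusion; being a subgroup, it is closed under inverses, which supplies the reverse
  inclusion.\<close>

lemma (in group) quotient_normalizer:
  assumes K: "K \<lhd> G" and B: "subgroup B G" "K \<subseteq> B" and A: "A = (\<lambda>x. K #> x) ` B"
    and Nz: "Nz = {g \<in> carrier G. \<forall>b\<in>B. g \<otimes> b \<otimes> inv g \<in> B}" "subgroup Nz G"
  shows "normalizer (G Mod K) A = (\<lambda>x. K #> x) ` Nz"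
proof -
  interpret K: normal K G by fact
  interpret Q: group "G Mod K" by (rule K.factorgroup_is_group)
  have BG: "B \<subseteq> carrier G" using subgroup.subset[OF B(1)] .
  have carr: "carrier (G Mod K) = (\<lambda>x. K #> x) ` carrier G" by (rule carrier_FactGroup)
  have AQ: "A \<subseteq> carrier (G Mod K)" using A BG carr by auto
  have conj: "(K #> g) <#\<^bsub>G Mod K\<^esub> A #>\<^bsub>G Mod K\<^esub> (inv\<^bsub>G Mod K\<^esub> (K #> g)) = (\<lambda>b. K #> (g \<otimes> b \<otimes> inv g)) ` B"
    if g: "g \<in> carrier G" for g
  proof -
    have "inv\<^bsub>G Mod K\<^esub> (K #> g) = K #> inv g"
      using K.inv_FactGroup[of "K #> g"] K.rcos_inv[OF g] g by (auto simp: carr)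
    then have "(K #> g) <#\<^bsub>G Mod K\<^esub> A #>\<^bsub>G Mod K\<^esub> (inv\<^bsub>G Mod K\<^esub> (K #> g)) =
        (\<lambda>b. ((K #> g) <#> (K #> b)) <#> (K #> inv g)) ` B"
      by (auto simp: A l_coset_def r_coset_def[of "G Mod K"])
    also have "\<dots> = (\<lambda>b. K #> (g \<otimes> b \<otimes> inv g)) ` B"
      using g BG by (intro image_cong refl) (auto simp: K.rcos_sum subset_eq)
    finally show ?thesis .
  qed
  have mem: "x \<in> B" if x: "x \<in> carrier G" "K #> x \<in> A" for x
  proof -
    obtain b where b: "b \<in> B" "K #> x = K #> b" using x by (auto simp: A)
    have "x \<in> K #> x" by (rule rcos_self[OF x(1) normal_imp_subgroup[OF K]])
    then have "x \<in> K #> b" by (simp only: b(2))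
    then obtain k where "k \<in> K" "x = k \<otimes> b" by (auto simp: r_coset_def)
    then show ?thesis using subgroup.m_closed[OF B(1)] b(1) B(2) by auto
  qed
  have iff: "(\<lambda>b. K #> (g \<otimes> b \<otimes> inv g)) ` B = A \<longleftrightarrow> g \<in> Nz" if g: "g \<in> carrier G" for g
  proof
    assume eq: "(\<lambda>b. K #> (g \<otimes> b \<otimes> inv g)) ` B = A"
    have "g \<otimes> b \<otimes> inv g \<in> B" if b: "b \<in> B" for b
    proof (rule mem)
      show "g \<otimes> b \<otimes> inv g \<in> carrier G" using b g BG by auto
      show "K #> (g \<otimes> b \<otimes> inv g) \<in> A" unfolding eq[symmetric] by (rule imageI[OF b])
    qed
    then show "g \<in> Nz" using g by (simp add: Nz)
  next
    assume gN: "g \<in> Nz"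
    then have iN: "inv g \<in> Nz" by (rule subgroup.m_inv_closed[OF Nz(2)])
    show "(\<lambda>b. K #> (g \<otimes> b \<otimes> inv g)) ` B = A"
    proof
      show "(\<lambda>b. K #> (g \<otimes> b \<otimes> inv g)) ` B \<subseteq> A" using gN by (auto simp: A Nz)
      show "A \<subseteq> (\<lambda>b. K #> (g \<otimes> b \<otimes> inv g)) ` B"
      proof
        fix c assume "c \<in> A"
        then obtain b where b: "b \<in> B" "c = K #> b" by (auto simp: A)
        have bG: "b \<in> carrier G" using b BG by blast
        have iB: "inv g \<otimes> b \<otimes> inv (inv g) \<in> B" using iN b by (simp add: Nz)
        have "g \<otimes> (inv g \<otimes> b \<otimes> inv (inv g)) \<otimes> inv g = b"
          using g bG by (simp add: m_assoc) (simp flip: m_assoc)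
        then have "c = K #> (g \<otimes> (inv g \<otimes> b \<otimes> inv (inv g)) \<otimes> inv g)" using b(2) by simp
        then show "c \<in> (\<lambda>b. K #> (g \<otimes> b \<otimes> inv g)) ` B" by (rule image_eqI[OF _ iB])
      qed
    qed
  qed
  have "c \<in> normalizer (G Mod K) A \<longleftrightarrow> (\<exists>g\<in>carrier G. c = K #> g \<and> g \<in> Nz)" for c
  proof -
    have "c \<in> normalizer (G Mod K) A \<longleftrightarrow>
        c \<in> carrier (G Mod K) \<and> c <#\<^bsub>G Mod K\<^esub> A #>\<^bsub>G Mod K\<^esub> (inv\<^bsub>G Mod K\<^esub> c) = A"
      using AQ by (simp add: normalizer_def stabilizer_def)
    also have "\<dots> \<longleftrightarrow> (\<exists>g\<in>carrier G. c = K #> g \<and>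
        (K #> g) <#\<^bsub>G Mod K\<^esub> A #>\<^bsub>G Mod K\<^esub> (inv\<^bsub>G Mod K\<^esub> (K #> g)) = A)"
      by (auto simp: carr)
    also have "\<dots> \<longleftrightarrow> (\<exists>g\<in>carrier G. c = K #> g \<and> g \<in> Nz)"
      by (intro bex_cong refl) (simp only: conj iff)
    finally show ?thesis .
  qed
  moreover have "Nz \<subseteq> carrier G" using Nz by auto
  ultimately show ?thesis by auto
qed

text \<open>\<open>K\<close> lies in \<open>Nz\<close>, so passing to the quotient divides the
  orders of both \<open>Nz\<close> and \<open>G\<close> by \<open>card K\<close>, and the index is
  unchanged.\<close>

lemma (in group) quotient_normalizer_index:
  assumes fin: "finite (carrier G)" and K: "K \<lhd> G" and B: "subgroup B G" "K \<subseteq> B" and A: "A = (\<lambda>x. K #> x) ` B"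
    and Nz: "Nz = {g \<in> carrier G. \<forall>b\<in>B. g \<otimes> b \<otimes> inv g \<in> B}" "subgroup Nz G"
  shows "subgroup_index (G Mod K) (normalizer (G Mod K) A) = card (carrier G) div card Nz"
proof -
  interpret K: normal K G by fact
  interpret Q: group "G Mod K" by (rule K.factorgroup_is_group)
  have BG: "B \<subseteq> carrier G" using subgroup.subset[OF B(1)] .
  have KNz: "K \<subseteq> Nz"
  proof
    fix k assume k: "k \<in> K"
    then have kB: "k \<in> B" using B by blast
    have "k \<otimes> b \<otimes> inv k \<in> B" if "b \<in> B" for b
      by (rule subgroup.m_closed[OF B(1) subgroup.m_closed[OF B(1) kB that] subgroup.m_inv_closed[OF B(1) kB]])
    then show "k \<in> Nz" using kB BG by (auto simp: Nz(1))
  qed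
  have N: "normalizer (G Mod K) A = (\<lambda>x. K #> x) ` Nz" by (rule quotient_normalizer[OF K B A Nz])
  have carr: "carrier (G Mod K) = (\<lambda>x. K #> x) ` carrier G" by (rule carrier_FactGroup)
  have G: "subgroup (carrier G) G" by (rule subgroup_self)
  have c1: "card (normalizer (G Mod K) A) * card K = card Nz"
    using card_quot[OF Nz(2) K KNz] by (simp add: N carrier_quot)
  have c2: "card (carrier (G Mod K)) * card K = card (carrier G)"
    using card_quot[OF G K K.subset] by (simp add: carr carrier_quot)
  have sub: "subgroup (normalizer (G Mod K) A) (G Mod K)"
    by (rule Q.normalizer_imp_subgroup) (use A BG carr in auto)
  have c3: "card (rcosets\<^bsub>G Mod K\<^esub> (normalizer (G Mod K) A)) * card (normalizer (G Mod K) A) = card (carrier (G Mod K))"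
    using Q.lagrange[OF sub] by (simp add: order_def)
  have "card (carrier G) = subgroup_index (G Mod K) (normalizer (G Mod K) A) * card Nz"
    using c1 c2 c3 by (metis mult.assoc subgroup_index_def)
  moreover have "card Nz > 0"
    using Nz fin subgroup.one_closed[OF Nz(2)] by (auto simp: card_gt_0_iff intro: finite_subset)
  ultimately show ?thesis by simp
qed

section \<open>Cayley's theorem\<close>

typedef 'a symmetric = "{f :: 'a \<Rightarrow> 'a. bij f}"
  by (rule exI[of _ id]) simp

setup_lifting type_definition_symmetric

instantiation symmetric :: (type) group_mult
begin

lift_definition one_symmetric :: "'a symmetric" is id by simp
lift_definition times_symmetric :: "'a symmetric \<Rightarrow> 'a symmetric \<Rightarrow> 'a symmetric" is "(\<circ>)" by (rule bij_comp)
lift_definition inverse_symmetric :: "'a symmetric \<Rightarrow> 'a symmetric" is "inv_into UNIV" by (rule bij_imp_bij_inv)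
definition divide_symmetric :: "'a symmetric \<Rightarrow> 'a symmetric \<Rightarrow> 'a symmetric"
  where "divide_symmetric x y = x * inverse y"

instance
proof
  fix a b c :: "'a symmetric"
  show "a * b * c = a * (b * c)" by transfer (simp add: comp_assoc)
  show "1 * a = a" "a * 1 = a" by (transfer, simp)+
  show "inverse a * a = 1" by transfer (simp add: bij_is_inj)
qed

end

lemma (in group) cayley_embedding:
  "\<exists>e :: 'a \<Rightarrow> 'a symmetric. inj_on e (carrier G) \<and> (\<forall>x\<in>carrier G. \<forall>y\<in>carrier G. e (x \<otimes> y) = e x * e y)"
proof -
  \<comment> \<open>Left multiplication is extended by the identity outside the carrier, so that it
    becomes a permutation of the whole type.\<close>
  define act where "act x y = (if y \<in> carrier G then x \<otimes> y else y)" for x y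
  have comp: "act (x \<otimes> y) = act x \<circ> act y" if "x \<in> carrier G" "y \<in> carrier G" for x y
    using that by (auto simp: act_def fun_eq_iff m_assoc)
  have one: "act \<one> = id" by (auto simp: act_def fun_eq_iff)
  have bij: "bij (act x)" if x: "x \<in> carrier G" for x
    by (rule o_bij[of "act (inv x)"]) (use x comp[of "inv x" x] comp[of x "inv x"] one in simp_all)
  have "inj_on (\<lambda>x. Abs_symmetric (act x)) (carrier G)"
  proof (rule inj_onI)
    fix x y assume xy: "x \<in> carrier G" "y \<in> carrier G" "Abs_symmetric (act x) = Abs_symmetric (act y)"
    then have "act x = act y" using bij by (simp add: Abs_symmetric_inject)
    then have "act x \<one> = act y \<one>" by simp
    then show "x = y" using xy by (simp add: act_def)
  qed
  moreover have "Abs_symmetric (act (x \<otimes> y)) = Abs_symmetric (act x) * Abs_symmetric (act y)"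
    if "x \<in> carrier G" "y \<in> carrier G" for x y
    using that bij by (simp add: comp times_symmetric.abs_eq eq_onp_def)
  ultimately show ?thesis by blast
qed

section \<open>Translation of the notions along an embedding into a group type\<close>

locale group_embedding = group G for G :: "('a, 'b) monoid_scheme" (structure) +
  fixes e :: "'a \<Rightarrow> 'g::group_mult"
  assumes inj: "inj_on e (carrier G)"
    and hom: "\<And>x y. x \<in> carrier G \<Longrightarrow> y \<in> carrier G \<Longrightarrow> e (x \<otimes> y) = e x * e y"
begin

lemma e_one: "e \<one> = 1"
proof -
  have "e \<one> * e \<one> = e \<one> * 1" using hom[of \<one> \<one>] by simp
  then show ?thesis by (simp only: group_left_cancel)
qed

lemma e_inv: "x \<in> carrier G \<Longrightarrow> e (inv x) = inverse (e x)"
proof -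
  assume x: "x \<in> carrier G"
  have "e x * e (inv x) = e x * inverse (e x)" using hom[of x "inv x"] x by (simp add: e_one)
  then show ?thesis by (simp only: group_left_cancel)
qed

lemma e_mem: "A \<subseteq> carrier G \<Longrightarrow> x \<in> carrier G \<Longrightarrow> e x \<in> e ` A \<longleftrightarrow> x \<in> A"
  using inj by (meson inj_on_image_mem_iff)

lemma e_subset: "A \<subseteq> carrier G \<Longrightarrow> B \<subseteq> carrier G \<Longrightarrow> e ` A \<subseteq> e ` B \<longleftrightarrow> A \<subseteq> B"
  using e_mem by blast

lemma e_eq: "A \<subseteq> carrier G \<Longrightarrow> B \<subseteq> carrier G \<Longrightarrow> e ` A = e ` B \<longleftrightarrow> A = B"
  using inj by (meson inj_on_image_eq_iff)

lemma e_card: "A \<subseteq> carrier G \<Longrightarrow> card (e ` A) = card A"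
  by (meson card_image inj inj_on_subset)

lemma e_Int: "A \<subseteq> carrier G \<Longrightarrow> B \<subseteq> carrier G \<Longrightarrow> e ` (A \<inter> B) = e ` A \<inter> e ` B"
  by (rule inj_on_image_Int[OF inj])

lemma subgroup_iff:
  assumes A: "A \<subseteq> carrier G"
  shows "subgroup A G \<longleftrightarrow> is_subgroup (e ` A)"
proof
  assume s: "subgroup A G"
  show "is_subgroup (e ` A)"
    unfolding is_subgroup_def
  proof (intro conjI ballI)
    show "1 \<in> e ` A" using subgroup.one_closed[OF s] e_one by (metis imageI)
    fix x assume "x \<in> e ` A"
    then obtain a where a: "a \<in> A" "x = e a" by blast
    show "inverse x \<in> e ` A"
      using subgroup.m_inv_closed[OF s a(1)] e_inv[of a] a A by (metis imageI subsetD)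
    fix y assume "y \<in> e ` A"
    then obtain b where b: "b \<in> A" "y = e b" by blast
    show "x * y \<in> e ` A"
      using subgroup.m_closed[OF s a(1) b(1)] hom[of a b] a b A by (metis imageI subsetD)
  qed
next
  assume s: "is_subgroup (e ` A)"
  show "subgroup A G"
  proof (rule subgroup.intro[OF A])
    fix x y assume xy: "x \<in> A" "y \<in> A"
    then have "e x * e y \<in> e ` A" using is_subgroupD(2)[OF s] by blast
    then have "e (x \<otimes> y) \<in> e ` A" using hom[of x y] xy A by (metis subsetD)
    moreover have "x \<otimes> y \<in> carrier G" using xy A by auto
    ultimately show "x \<otimes> y \<in> A" using e_mem[OF A] by simp
  next
    show "\<one> \<in> A" using is_subgroupD(1)[OF s] e_mem[OF A one_closed] by (simp add: e_one)
  next
    fix x assume x: "x \<in> A"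
    then have "inverse (e x) \<in> e ` A" using is_subgroupD(3)[OF s] by blast
    then have "e (inv x) \<in> e ` A" using e_inv[of x] x A by (metis subsetD)
    moreover have "inv x \<in> carrier G" using x A by auto
    ultimately show "inv x \<in> A" using e_mem[OF A] by simp
  qed
qed

lemma e_conj: "g \<in> carrier G \<Longrightarrow> b \<in> carrier G \<Longrightarrow> e (g \<otimes> b \<otimes> inv g) = e g * e b * inverse (e g)"
  by (simp add: hom e_inv)

lemma normal_iff:
  assumes A: "A \<subseteq> carrier G"
  shows "A \<lhd> G \<longleftrightarrow> is_normal (e ` A) (e ` carrier G)"
proof -
  have "e g * e a * inverse (e g) \<in> e ` A \<longleftrightarrow> g \<otimes> a \<otimes> inv g \<in> A" if "g \<in> carrier G" "a \<in> A" for g a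
    using e_mem[OF A, of "g \<otimes> a \<otimes> inv g"] that A by (auto simp: e_conj subset_eq)
  then show ?thesis
    using subgroup_iff[OF A] A by (auto simp: normal_inv_iff is_normal_def normalizes_def)
qed

lemma image_preimage: "B \<subseteq> e ` carrier G \<Longrightarrow> \<exists>A\<subseteq>carrier G. B = e ` A"
  by (simp add: subset_image_iff)

lemma is_subgroup_carrier: "is_subgroup (e ` carrier G)"
  using subgroup_iff[of "carrier G"] subgroup_self by blast

lemma chief_iff:
  assumes L: "L \<subseteq> carrier G" and K: "K \<subseteq> carrier G"
  shows "chief_factor G L K \<longleftrightarrow> chief (e ` carrier G) (e ` L) (e ` K)"
proof -
  have ps: "K \<subset> L \<longleftrightarrow> e ` K \<subset> e ` L" using e_subset[OF K L] e_eq[OF K L] by (simp add: psubset_eq)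
  have "(\<forall>M. M \<lhd> G \<and> K \<subseteq> M \<and> M \<subseteq> L \<longrightarrow> M = K \<or> M = L) \<longleftrightarrow>
    (\<forall>M. is_normal M (e ` carrier G) \<and> e ` K \<subseteq> M \<and> M \<subseteq> e ` L \<longrightarrow> M = e ` K \<or> M = e ` L)" (is "?l \<longleftrightarrow> ?r")
  proof
    assume l: ?l
    show ?r
    proof (intro allI impI)
      fix M assume M: "is_normal M (e ` carrier G) \<and> e ` K \<subseteq> M \<and> M \<subseteq> e ` L"
      then have "M \<subseteq> e ` carrier G" using is_normalD(2)[of M] by simp
      then obtain A where A: "A \<subseteq> carrier G" "M = e ` A" using image_preimage[of M] by auto
      then have "A \<lhd> G \<and> K \<subseteq> A \<and> A \<subseteq> L" using M normal_iff[OF A(1)] e_subset K L by simp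
      then show "M = e ` K \<or> M = e ` L" using l A(2) by blast
    qed
  next
    assume r: ?r
    show ?l
    proof (intro allI impI)
      fix M assume M: "M \<lhd> G \<and> K \<subseteq> M \<and> M \<subseteq> L"
      then have MG: "M \<subseteq> carrier G" using L by blast
      then have "is_normal (e ` M) (e ` carrier G) \<and> e ` K \<subseteq> e ` M \<and> e ` M \<subseteq> e ` L"
        using M normal_iff[OF MG] by blast
      then have "e ` M = e ` K \<or> e ` M = e ` L" using r by blast
      then show "M = K \<or> M = L" using e_eq MG K L by blast
    qed
  qed
  then show ?thesis unfolding chief_factor_def chief_def using normal_iff[OF L] normal_iff[OF K] ps by simp
qed

lemma maximal_subgroup_if_maxsub:
  assumes P: "subgroup P G" and M: "M \<subseteq> carrier G" and mx: "maxsub (e ` M) (e ` P)"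
  shows "maximal_subgroup M (G\<lparr>carrier := P\<rparr>)"
proof -
  note mx' = maxsubD[OF mx]
  have PG: "P \<subseteq> carrier G" using subgroup.subset[OF P] .
  have MP: "M \<subseteq> P" using mx'(2) e_subset[OF M PG] by blast
  have sM: "subgroup M G" using mx'(1) subgroup_iff[OF M] by blast
  have "K = M \<or> K = P" if K: "subgroup K (G\<lparr>carrier := P\<rparr>)" "M \<subseteq> K" for K
  proof -
    have sK: "subgroup K G" using incl_subgroup[OF P K(1)] .
    have KP: "K \<subseteq> P" using subgroup.subset[OF K(1)] by simp
    have KG: "K \<subseteq> carrier G" using KP PG by blast
    have "is_subgroup (e ` K)" using sK subgroup_iff[OF KG] by simp
    then have "e ` K = e ` M \<or> e ` K = e ` P"
      by (rule mx'(4)[OF _ image_mono[OF K(2)] image_mono[OF KP]])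
    then show ?thesis using e_eq KG M PG by blast
  qed
  moreover have "M \<noteq> P" using mx'(3) by blast
  ultimately show ?thesis
    unfolding maximal_subgroup_def using subgroup_incl[OF sM P MP] by simp
qed

lemma com_image:
  assumes M: "M \<subseteq> carrier G"
  shows "com (e ` M) (e ` carrier G) = e ` commutator_subgroup G M (carrier G)"
    and "commutator_subgroup G M (carrier G) \<subseteq> carrier G"
proof -
  let ?S = "{inv h \<otimes> inv g \<otimes> h \<otimes> g | h g. h \<in> M \<and> g \<in> carrier G}"
  let ?C = "commutator_subgroup G M (carrier G)"
  have C: "?C = generate G ?S" by (simp add: commutator_subgroup_def)
  have S: "?S \<subseteq> carrier G" using M by auto
  have sC: "subgroup ?C G" unfolding C using generate_is_subgroup[OF S] .
  show CG: "?C \<subseteq> carrier G" using subgroup.subset[OF sC] .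
  have ec: "e (inv h \<otimes> inv g \<otimes> h \<otimes> g) = inverse (e h) * inverse (e g) * e h * e g"
    if "h \<in> carrier G" "g \<in> carrier G" for h g
    using that by (simp add: hom e_inv)
  show "com (e ` M) (e ` carrier G) = e ` ?C"
  proof
    show "com (e ` M) (e ` carrier G) \<subseteq> e ` ?C"
    proof (rule com_least)
      show "is_subgroup (e ` ?C)" using sC subgroup_iff[OF CG] by blast
      fix m g assume "m \<in> e ` M" "g \<in> e ` carrier G"
      then obtain h k where hk: "h \<in> M" "k \<in> carrier G" "m = e h" "g = e k" by blast
      then have "inv h \<otimes> inv k \<otimes> h \<otimes> k \<in> ?C" unfolding C by (intro generate.incl) blast
      then show "inverse m * inverse g * m * g \<in> e ` ?C" using ec[of h k] hk M by (metis imageI subsetD)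
    qed
    have "com (e ` M) (e ` carrier G) \<subseteq> e ` carrier G"
    proof (rule com_least[OF is_subgroup_carrier])
      fix m g assume "m \<in> e ` M" "g \<in> e ` carrier G"
      then have "m \<in> e ` carrier G" "g \<in> e ` carrier G" using M by auto
      then show "inverse m * inverse g * m * g \<in> e ` carrier G"
        using is_subgroupD[OF is_subgroup_carrier] by simp
    qed
    then obtain A where A: "A \<subseteq> carrier G" "com (e ` M) (e ` carrier G) = e ` A"
      using image_preimage[of "com (e ` M) (e ` carrier G)"] by auto
    have sA: "subgroup A G" using subgroup_iff[OF A(1)] com_subgroup[of "e ` M" "e ` carrier G"] A(2) by simp
    have "?S \<subseteq> A"
    proof clarify
      fix h g assume hg: "h \<in> M" "g \<in> carrier G"
      have "e (inv h \<otimes> inv g \<otimes> h \<otimes> g) \<in> e ` A"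
        using com_gen[of "e h" "e ` M" "e g" "e ` carrier G"] hg M ec[of h g] A(2) by auto
      moreover have "inv h \<otimes> inv g \<otimes> h \<otimes> g \<in> carrier G" using hg M by auto
      ultimately show "inv h \<otimes> inv g \<otimes> h \<otimes> g \<in> A" using e_mem[OF A(1)] by simp
    qed
    then have "?C \<subseteq> A" unfolding C using generate_subgroup_incl[OF _ sA] by blast
    then show "e ` ?C \<subseteq> com (e ` M) (e ` carrier G)" using A(2) by blast
  qed
qed

lemma set_mult_image: "A \<subseteq> carrier G \<Longrightarrow> B \<subseteq> carrier G \<Longrightarrow> e ` (A <#> B) = e ` A * e ` B"
proof -
  assume A: "A \<subseteq> carrier G" and B: "B \<subseteq> carrier G"
  have "x \<in> e ` (A <#> B) \<longleftrightarrow> (\<exists>a\<in>A. \<exists>b\<in>B. x = e (a \<otimes> b))" for x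
    by (auto simp: set_mult_def)
  also have "(\<exists>a\<in>A. \<exists>b\<in>B. x = e (a \<otimes> b)) \<longleftrightarrow> (\<exists>a\<in>A. \<exists>b\<in>B. x = e a * e b)" for x
    using A B hom by (intro bex_cong refl) (simp add: subset_eq)
  also have "(\<exists>a\<in>A. \<exists>b\<in>B. x = e a * e b) \<longleftrightarrow> x \<in> e ` A * e ` B" for x
    by (simp add: set_times_mem)
  finally show ?thesis by blast
qed

text \<open>For a finite set, one-sided invariance under conjugation is equality, by counting; this
  reconciles the two descriptions of the normalizer.\<close>

lemma normalizer_image:
  assumes fin: "finite (carrier G)" and B: "B \<subseteq> carrier G"
  shows "normalizer_in (e ` carrier G) (e ` B) = e ` {g \<in> carrier G. \<forall>b\<in>B. g \<otimes> b \<otimes> inv g \<in> B}"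
proof -
  have "conjugate (e g) (e ` B) = e ` B \<longleftrightarrow> (\<forall>b\<in>B. g \<otimes> b \<otimes> inv g \<in> B)" if g: "g \<in> carrier G" for g
  proof -
    have "e g * e b * inverse (e g) \<in> e ` B \<longleftrightarrow> g \<otimes> b \<otimes> inv g \<in> B" if "b \<in> B" for b
      using e_mem[OF B, of "g \<otimes> b \<otimes> inv g"] that B g by (auto simp: e_conj subset_eq)
    then have "conjugate (e g) (e ` B) \<subseteq> e ` B \<longleftrightarrow> (\<forall>b\<in>B. g \<otimes> b \<otimes> inv g \<in> B)"
      by (simp add: conjugate_def image_subset_iff)
    moreover have "finite (e ` B)" using fin B finite_subset by blast
    then have "conjugate (e g) (e ` B) \<subseteq> e ` B \<longleftrightarrow> conjugate (e g) (e ` B) = e ` B"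
      using card_subset_eq[of "e ` B" "conjugate (e g) (e ` B)"] by auto
    ultimately show ?thesis by blast
  qed
  then show ?thesis by (auto simp: normalizer_in_def)
qed

text \<open>The set \<open>A\<close> of the \<Pi>-property is the image of
  \<open>B = H K \<inter> L\<close> and its order divides \<open>card H\<close>, so only
  \<open>p\<close> may divide the index. If \<open>A\<close> is trivial, no prime is allowed and the
  index is 1, again a power of \<open>p\<close>.\<close>

lemma Pi_property_prime_power:
  assumes fin: "finite (carrier G)" and p: "prime p" and Pi: "Pi_property G H" and H: "subgroup H G" "prime_power_of p (card H)"
    and ch: "chief_factor G L K"
  shows "prime_power_of p (idx (e ` carrier G) (normalizer_in (e ` carrier G) (e ` H * e ` K \<inter> e ` L)))"
proof -
  have K: "K \<lhd> G" and L: "L \<lhd> G" and KL: "K \<subseteq> L" using ch by (auto simp: chief_factor_def)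
  have HG: "H \<subseteq> carrier G" and KG: "K \<subseteq> carrier G" and LG: "L \<subseteq> carrier G"
    using subgroup.subset H normal_imp_subgroup K L by blast+
  have finG: "finite (e ` carrier G)" using fin by blast
  have eH: "is_subgroup (e ` H)" "e ` H \<subseteq> e ` carrier G" using H subgroup_iff[OF HG] HG by blast+
  have eK: "is_normal (e ` K) (e ` carrier G)" and eL: "is_normal (e ` L) (e ` carrier G)"
    using K L normal_iff KG LG by blast+
  note eK' = is_normalD[OF eK] and eL' = is_normalD[OF eL]
  have HKG: "H <#> K \<subseteq> carrier G" using HG KG by (auto simp: set_mult_def)
  define B where "B = (H <#> K) \<inter> L"
  have BG: "B \<subseteq> carrier G" using LG by (auto simp: B_def)
  have eB: "e ` B = e ` H * e ` K \<inter> e ` L"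
    unfolding B_def using e_Int[OF HKG LG] set_mult_image[OF HG KG] by simp
  have sHK: "is_subgroup (e ` H * e ` K)" using is_subgroup_times_normal[OF eH eK] .
  have seB: "is_subgroup (e ` B)" unfolding eB by (rule is_subgroup_Int[OF sHK eL'(1)])
  have sB: "subgroup B G" using subgroup_iff[OF BG] seB by blast
  have eKB: "e ` K \<subseteq> e ` B"
    unfolding eB using set_times_superset2[OF eH(1), of "e ` K"] KL by blast
  have KB: "K \<subseteq> B" using eKB e_subset[OF KG BG] by blast
  have KHK: "K \<subseteq> H <#> K" using KB by (auto simp: B_def)
  have sHK': "subgroup (H <#> K) G" using subgroup_iff[OF HKG] sHK set_mult_image[OF HG KG] by simp
  have finHK: "finite (e ` H * e ` K)"
    using set_times_least[OF is_subgroup_carrier eH(2) eK'(2)] finG finite_subset by blast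
  have "idx (e ` B) (e ` K) dvd idx (e ` H * e ` K) (e ` K)"
    by (rule idx_dvd_trans(2)[OF eK'(1) seB sHK eKB _ finHK]) (auto simp: eB)
  also have "\<dots> = idx (e ` H) (e ` H \<inter> e ` K)"
    using idx_times[OF eH(1) eK'(1)] eH(2) eK'(2) finG finite_subset by blast
  also have "\<dots> dvd card (e ` H)"
    using lagrange_idx[of "e ` H \<inter> e ` K" "e ` H"] is_subgroup_Int[OF eH(1) eK'(1)] eH finite_subset[OF eH(2) finG]
    by (metis dvd_triv_left inf_le1)
  finally have ppB: "prime_power_of p (idx (e ` B) (e ` K))"
    using prime_power_of_dvd[OF p H(2)] e_card[OF HG] by simp
  let ?A = "carrier (quot G (H <#> K) K) \<inter> carrier (quot G L K)"
  have A: "?A = (\<lambda>x. K #> x) ` B"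
  proof
    show "(\<lambda>x. K #> x) ` B \<subseteq> ?A" by (auto simp: carrier_quot B_def)
    show "?A \<subseteq> (\<lambda>x. K #> x) ` B"
    proof
      fix c assume "c \<in> ?A"
      \<comment> \<open>A coset in both carriers comes with two representatives; since
        \<open>K \<subseteq> L\<close>, the one from \<open>H K\<close> lies in \<open>L\<close> as
        well.\<close>
      then obtain x y where xy: "x \<in> H <#> K" "y \<in> L" "c = K #> x" "c = K #> y" by (auto simp: carrier_quot)
      have "x \<in> K #> x" by (rule rcos_self[OF subsetD[OF HKG xy(1)] normal_imp_subgroup[OF K]])
      then have "x \<in> K #> y" using xy(3,4) by simp
      then obtain k where "k \<in> K" "x = k \<otimes> y" by (auto simp: r_coset_def)
      then have "x \<in> L" using xy(2) KL subgroup.m_closed[OF normal_imp_subgroup[OF L]] by blast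
      then show "c \<in> (\<lambda>x. K #> x) ` B" using xy by (auto simp: B_def)
    qed
  qed
  have "card ((\<lambda>x. K #> x) ` B) * card K = card B" using card_quot[OF sB K KB] by (simp only: carrier_quot)
  then have "card ?A * card K = card B" by (simp only: A)
  moreover have "card K > 0"
    using card_subgroup_pos[OF eK'(1)] e_card[OF KG] finite_subset[OF eK'(2) finG] by simp
  ultimately have cA: "card ?A = idx (e ` B) (e ` K)"
    using e_card[OF KG] e_card[OF BG] by (metis idx_def nonzero_mult_div_cancel_right not_gr_zero)
  define Nz where "Nz = {g \<in> carrier G. \<forall>b\<in>B. g \<otimes> b \<otimes> inv g \<in> B}"
  have NzG: "Nz \<subseteq> carrier G" by (auto simp: Nz_def)
  have eN: "normalizer_in (e ` carrier G) (e ` B) = e ` Nz" unfolding Nz_def by (rule normalizer_image[OF fin BG])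
  have sN: "subgroup Nz G"
    using subgroup_iff[OF NzG] is_subgroup_normalizer_in[OF is_subgroup_carrier, of "e ` B"] eN by simp
  have ix: "subgroup_index (G Mod K) (normalizer (G Mod K) ?A) = idx (e ` carrier G) (e ` Nz)"
    using quotient_normalizer_index[OF fin K sB KB A Nz_def sN] e_card[OF NzG] e_card[OF subset_refl]
    by (simp add: idx_def)
  have "pi_number (prime_divisors_card ?A) (subgroup_index (G Mod K) (normalizer (G Mod K) ?A))"
    using Pi ch by (auto simp: Pi_property_def Let_def)
  then have pin: "pi_number (prime_divisors_card ?A) (idx (e ` carrier G) (e ` Nz))" by (simp only: ix)
  have "prime_power_of p (idx (e ` carrier G) (e ` Nz))"
  proof (rule prime_power_ofI[OF _ _ p])
    show "idx (e ` carrier G) (e ` Nz) > 0" using pin by (simp add: pi_number_def)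
    fix q assume q: "prime q" "q dvd idx (e ` carrier G) (e ` Nz)"
    then have "q dvd card ?A" using pin by (auto simp: pi_number_def prime_divisors_card_def)
    then obtain j where "q dvd p ^ j" using ppB cA by (auto simp: prime_power_of_def)
    then show "q = p" using q(1) p by (metis prime_dvd_power primes_dvd_imp_eq)
  qed
  then show ?thesis by (simp only: eN flip: eB)
qed

end

theorem theorem4:
  fixes G :: "('a, 'b) monoid_scheme" and p :: nat and N P :: "'a set"
  assumes "group G" and "finite (carrier G)"
    and "Factorial_Ring.prime p"
    and "N \<lhd> G"
    and "sylow_subgroup p P (G\<lparr>carrier := N\<rparr>)"
    and "\<And>M. maximal_subgroup M (G\<lparr>carrier := P\<rparr>) \<Longrightarrow> IC_Pi_property G M"
  shows "card P = p \<or> N \<subseteq> pU_hypercenter p G"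
proof (rule disjCI)
  assume notin: "\<not> N \<subseteq> pU_hypercenter p G"
  interpret group G by fact
  obtain e :: "'a \<Rightarrow> 'a symmetric" where e: "inj_on e (carrier G)"
    "\<forall>x\<in>carrier G. \<forall>y\<in>carrier G. e (x \<otimes>\<^bsub>G\<^esub> y) = e x * e y"
    using cayley_embedding by blast
  interpret group_embedding G e by unfold_locales (use e in auto)
  note p = assms(3) and finG = assms(2)
  have sN: "subgroup N G" using normal_imp_subgroup[OF assms(4)] .
  have NG: "N \<subseteq> carrier G" using subgroup.subset[OF sN] .
  have sPN: "subgroup P (G\<lparr>carrier := N\<rparr>)" and cP: "card P = p ^ multiplicity p (card N)"
    using assms(5) by (simp_all add: sylow_subgroup_def order_def)
  have sP: "subgroup P G" using incl_subgroup[OF sN sPN] .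
  have PN: "P \<subseteq> N" using subgroup.subset[OF sPN] by simp
  have PG: "P \<subseteq> carrier G" using PN NG by blast
  have eP: "is_subgroup (e ` P)" using subgroup_iff[OF PG] sP by blast
  have eN: "is_subgroup (e ` N)" using subgroup_iff[OF NG] sN by blast
  have finN: "finite (e ` N)" using NG finG finite_subset by blast
  have ppP: "prime_power_of p (card P)" unfolding cP prime_power_of_def by blast
  have syl: "is_sylow p (e ` P) (e ` N)"
    unfolding is_sylow_def
  proof (intro conjI)
    show "prime_power_of p (card (e ` P))" using ppP e_card[OF PG] by simp
    have "card N > 0" using card_subgroup_pos[OF eN finN] e_card[OF NG] by simp
    then obtain m where m: "card N = p ^ multiplicity p (card N) * m" "\<not> p dvd m"
      using multiplicity_decompose'[of "card N" p] p by (metis not_prime_unit not_gr_zero)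
    have "idx (e ` N) (e ` P) = m"
      using m(1) cP e_card[OF NG] e_card[OF PG] p by (metis idx_def nonzero_mult_div_cancel_left not_prime_0 power_not_zero)
    then show "\<not> p dvd idx (e ` N) (e ` P)" using m(2) by simp
  qed (use eP PN in auto)
  interpret S: sylow_setting "e ` carrier G" "e ` N" "e ` P" p
  proof
    show "prime p" "is_subgroup (e ` carrier G)" "finite (e ` carrier G)" using p is_subgroup_carrier finG by auto
    show "is_normal (e ` N) (e ` carrier G)" using normal_iff[OF NG] assms(4) by blast
    show "is_sylow p (e ` P) (e ` N)" by (rule syl)
    fix M' L' K' assume mx: "maxsub M' (e ` P)" and ch: "chief (e ` carrier G) L' K'"
    have "M' \<subseteq> e ` carrier G" using maxsubD(2)[OF mx] PG by blast
    then obtain M where M: "M \<subseteq> carrier G" "M' = e ` M" using image_preimage[of M'] by auto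
    obtain L where L: "L \<subseteq> carrier G" "L' = e ` L"
      using image_preimage[OF is_normalD(2)[OF chiefD(1)[OF ch]]] by auto
    obtain K where K: "K \<subseteq> carrier G" "K' = e ` K"
      using image_preimage[OF is_normalD(2)[OF chiefD(2)[OF ch]]] by auto
    have chG: "chief_factor G L K" using ch chief_iff[OF L(1) K(1)] L K by simp
    have mxM: "maximal_subgroup M (G\<lparr>carrier := P\<rparr>)"
      using maximal_subgroup_if_maxsub[OF sP M(1)] mx M(2) by simp
    let ?C = "commutator_subgroup G M (carrier G)"
    have Pi: "Pi_property G (M \<inter> ?C)" using assms(6)[OF mxM] by (simp add: IC_Pi_property_def)
    have HG: "M \<inter> ?C \<subseteq> carrier G" using M by blast
    have eH: "e ` (M \<inter> ?C) = M' \<inter> com M' (e ` carrier G)"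
      using e_Int[OF M(1) com_image(2)[OF M(1)]] com_image(1)[OF M(1)] M(2) by simp
    have seH: "is_subgroup (e ` (M \<inter> ?C))" unfolding eH by (rule is_subgroup_Int[OF maxsubD(1)[OF mx] com_subgroup])
    have sH: "subgroup (M \<inter> ?C) G" using subgroup_iff[OF HG] seH by blast
    have "card (e ` (M \<inter> ?C)) dvd card (e ` P)"
    proof -
      have "e ` (M \<inter> ?C) \<subseteq> e ` P" using maxsubD(2)[OF mx] M(2) by blast
      then have "card (e ` P) = idx (e ` P) (e ` (M \<inter> ?C)) * card (e ` (M \<inter> ?C))"
        by (rule lagrange_idx[OF seH eP]) (use PG finG finite_subset in blast)
      then show ?thesis by simp
    qed
    then have ppH: "prime_power_of p (card (M \<inter> ?C))"
      using prime_power_of_dvd[OF p ppP] e_card[OF HG] e_card[OF PG] by simp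
    show "prime_power_of p (idx (e ` carrier G) (normalizer_in (e ` carrier G) ((M' \<inter> com M' (e ` carrier G)) * K' \<inter> L')))"
      using Pi_property_prime_power[OF finG p Pi sH ppH chG] eH L(2) K(2) by simp
  qed
  \<comment> \<open>Otherwise \<open>N\<close> would be one of the subgroups generating the
    hypercenter. So a noncyclic \<open>p\<close>-chief factor lies below \<open>N\<close>.\<close>
  have "\<not> pU_hypercentral p G N"
  proof
    assume "pU_hypercentral p G N"
    then have "N \<subseteq> \<Union>{A. pU_hypercentral p G A}" by blast
    then have "N \<subseteq> pU_hypercenter p G" unfolding pU_hypercenter_def by (auto intro: generate.incl)
    then show False using notin by contradiction
  qed
  then obtain L K where ch: "chief_factor G L K" and LN: "L \<subseteq> N" and pd: "p dvd order (quot G L K)"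
    and nc: "\<not> cyclic_group (quot G L K)"
    unfolding pU_hypercentral_def using assms(4) by blast
  have K: "K \<lhd> G" and L: "L \<lhd> G" and KL: "K \<subseteq> L" using ch by (auto simp: chief_factor_def)
  have LG: "L \<subseteq> carrier G" and KG: "K \<subseteq> carrier G" using LN NG KL by blast+
  have sL: "subgroup L G" using normal_imp_subgroup[OF L] .
  have chE: "chief (e ` carrier G) (e ` L) (e ` K)" using ch chief_iff[OF LG KG] by blast
  have "card K > 0"
    using card_subgroup_pos[OF is_normalD(1)[OF chiefD(2)[OF chE]]] e_card[OF KG] finite_subset[OF KG finG] by simp
  then have oq: "order (quot G L K) = idx (e ` L) (e ` K)"
    using card_quot[OF sL K KL] e_card[OF KG] e_card[OF LG]
    by (metis idx_def nonzero_mult_div_cancel_right not_gr_zero order_def)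
  have "group (quot G L K)"
  proof (rule normal.factorgroup_is_group)
    show "K \<lhd> G\<lparr>carrier := L\<rparr>"
      using normal_restrict_supergroup[OF sL K KL] .
  qed
  then have "idx (e ` L) (e ` K) \<noteq> p" using nc group.prime_order_cyclic[of "quot G L K"] oq p by metis
  \<comment> \<open>A noncyclic factor does not have order \<open>p\<close>, so
    \<open>p_chief_prime\<close> excludes \<open>p * p dvd card P\<close>. As \<open>p\<close>
    divides the order of a section of \<open>N\<close>, it divides \<open>card P\<close>, which is
    therefore \<open>p\<close>.\<close>
  then have "\<not> p * p dvd card P"
    using S.p_chief_prime[OF _ chE] LN pd oq e_card[OF PG] by auto
  moreover have "p dvd card P"
  proof (rule ccontr)
    assume "\<not> p dvd card P"
    then have "card P = 1" using prime_power_of_eq_1[OF ppP] by blast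
    then have "idx (e ` N) (e ` P) = card N" using e_card[OF PG] e_card[OF NG] by (simp add: idx_def)
    then have "\<not> p dvd card N" using is_sylowD(4)[OF syl] by simp
    moreover have "p dvd card (e ` N)"
    proof -
      have "idx (e ` L) (e ` K) dvd card (e ` L)"
        using lagrange_idx[OF is_normalD(1)[OF chiefD(2)[OF chE]] is_normalD(1)[OF chiefD(1)[OF chE]] chiefD(3)[OF chE]]
          finite_subset[OF image_mono[OF LN] finN] by (metis dvd_triv_left)
      moreover have "card (e ` L) dvd card (e ` N)"
        using lagrange_idx[OF is_normalD(1)[OF chiefD(1)[OF chE]] eN image_mono[OF LN] finN] by simp
      ultimately show ?thesis using pd oq dvd_trans by metis
    qed
    ultimately show False using e_card[OF NG] by simp
  qed
  ultimately show "card P = p" using prime_power_of_eq_prime[OF p ppP] by blast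
qed

end
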